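(* Let $f\colon G\to J$ be a stable simplicial map from a graph $G$ to a path graph $J$ (that is, a triangulation of a segment). Let $i\colon|J|\hookrightarrow\mathbb{R}^2$ be an embedding. Then the following statements are equivalent: (1) $f$ is approximable by embeddings with respect to $i\colon|J|\to\mathbb{R}^2$; (2) $|f|$ lifts to an embedding.
   Context: Graphs are finite and regarded as one-dimensional simplicial complexes. $|K|$ denotes the geometric realisation and $|f|$ the piecewise linear map induced by a simplicial map $f$. $|f|\colon|G|\to|J|$ lifts to an embedding if there is a piecewise linear embedding $\widetilde{|f|}\colon|G|\to|J|\times\mathbb{R}$ with $|f|=\mathrm{pr}_{|J|}\circ\widetilde{|f|}$. Let $f\colon G\to H$ be a simplicial map between graphs. A vertex $v$ of $G$ is regular with respect to $f$ if $f$ is bijective on the star $\mathrm{st}(v)=\bigcup_{e\in E(G),\,v\in e}e$ (that is, $f$ maps $\mathrm{st}(v)$ bijectively onto $\mathrm{st}(f(v))$). The map $f$ is stable if for any vertex $w\in V(H)$: if $\deg(w)\ne2$, all the vertices in $f^{-1}(w)$ are regular; if $\deg(w)=2$, $f^{-1}(w)$ contains at most one non-regular vertex. Let $f\colon G\to H$ be a simplicial map between graphs and $i\colon|H|\hookrightarrow S$ a continuous embedding into a surface $S$ with a metric $d$ (inducing its topology). $f$ is approximable by embeddings (with respect to $i$) if for every $\varepsilon>0$ there exists a continuous embedding $j\colon|G|\hookrightarrow S$ such that $d(j(x),i(|f|(x)))<\varepsilon$ for every $x\in|G|$. This property does not depend on the choice of the metric; on $\mathbb{R}^2$ one may take the Euclidean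 metric. *)

theory Defs
  imports "HOL-Analysis.Analysis"
begin

text \<open>Vertices are drawn from a finite type, so that the vertices of a graph can serve as the
  standard basis vectors of \<^typ>\<open>real ^ 'v\<close>; the vertex set itself may be any subset of the type.\<close>

datatype 'v graph = Graph (verts: "'v set") (edges: "'v set set")

definition is_graph :: "'v::finite graph \<Rightarrow> bool" where
  "is_graph G \<longleftrightarrow> (\<forall>e\<in>edges G. e \<subseteq> verts G \<and> card e = 2)"

definition simplices :: "'v graph \<Rightarrow> 'v set set" where
  "simplices G = (\<lambda>v. {v}) ` verts G \<union> edges G"

text \<open>Simplicial maps may collapse an edge to a vertex.\<close>

definition simplicial_map :: "'v graph \<Rightarrow> 'w graph \<Rightarrow> ('v \<Rightarrow> 'w) \<Rightarrow> bool" where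
  "simplicial_map G H f \<longleftrightarrow> (\<forall>s\<in>simplices G. f ` s \<in> simplices H)"

definition vdeg :: "'v graph \<Rightarrow> 'v \<Rightarrow> nat" where
  "vdeg G v = card {e \<in> edges G. v \<in> e}"

definition star :: "'v graph \<Rightarrow> 'v \<Rightarrow> 'v set" where
  "star G v = \<Union>{e \<in> edges G. v \<in> e}"

definition regular_vertex :: "'v graph \<Rightarrow> 'w graph \<Rightarrow> ('v \<Rightarrow> 'w) \<Rightarrow> 'v \<Rightarrow> bool" where
  "regular_vertex G H f v \<longleftrightarrow> bij_betw f (star G v) (star H (f v))"

definition stable_map :: "'v::finite graph \<Rightarrow> 'w graph \<Rightarrow> ('v \<Rightarrow> 'w) \<Rightarrow> bool" where
  "stable_map G H f \<longleftrightarrow> (\<forall>w\<in>verts H.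
     (vdeg H w \<noteq> 2 \<longrightarrow> (\<forall>v\<in>verts G. f v = w \<longrightarrow> regular_vertex G H f v)) \<and>
     (vdeg H w = 2 \<longrightarrow> card {v \<in> verts G. f v = w \<and> \<not> regular_vertex G H f v} \<le> 1))"

text \<open>A segment is non-degenerate, so a path graph has at least one edge.\<close>

definition path_graph :: "'v graph \<Rightarrow> bool" where
  "path_graph J \<longleftrightarrow> (\<exists>vs. distinct vs \<and> length vs \<ge> 2 \<and> verts J = set vs \<and>
     edges J = {{vs ! k, vs ! Suc k} | k. Suc k < length vs})"

definition geom :: "'v::finite graph \<Rightarrow> (real ^ 'v) set" where
  "geom G = (\<Union>s\<in>simplices G. convex hull ((\<lambda>v. axis v 1) ` s))"

text \<open>The linear map sending the basis vector of \<open>v\<close> to that of \<open>f v\<close>; on \<^term>\<open>geom G\<close> only the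
  values of \<open>f\<close> on \<^term>\<open>verts G\<close> matter.\<close>

definition geom_map :: "('v::finite \<Rightarrow> 'w::finite) \<Rightarrow> real ^ 'v \<Rightarrow> real ^ 'w" where
  "geom_map f x = (\<Sum>v\<in>UNIV. (x $ v) *\<^sub>R axis (f v) 1)"

text \<open>Piecewise linearity on a compact polyhedron: affine on every simplex of some finite
  triangulation of it. Continuity on \<open>X\<close> follows.\<close>

definition piecewise_linear_on ::
  "'a::euclidean_space set \<Rightarrow> ('a \<Rightarrow> 'b::euclidean_space) \<Rightarrow> bool" where
  "piecewise_linear_on X F \<longleftrightarrow> (\<exists>T. simplicial_complex T \<and> \<Union>T = X \<and>
     (\<forall>S\<in>T. \<exists>c L. linear L \<and> (\<forall>x\<in>S. F x = c + L x)))"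

definition lifts_to_embedding ::
  "'v::finite graph \<Rightarrow> 'w::finite graph \<Rightarrow> ('v \<Rightarrow> 'w) \<Rightarrow> bool" where
  "lifts_to_embedding G J f \<longleftrightarrow> (\<exists>F :: real ^ 'v \<Rightarrow> (real ^ 'w) \<times> real.
     piecewise_linear_on (geom G) F \<and>
     embedding_map (top_of_set (geom G)) (top_of_set (geom J \<times> UNIV)) F \<and>
     (\<forall>x\<in>geom G. geom_map f x = fst (F x)))"

definition approximable_by_embeddings ::
  "'v::finite graph \<Rightarrow> ('v \<Rightarrow> 'w::finite) \<Rightarrow> (real ^ 'w \<Rightarrow> 'c::metric_space) \<Rightarrow> bool" where
  "approximable_by_embeddings G f i \<longleftrightarrow> (\<forall>\<epsilon>>0. \<exists>j :: real ^ 'v \<Rightarrow> 'c.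
     embedding_map (top_of_set (geom G)) euclidean j \<and>
     (\<forall>x\<in>geom G. dist (j x) (i (geom_map f x)) < \<epsilon>))"

end

(* Over each edge of J the edges of G are pairwise disjoint strands, and a lift is the same as a
   choice of distinct heights for the vertices over each vertex of J under which strands do not cross.

   From a lift to approximations: the image arc i(J) has arbitrarily thin embedded ribbons following
   it, and composing the lift with a ribbon gives the required embedding. A ribbon is built around a
   simple path in a fine square grid, namely a shortest walk that follows the arc in increasing time.

   From approximations to a lift: for disjoint curves a, b close to the arc c, the argument of
   b(s) - a(t) over the rectangle of all (s, t) is close to that of c(s) - c(t) for s well above t,
   and to that of c(t) - c(s) up to an odd multiple of pi for s well below t. Whether this multiple
   is positive does not change when the rectangle is shrunk, so it carries the order of strands past
   a vertex. On the middle part of a single edge it agrees with a linear order: project to the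
   direction u from the start of this part to its point T farthest from the start, so that the
   projection of the arc has a strict maximum at T, and compare heights, orthogonally to u, at the
   first time a strand reaches a level slightly below the maximum. Stability makes the
   comparison at every vertex involve a strand that passes straight through. *)

theory Submission
  imports Defs
begin

section \<open>Ribbons around lattice paths\<close>

text \<open>The arc is only continuous. It may spiral or oscillate at every scale, so it has no
  tangents, no evident normal direction and no local sides. A lattice path has straight pieces and
  right angles, hence an explicit transverse direction; injectivity of the arc then controls the
  short cuts of the walk, because times with nearby images are themselves nearby. In the converse,
  "above" has to be measured against something that rotates along with the curves: the differences
  \<open>c s - c t\<close> of the arc with itself. The resulting comparison is stable under changes
  of the rectangle, but neither antisymmetry nor transitivity can be seen from its definition. Both
  come from the real heights \<open>h\<close>, which are chosen before the curves. The middle part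
  of an edge omits a quarter at each end, as strands may meet at vertices. To pass a vertex, a
  rectangle must reach to both sides of it in one of its two variables: one strand has to continue
  there, while the other may shrink to its end point. Of two distinct vertices on a level at least
  one is regular, and this one supplies the continuing strand.\<close>

definition interp :: "nat \<Rightarrow> (nat \<Rightarrow> 'a::real_normed_vector) \<Rightarrow> real \<Rightarrow> 'a" where
  "interp M a r = (\<Sum>k\<le>M. max 0 (1 - \<bar>r - real k\<bar>) *\<^sub>R a k)"

text \<open>A sum of hat functions, in place of a case distinction on segments, makes continuity
  immediate; between two nodes only two hats survive.\<close>

lemma continuous_on_interp [continuous_intros]:
  "continuous_on S g \<Longrightarrow> continuous_on S (\<lambda>x. interp M a (g x))"
  unfolding interp_def by (intro continuous_intros)

lemma interp_segment:
  assumes "j < M" "0 \<le> l" "l \<le> 1"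
  shows "interp M a (real j + l) = (1 - l) *\<^sub>R a j + l *\<^sub>R a (Suc j)"
proof -
  have "interp M a (real j + l) = (\<Sum>k\<in>{j, Suc j}. max 0 (1 - \<bar>real j + l - real k\<bar>) *\<^sub>R a k)"
    unfolding interp_def
  proof (rule sum.mono_neutral_right)
    show "\<forall>k\<in>{..M} - {j, Suc j}. max 0 (1 - \<bar>real j + l - real k\<bar>) *\<^sub>R a k = 0"
    proof
      fix k assume "k \<in> {..M} - {j, Suc j}"
      then have "real k + 1 \<le> real j \<or> real j + 2 \<le> real k" by auto
      then have "1 - \<bar>real j + l - real k\<bar> \<le> 0" using assms by linarith
      then show "max 0 (1 - \<bar>real j + l - real k\<bar>) *\<^sub>R a k = 0" by simp
    qed
  qed (use assms in auto)
  also have "\<dots> = (1 - l) *\<^sub>R a j + l *\<^sub>R a (Suc j)" using assms by simp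
  finally show ?thesis .
qed

lemma interp_nat: "k \<le> M \<Longrightarrow> interp M a (real k) = a k"
proof -
  assume "k \<le> M"
  then have "interp M a (real k) = (\<Sum>k\<in>{k}. a k)"
    unfolding interp_def by (intro sum.mono_neutral_cong_right) auto
  then show ?thesis by simp
qed

lemma segment_index:
  assumes "0 \<le> r" "r \<le> real M" "0 < M"
  obtains j l where "j < M" "0 \<le> l" "l \<le> 1" "r = real j + l"
proof (cases "r = real M")
  case True
  \<comment> \<open>At the right end \<open>l = 1\<close> is used, so that \<open>j\<close> always
    starts a segment.\<close>
  then show ?thesis using that[of "M - 1" 1] assms by (auto simp: of_nat_diff)
next
  case False
  define j where "j = nat \<lfloor>r\<rfloor>"
  have "real j \<le> r" "r < real j + 1" using assms(1) by (auto simp: j_def)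
  moreover have "j < M" using \<open>real j \<le> r\<close> False assms(2) by (metis le_neq_trans of_nat_le_iff of_nat_less_iff order_le_less_trans order_less_le)
  ultimately show ?thesis using that[of j "r - real j"] by auto
qed

section \<open>Unit edges of the square grid and ribbons around them\<close>

definition lattice_point :: "int \<times> int \<Rightarrow> complex" where
  "lattice_point w = Complex (of_int (fst w)) (of_int (snd w))"

definition l1_dist :: "int \<times> int \<Rightarrow> int \<times> int \<Rightarrow> int" where
  "l1_dist v w = \<bar>fst v - fst w\<bar> + \<bar>snd v - snd w\<bar>"

lemma lattice_point_eq_iff [simp]: "lattice_point v = lattice_point w \<longleftrightarrow> v = w"
  by (auto simp: lattice_point_def prod_eq_iff)

lemma lattice_step:
  assumes "l1_dist v w = 1"
  shows "lattice_point w - lattice_point v \<in> {1, -1, \<i>, -\<i>}"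
proof -
  have "fst w = fst v + 1 \<and> snd w = snd v \<or> fst w = fst v - 1 \<and> snd w = snd v \<or>
    fst w = fst v \<and> snd w = snd v + 1 \<or> fst w = fst v \<and> snd w = snd v - 1"
    using assms unfolding l1_dist_def by linarith
  then show ?thesis
    by (elim disjE conjE) (simp_all add: lattice_point_def complex_eq_iff)
qed

text \<open>\<open>cnj F * z\<close> is \<open>z\<close> seen in the frame with \<open>F\<close> as
  positive real axis. There \<open>D + E\<close> is 1 plus one of 1, \<open>\<i>\<close>,
  \<open>- \<i>\<close>, so its left normal has height 1 or 2 and sideways shift at most 1.\<close>

lemma unit_turn:
  assumes "D \<in> {1, -1, \<i>, -\<i>}" "E \<in> {1, -1, \<i>, -\<i>}" "D + E \<noteq> 0" "F \<in> {D, E}"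
  shows "1 \<le> Im (cnj F * (\<i> * (D + E)))" "Im (cnj F * (\<i> * (D + E))) \<le> 2"
    "\<bar>Re (cnj F * (\<i> * (D + E)))\<bar> \<le> 1"
  using assms by auto

lemma norm_unit_turn:
  assumes "D \<in> {1, -1, \<i>, -\<i>}" "E \<in> {1, -1, \<i>, -\<i>}"
  shows "cmod (\<i> * (D + E)) \<le> 2"
proof -
  have "cmod D = 1" "cmod E = 1" using assms by auto
  then show ?thesis using norm_triangle_ineq[of D E] by (simp add: norm_mult)
qed

lemma abs_convex_le:
  fixes p q :: real
  assumes "\<bar>p\<bar> \<le> B" "\<bar>q\<bar> \<le> B" "0 \<le> l" "l \<le> 1"
  shows "\<bar>(1 - l) * p + l * q\<bar> \<le> B"
proof -
  have "\<bar>(1 - l) * p + l * q\<bar> \<le> (1 - l) * \<bar>p\<bar> + l * \<bar>q\<bar>"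
    using assms abs_triangle_ineq[of "(1 - l) * p" "l * q"] by (simp add: abs_mult)
  also have "\<dots> \<le> (1 - l) * B + l * B" using assms by (intro add_mono mult_left_mono) auto
  finally show ?thesis by (simp add: algebra_simps)
qed

lemma norm_convex_le:
  fixes p q :: "'a::real_normed_vector"
  assumes "norm p \<le> B" "norm q \<le> B" "0 \<le> l" "l \<le> 1"
  shows "norm ((1 - l) *\<^sub>R p + l *\<^sub>R q) \<le> B"
proof -
  have "norm ((1 - l) *\<^sub>R p + l *\<^sub>R q) \<le> (1 - l) * norm p + l * norm q"
    using assms norm_triangle_ineq[of "(1 - l) *\<^sub>R p" "l *\<^sub>R q"] by simp
  also have "\<dots> \<le> (1 - l) * B + l * B" using assms by (intro add_mono mult_left_mono) auto
  finally show ?thesis by (simp add: algebra_simps)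
qed

text \<open>In the frame of an edge a ribbon piece is
  \<open>l + s * ((1 - l) * (p + a * \<i>) + l * (q + b * \<i>))\<close>. The imaginary parts give
  \<open>\<bar>s - s'\<bar> \<le> \<bar>m - l\<bar> / 8\<close>; inserted into the real parts, this
  bounds \<open>\<bar>m - l\<bar>\<close> by 3/8 of itself.\<close>

lemma bilinear_quad_inj:
  fixes l m s s' p q a b :: real
  assumes "\<bar>p\<bar> \<le> 1" "\<bar>q\<bar> \<le> 1" "1 \<le> a" "a \<le> 2" "1 \<le> b" "b \<le> 2"
    and s: "\<bar>s'\<bar> \<le> 1/8" and l: "0 \<le> l" "l \<le> 1"
    and im: "s * ((1 - l) * a + l * b) = s' * ((1 - m) * a + m * b)"
    and re: "l + s * ((1 - l) * p + l * q) = m + s' * ((1 - m) * p + m * q)"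
  shows "l = m" "s = s'"
proof -
  define A where "A = (1 - l) * a + l * b"
  have "A = 1 + (1 - l) * (a - 1) + l * (b - 1)" by (simp add: A_def algebra_simps)
  moreover have "(1 - l) * (a - 1) \<ge> 0" "l * (b - 1) \<ge> 0" using assms by auto
  ultimately have A: "A \<ge> 1" by linarith
  have "(s - s') * A = s' * ((b - a) * (m - l))" using im by (simp add: A_def algebra_simps)
  then have "\<bar>s - s'\<bar> * A = \<bar>s'\<bar> * (\<bar>b - a\<bar> * \<bar>m - l\<bar>)" using A by (metis abs_mult abs_of_nonneg order_trans zero_le_one)
  also have "\<dots> \<le> 1/8 * (1 * \<bar>m - l\<bar>)" using assms by (intro mult_mono mult_right_mono) auto
  finally have "\<bar>s - s'\<bar> * A \<le> 1/8 * \<bar>m - l\<bar>" by simp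
  moreover have "\<bar>s - s'\<bar> * 1 \<le> \<bar>s - s'\<bar> * A" using A by (intro mult_left_mono) auto
  ultimately have d: "\<bar>s - s'\<bar> \<le> 1/8 * \<bar>m - l\<bar>" by (metis mult_1_right order_trans)
  have "m - l = (s - s') * ((1 - l) * p + l * q) + s' * ((q - p) * (l - m))"
    using re by (simp add: algebra_simps)
  then have "\<bar>m - l\<bar> \<le> \<bar>s - s'\<bar> * \<bar>(1 - l) * p + l * q\<bar> + \<bar>s'\<bar> * (\<bar>q - p\<bar> * \<bar>l - m\<bar>)"
    by (metis abs_mult abs_triangle_ineq)
  also have "\<dots> \<le> (1/8 * \<bar>m - l\<bar>) * 1 + 1/8 * (2 * \<bar>l - m\<bar>)"
    using d s assms abs_convex_le[of p 1 q l] by (intro add_mono mult_mono mult_right_mono) auto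
  also have "\<dots> = 3/8 * \<bar>m - l\<bar>" by (simp add: abs_minus_commute[of l m])
  finally have "\<bar>m - l\<bar> = 0" using abs_ge_zero[of "m - l"] by simp
  then show "l = m" by simp
  then show "s = s'" using d by simp
qed

text \<open>The projections of the two edges to one axis are intervals with integer ends; if they
  contain points less than 1 apart, they intersect.\<close>

lemma lattice_coordinate:
  fixes x x' d d' :: int and l m :: real
  assumes "\<bar>(of_int x + l * of_int d) - (of_int x' + m * of_int d')\<bar> < 1"
    and "\<bar>d\<bar> \<le> 1" "\<bar>d'\<bar> \<le> 1" "0 \<le> l" "l \<le> 1" "0 \<le> m" "m \<le> 1"
  shows "x - x' \<le> max 0 d' - min 0 d" "min 0 d' - max 0 d \<le> x - x'"
proof -
  have bounds: "of_int (min 0 d) \<le> l * of_int d \<and> l * of_int d \<le> (of_int (max 0 d) :: real)"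
    if "\<bar>d\<bar> \<le> 1" "0 \<le> l" "l \<le> 1" for d :: int and l :: real
  proof -
    have "d = 0 \<or> d = 1 \<or> d = -1" using that by linarith
    then show ?thesis using that by auto
  qed
  have "of_int x - of_int x' < (of_int (max 0 d' - min 0 d + 1) :: real)"
    "(of_int (min 0 d' - max 0 d - 1) :: real) < of_int x - of_int x'"
    using bounds[of d l] bounds[of d' m] assms unfolding of_int_add of_int_diff of_int_1 by linarith+
  then have "x - x' < max 0 d' - min 0 d + 1" "min 0 d' - max 0 d - 1 < x - x'"
    by (metis of_int_diff of_int_less_iff)+
  then show "x - x' \<le> max 0 d' - min 0 d" "min 0 d' - max 0 d \<le> x - x'" by linarith+
qed

text \<open>\<open>(x, y)\<close> is the difference of the starting points, and the alternatives are
  the four ways to share an end point. Only finitely many positions have to be enumerated.\<close>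

lemma unit_edges_meet:
  fixes x y d e d' e' :: int
  assumes "\<bar>d\<bar> + \<bar>e\<bar> = 1" "\<bar>d'\<bar> + \<bar>e'\<bar> = 1"
    and "x \<le> max 0 d' - min 0 d" "min 0 d' - max 0 d \<le> x"
    and "y \<le> max 0 e' - min 0 e" "min 0 e' - max 0 e \<le> y"
  shows "(x = 0 \<and> y = 0) \<or> (x = d' \<and> y = e') \<or> (x = - d \<and> y = - e) \<or> (x = d' - d \<and> y = e' - e)"
proof -
  have u: "(d = 1 \<and> e = 0) \<or> (d = -1 \<and> e = 0) \<or> (d = 0 \<and> e = 1) \<or> (d = 0 \<and> e = -1)"
    if "\<bar>d\<bar> + \<bar>e\<bar> = 1" for d e :: int
  proof -
    have "d = 0 \<or> d = 1 \<or> d = -1" "e = 0 \<or> e = 1 \<or> e = -1" using that by linarith+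
    then show ?thesis using that by auto
  qed
  have "\<bar>d\<bar> \<le> 1" "\<bar>e\<bar> \<le> 1" "\<bar>d'\<bar> \<le> 1" "\<bar>e'\<bar> \<le> 1" using assms(1,2) by linarith+
  then have "\<bar>x\<bar> \<le> 2" "\<bar>y\<bar> \<le> 2" using assms(3-6) by (simp_all add: max_def min_def split: if_splits)
  then have "x = -2 \<or> x = -1 \<or> x = 0 \<or> x = 1 \<or> x = 2" "y = -2 \<or> y = -1 \<or> y = 0 \<or> y = 1 \<or> y = 2"
    by linarith+
  then show ?thesis
    using u[OF assms(1)] u[OF assms(2)] assms(3-6) by (elim disjE conjE) simp_all
qed

text \<open>The bound holds already for the maximum norm: otherwise the projections to both axes
  would meet, which forces a common end point.\<close>

lemma lattice_edges_far:
  assumes "l1_dist v w = 1" "l1_dist v' w' = 1" "{v, w} \<inter> {v', w'} = {}"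
    and "0 \<le> l" "l \<le> 1" "0 \<le> m" "m \<le> 1"
  shows "1 \<le> cmod ((1 - l) *\<^sub>R lattice_point v + l *\<^sub>R lattice_point w
    - ((1 - m) *\<^sub>R lattice_point v' + m *\<^sub>R lattice_point w'))" (is "1 \<le> cmod ?z")
proof (rule ccontr)
  assume "\<not> 1 \<le> cmod ?z"
  then have "\<bar>Re ?z\<bar> < 1" "\<bar>Im ?z\<bar> < 1" using abs_Re_le_cmod[of ?z] abs_Im_le_cmod[of ?z] by linarith+
  then have r: "\<bar>(of_int (fst v) + l * of_int (fst w - fst v)) - (of_int (fst v') + m * of_int (fst w' - fst v'))\<bar> < 1"
    and i: "\<bar>(of_int (snd v) + l * of_int (snd w - snd v)) - (of_int (snd v') + m * of_int (snd w' - snd v'))\<bar> < 1"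
    by (simp_all add: lattice_point_def algebra_simps)
  have b: "\<bar>fst w - fst v\<bar> \<le> 1" "\<bar>snd w - snd v\<bar> \<le> 1" "\<bar>fst w' - fst v'\<bar> \<le> 1" "\<bar>snd w' - snd v'\<bar> \<le> 1"
    using assms(1,2) by (auto simp: l1_dist_def)
  note c = lattice_coordinate[OF r b(1,3) assms(4-7)] lattice_coordinate[OF i b(2,4) assms(4-7)]
  have "\<bar>fst w - fst v\<bar> + \<bar>snd w - snd v\<bar> = 1" "\<bar>fst w' - fst v'\<bar> + \<bar>snd w' - snd v'\<bar> = 1"
    using assms(1,2) by (auto simp: l1_dist_def)
  from unit_edges_meet[OF this c] have "v = v' \<or> v = w' \<or> w = v' \<or> w = w'"
    unfolding prod_eq_iff by (elim disjE conjE) (simp_all only: diff_eq_eq, linarith+)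
  then show False using assms(3) by auto
qed

text \<open>Displacements have length at most 2 and are scaled by at most 1/8, so ribbon points stay
  within 1/4 of the path, while disjoint edges are 1 apart. Over one edge the ribbon is a bilinear
  quadrilateral, and quadrilaterals of consecutive edges are separated by the line through their
  common cross-section.\<close>

lemma ribbon_injective:
  fixes w :: "nat \<Rightarrow> int \<times> int"
  assumes inj: "inj_on w {..M}" and step: "\<And>k. k < M \<Longrightarrow> l1_dist (w k) (w (Suc k)) = 1" and M: "0 < M"
  obtains V where "\<And>k. k \<le> M \<Longrightarrow> cmod (V k) \<le> 2"
    "inj_on (\<lambda>(r, s). interp M (lattice_point \<circ> w) r + s *\<^sub>R interp M V r) ({0..real M} \<times> {-(1/8)..1/8})"
proof -
  define q where "q = lattice_point \<circ> w"
  define D where "D k = q (Suc k) - q k" for k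
  \<comment> \<open>\<open>V k\<close> points strictly to the left of both segments at \<open>k\<close>; \<open>k - 1\<close> and \<open>min\<close> truncate at the ends.\<close>
  define V where "V k = \<i> * (D (k - 1) + D (min k (M - 1)))" for k
  define P where "P = (\<lambda>(r, s). interp M q r + s *\<^sub>R interp M V r)"
  have D: "D k \<in> {1, -1, \<i>, -\<i>}" if "k < M" for k
    unfolding D_def q_def using lattice_step[OF step[OF that]] by simp
  \<comment> \<open>At the ends both summands agree; inside, a zero sum would be a reversal,
    returning to a point already visited.\<close>
  have DD: "D (k - 1) + D (min k (M - 1)) \<noteq> 0" if "k \<le> M" for k
  proof -
    have "k = 0 \<or> k = M \<or> (\<exists>j. k = Suc j \<and> Suc j < M)" using that by (cases k) auto
    then consider "k = 0" | "k = M" | j where "k = Suc j" "Suc j < M" by blast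
    then show ?thesis
    proof cases
      case 1 then show ?thesis using D[of 0] M by auto
    next
      case 2 then show ?thesis using D[of "M - 1"] M by auto
    next
      case (3 j)
      have "q (Suc (Suc j)) \<noteq> q j"
        using inj_onD[OF inj, of "Suc (Suc j)" j] 3 by (auto simp: q_def)
      then show ?thesis using 3 by (simp add: D_def min_def)
    qed
  qed
  have Vn: "cmod (V k) \<le> 2" if "k \<le> M" for k
    unfolding V_def using that M by (intro norm_unit_turn D) auto
  have turn: "1 \<le> Im (cnj F * V k)" "Im (cnj F * V k) \<le> 2" "\<bar>Re (cnj F * V k)\<bar> \<le> 1"
    if "k \<le> M" "F = D (k - 1) \<or> F = D (min k (M - 1))" for k F
  proof -
    have "D (k - 1) \<in> {1, -1, \<i>, -\<i>}" "D (min k (M - 1)) \<in> {1, -1, \<i>, -\<i>}"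
      using that(1) M by (auto intro!: D simp del: insert_iff)
    note unit_turn[OF this DD[OF that(1)], of F]
    then show "1 \<le> Im (cnj F * V k)" "Im (cnj F * V k) \<le> 2" "\<bar>Re (cnj F * V k)\<bar> \<le> 1"
      using that(2) unfolding V_def by blast+
  qed
  have minj: "min j (M - 1) = j" if "j < M" for j using that by (simp add: min_def)
  have P: "P (real j + l, s) = q j + l *\<^sub>R D j + s *\<^sub>R ((1 - l) *\<^sub>R V j + l *\<^sub>R V (Suc j))"
    if "j < M" "0 \<le> l" "l \<le> 1" for j l s
    unfolding P_def prod.case interp_segment[OF that] by (simp add: D_def algebra_simps)
  have P2: "P (real j + l, s) = q (Suc j) - (1 - l) *\<^sub>R D j + s *\<^sub>R ((1 - l) *\<^sub>R V j + l *\<^sub>R V (Suc j))"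
    if "j < M" "0 \<le> l" "l \<le> 1" for j l s
    using P[OF that, of s] by (simp add: D_def algebra_simps)
  have D1: "cnj (D j) * D j = 1" if "j < M" for j using D[OF that] by auto
  have same: "l = m \<and> s = s'"
    if "j < M" "0 \<le> l" "l \<le> 1" "0 \<le> m" "m \<le> 1" "\<bar>s\<bar> \<le> 1/8" "\<bar>s'\<bar> \<le> 1/8"
      "P (real j + l, s) = P (real j + m, s')" for j l m s s'
  proof -
    let ?a = "cnj (D j) * V j" and ?b = "cnj (D j) * V (Suc j)"
    have "cnj (D j) * (P (real j + l, s) - q j) = cnj (D j) * (P (real j + m, s') - q j)" using that by simp
    moreover have "cnj (D j) * (P (real j + l, s) - q j) = of_real l + s *\<^sub>R ((1 - l) *\<^sub>R ?a + l *\<^sub>R ?b)"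
      if "0 \<le> l" "l \<le> 1" for l s
    proof -
      have "cnj (D j) * (P (real j + l, s) - q j) = l *\<^sub>R (cnj (D j) * D j) + s *\<^sub>R ((1 - l) *\<^sub>R ?a + l *\<^sub>R ?b)"
        unfolding P[OF \<open>j < M\<close> that] by (simp add: algebra_simps)
      then show ?thesis using D1[OF \<open>j < M\<close>] by (simp add: of_real_def)
    qed
    ultimately have eq: "of_real l + s *\<^sub>R ((1 - l) *\<^sub>R ?a + l *\<^sub>R ?b) = of_real m + s' *\<^sub>R ((1 - m) *\<^sub>R ?a + m *\<^sub>R ?b)"
      using that by metis
    have ta: "1 \<le> Im ?a" "Im ?a \<le> 2" "\<bar>Re ?a\<bar> \<le> 1"       using turn[of j "D j"] that(1) minj[OF that(1)] by (auto simp del: times_complex.sel)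
    have tb: "1 \<le> Im ?b" "Im ?b \<le> 2" "\<bar>Re ?b\<bar> \<le> 1"       using turn[of "Suc j" "D j"] that(1) by (auto simp del: times_complex.sel)
    have "l = m" "s = s'"
      using bilinear_quad_inj[OF ta(3) tb(3) ta(1,2) tb(1,2) that(7) that(2,3), of s m]
        arg_cong[OF eq, of Re] arg_cong[OF eq, of Im] by simp_all
    then show ?thesis by simp
  qed
  have adjacent: "l = 1 \<and> m = 0 \<and> s = s'"
    if "Suc j < M" "0 \<le> l" "l \<le> 1" "0 \<le> m" "m \<le> 1" "\<bar>s\<bar> \<le> 1/8" "\<bar>s'\<bar> \<le> 1/8"
      "P (real j + l, s) = P (real (Suc j) + m, s')" for j l m s s'
  proof -
    let ?v = "V (Suc j)"
    \<comment> \<open>The signed area spanned by \<open>z\<close> and the common cross-section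
      \<open>?v\<close>. Taken relative to \<open>q (Suc j)\<close>, it is at most 0 on the earlier
      quadrilateral and at least 0 on the later one.\<close>
    define cr where "cr z = Im (cnj z * ?v)" for z
    have crlin: "cr (x + y) = cr x + cr y" "cr (x - y) = cr x - cr y" "cr (t *\<^sub>R x) = t * cr x" for x y t
      by (simp_all add: cr_def algebra_simps)
    have crv: "cr ?v = 0" by (simp add: cr_def)
    have crD: "cr (D j) \<ge> 1" "cr (D (Suc j)) \<ge> 1"
      unfolding cr_def using turn[of "Suc j" "D j"] turn[of "Suc j" "D (Suc j)"] that(1) minj[OF that(1)] by (auto simp del: times_complex.sel)
    \<comment> \<open>1/8 * 2 * 2 is half of the lower bound 1 for \<open>cr (D j)\<close>, so the
      tilt of the other cross-section cannot carry a quadrilateral across the line.\<close>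
    have crn: "\<bar>t * cr (V k)\<bar> \<le> 1/2" if "k \<le> M" "\<bar>t\<bar> \<le> 1/8" for k t
    proof -
      have "\<bar>cr (V k)\<bar> \<le> cmod (V k) * cmod ?v"
        unfolding cr_def using abs_Im_le_cmod[of "cnj (V k) * ?v"] by (simp add: norm_mult)
      also have "\<dots> \<le> 2 * 2" using Vn[of k] Vn[of "Suc j"] \<open>Suc j < M\<close> that by (intro mult_mono) auto
      finally have "\<bar>t\<bar> * \<bar>cr (V k)\<bar> \<le> 1/8 * 4" using that by (intro mult_mono) auto
      then show ?thesis by (simp add: abs_mult)
    qed
    have eq: "s *\<^sub>R ((1 - l) *\<^sub>R V j + l *\<^sub>R ?v) - (1 - l) *\<^sub>R D j
        = m *\<^sub>R D (Suc j) + s' *\<^sub>R ((1 - m) *\<^sub>R ?v + m *\<^sub>R V (Suc (Suc j)))"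
    proof -
      have cancel: "y - x = u + v" if "p - x + y = p + u + v" for p x y u v :: complex
        using that by (simp add: algebra_simps)
      show ?thesis
        by (rule cancel, use that(8) P2[of j l s] P[of "Suc j" m s'] that(1-5) in simp)
    qed
    have cc: "(1 - l) * (s * cr (V j) - cr (D j)) = m * (cr (D (Suc j)) + s' * cr (V (Suc (Suc j))))"
      using arg_cong[OF eq, of cr] by (simp add: crlin crv algebra_simps)
    have "s * cr (V j) - cr (D j) \<le> - (1/2)" "cr (D (Suc j)) + s' * cr (V (Suc (Suc j))) \<ge> 1/2"
      using crn[of j s] crn[of "Suc (Suc j)" s'] crD that by auto
    then have "(1 - l) * (s * cr (V j) - cr (D j)) \<le> (1 - l) * (- (1/2))"
      "m * (1/2) \<le> m * (cr (D (Suc j)) + s' * cr (V (Suc (Suc j))))"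
      using that by (intro mult_left_mono; simp)+
    then have "m * (1/2) \<le> (1 - l) * (- (1/2))" using cc by (metis order_trans)
    then have "m \<le> l - 1" by (simp add: field_simps)
    then have lm: "l = 1" "m = 0" using \<open>l \<le> 1\<close> \<open>0 \<le> m\<close> by linarith+
    have "?v \<noteq> 0" using crD by (auto simp: cr_def)
    then have "s = s'" using eq lm by simp
    then show ?thesis using lm by simp
  qed
  have far: False
    if "Suc j < k" "k < M" "0 \<le> l" "l \<le> 1" "0 \<le> m" "m \<le> 1" "\<bar>s\<bar> \<le> 1/8" "\<bar>s'\<bar> \<le> 1/8"
      "P (real j + l, s) = P (real k + m, s')" for j k l m s s'
  proof -
    have small: "cmod (s *\<^sub>R ((1 - l) *\<^sub>R V j + l *\<^sub>R V (Suc j))) \<le> 1/8 * 2"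
      if "j < M" "0 \<le> l" "l \<le> 1" "\<bar>s\<bar> \<le> 1/8" for j l s
      unfolding norm_scaleR using that Vn by (intro mult_mono norm_convex_le) auto
    have "1 \<le> cmod ((1 - l) *\<^sub>R lattice_point (w j) + l *\<^sub>R lattice_point (w (Suc j))
      - ((1 - m) *\<^sub>R lattice_point (w k) + m *\<^sub>R lattice_point (w (Suc k))))"
    proof (rule lattice_edges_far)
      have "w a \<noteq> w b" if "a \<le> M" "b \<le> M" "a \<noteq> b" for a b using inj_onD[OF inj, of a b] that by auto
      then show "{w j, w (Suc j)} \<inter> {w k, w (Suc k)} = {}" using that(1,2) by auto
    qed (use that step in auto)
    also have "(1 - l) *\<^sub>R lattice_point (w j) + l *\<^sub>R lattice_point (w (Suc j)) = q j + l *\<^sub>R D j"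
      by (simp add: q_def D_def algebra_simps)
    also have "(1 - m) *\<^sub>R lattice_point (w k) + m *\<^sub>R lattice_point (w (Suc k)) = q k + m *\<^sub>R D k"
      by (simp add: q_def D_def algebra_simps)
    also have "q j + l *\<^sub>R D j - (q k + m *\<^sub>R D k) =
      s' *\<^sub>R ((1 - m) *\<^sub>R V k + m *\<^sub>R V (Suc k)) - s *\<^sub>R ((1 - l) *\<^sub>R V j + l *\<^sub>R V (Suc j))"
    proof -
      have cancel: "x - y = v - u" if "x + u = y + v" for x y u v :: complex
        using that by (simp add: algebra_simps)
      show ?thesis
        by (rule cancel, use that(9) P[of j l s] P[of k m s'] that(1-6) in simp)
    qed
    also have "cmod \<dots> \<le> 1/8 * 2 + 1/8 * 2"
      by (rule order_trans[OF norm_triangle_ineq4 add_mono]; rule small) (use that in auto)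
    finally show False by simp
  qed
  have "inj_on P ({0..real M} \<times> {-(1/8)..1/8})"
  proof (rule inj_onI, clarify)
    fix r s r' s' :: real
    assume r: "r \<in> {0..real M}" "s \<in> {-(1/8)..1/8}" "r' \<in> {0..real M}" "s' \<in> {-(1/8)..1/8}"
      and eq: "P (r, s) = P (r', s')"
    obtain j l where j: "j < M" "0 \<le> l" "l \<le> 1" "r = real j + l"
      using segment_index[of r M] r M by auto
    obtain k m where k: "k < M" "0 \<le> m" "m \<le> 1" "r' = real k + m"
      using segment_index[of r' M] r M by auto
    have s: "\<bar>s\<bar> \<le> 1/8" "\<bar>s'\<bar> \<le> 1/8" using r by auto
    consider "j = k" | "k = Suc j" | "Suc j < k" | "j = Suc k" | "Suc k < j" by linarith
    then show "r = r' \<and> s = s'"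
    proof cases
      case 1 then show ?thesis using same[of j l m s s'] j k s eq by auto
    next
      case 2 then show ?thesis using adjacent[of j l m s s'] j k s eq by auto
    next
      case 3 then show ?thesis using far[of j k l m s s'] j k s eq by auto
    next
      case 4 then show ?thesis using adjacent[of k m l s' s] j k s eq by auto
    next
      case 5 then show ?thesis using far[of k j m l s' s] j k s eq by auto
    qed
  qed
  then show ?thesis using that[of V] Vn unfolding P_def q_def by auto
qed

section \<open>Shortest lattice walks that follow an arc\<close>

lemma separation_of_injective:
  fixes c :: "real \<Rightarrow> complex"
  assumes "continuous_on {p..q} c" "inj_on c {p..q}" "z > 0"
  obtains e where "e > 0" "\<And>s t. s \<in> {p..q} \<Longrightarrow> t \<in> {p..q} \<Longrightarrow> \<bar>s - t\<bar> \<ge> z \<Longrightarrow> e \<le> cmod (c s - c t)"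
proof -
  define K where "K = ({p..q} \<times> {p..q}) \<inter> {x. z \<le> \<bar>fst x - snd x\<bar>}"
  have K: "compact K" unfolding K_def
    by (intro compact_Int_closed compact_Times compact_Icc closed_Collect_le continuous_intros)
  show ?thesis
  proof (cases "K = {}")
    case True
    then show ?thesis using that[of 1] by (fastforce simp: K_def)
  next
    case False
    have "continuous_on K (\<lambda>x. cmod (c (fst x) - c (snd x)))"
      by (intro continuous_intros continuous_on_compose2[OF assms(1)]) (auto simp: K_def)
    from continuous_attains_inf[OF K False this] obtain x where x: "x \<in> K"
      "\<And>y. y \<in> K \<Longrightarrow> cmod (c (fst x) - c (snd x)) \<le> cmod (c (fst y) - c (snd y))" by blast
    have "fst x \<noteq> snd x" using x(1) \<open>z > 0\<close> by (auto simp: K_def)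
    then have "cmod (c (fst x) - c (snd x)) > 0"
      using x(1) inj_onD[OF assms(2), of "fst x" "snd x"] by (auto simp: K_def)
    then show ?thesis using x(2) by (intro that[of "cmod (c (fst x) - c (snd x))"]) (auto simp: K_def)
  qed
qed

text \<open>In a shortest walk no point is repeated, since the stretch between two visits could be
  cut out. A cut keeps each point together with its time and the times in order, so
  \<open>near\<close> and monotonicity survive. Steps of length 0 disappear as well.\<close>

lemma minimal_walk_inj:
  fixes \<tau> :: "nat \<Rightarrow> real" and w :: "nat \<Rightarrow> int \<times> int"
  assumes "\<And>k. k < M \<Longrightarrow> l1_dist (w k) (w (Suc k)) \<le> 1" "\<And>k. k < M \<Longrightarrow> \<tau> k < \<tau> (Suc k)"
    "\<And>k. k \<le> M \<Longrightarrow> near (\<tau> k) (w k)"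
  obtains M' \<tau>' w' where "inj_on w' {..M'}" "w' 0 = w 0" "w' M' = w M"
    "\<And>k. k < M' \<Longrightarrow> l1_dist (w' k) (w' (Suc k)) = 1" "\<And>k. k < M' \<Longrightarrow> \<tau>' k < \<tau>' (Suc k)"
    "\<And>k. k \<le> M' \<Longrightarrow> near (\<tau>' k) (w' k)"
proof -
  define walk where "walk m t v \<longleftrightarrow> v 0 = w 0 \<and> v m = w M \<and> (\<forall>k<m. l1_dist (v k) (v (Suc k)) \<le> 1) \<and>
    (\<forall>k<m. t k < t (Suc k)) \<and> (\<forall>k\<le>m. near (t k) (v k))"
    for m and t :: "nat \<Rightarrow> real" and v :: "nat \<Rightarrow> int \<times> int"
  have "walk M \<tau> w" unfolding walk_def using assms by auto
  then have ex: "\<exists>m t v. walk m t v" by blast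
  define m where "m = (LEAST m. \<exists>t v. walk m t v)"
  obtain t v where W: "walk m t v" unfolding m_def using LeastI_ex[OF ex] by blast
  have min: "m \<le> m'" if "walk m' t' v'" for m' t' v'
    unfolding m_def by (rule Least_le) (use that in blast)
  have tmono: "t a < t b" if "a < b" "b \<le> m" for a b
    using that
  proof (induction b)
    case (Suc b)
    then have "t b < t (Suc b)" using W by (auto simp: walk_def)
    then show ?case using Suc by (cases "a = b") auto
  qed auto
  have no_repeat: "v a \<noteq> v b" if "a < b" "b \<le> m" for a b
  proof
    assume eq: "v a = v b"
    \<comment> \<open>Omits the indices from \<open>a + 1\<close> to \<open>b\<close>. If
      \<open>b = m\<close>, the shorter walk ends at index \<open>a\<close>, where
      \<open>v a = v m\<close>.\<close>
    define g where "g k = (if k \<le> a then k else k + (b - a))" for k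
    have g: "g k \<le> m \<and> (k = m - (b - a) \<longrightarrow> v (g k) = v m)" if "k \<le> m - (b - a)" for k
    proof (cases "k = m - (b - a) \<and> k \<le> a")
      case True
      then have "b = m" "k = a" using \<open>a < b\<close> \<open>b \<le> m\<close> by linarith+
      then show ?thesis using \<open>a < b\<close> eq by (simp add: g_def)
    qed (use that \<open>a < b\<close> \<open>b \<le> m\<close> in \<open>auto simp: g_def\<close>)
    have gstep: "l1_dist (v (g k)) (v (g (Suc k))) \<le> 1 \<and> t (g k) < t (g (Suc k))" if "k < m - (b - a)" for k
    proof (cases "k = a")
      case True
      have "g k = a" "g (Suc k) = Suc b" "b < m" using True \<open>a < b\<close> that by (auto simp: g_def)
      then show ?thesis using W tmono[of a "Suc b"] \<open>a < b\<close> eq by (auto simp: walk_def)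
    next
      case False
      have "g (Suc k) = Suc (g k)" "g k < m" using False that \<open>a < b\<close> by (auto simp: g_def)
      then show ?thesis using W by (auto simp: walk_def)
    qed
    have "walk (m - (b - a)) (t \<circ> g) (v \<circ> g)"
      unfolding walk_def
    proof (intro conjI allI impI)
      show "(v \<circ> g) 0 = w 0" using W by (auto simp: walk_def g_def)
      show "(v \<circ> g) (m - (b - a)) = w M" using W g[of "m - (b - a)"] by (auto simp: walk_def)
      show "near ((t \<circ> g) k) ((v \<circ> g) k)" if "k \<le> m - (b - a)" for k
        using W g[OF that] by (auto simp: walk_def)
    qed (use gstep in auto)
    then have "m \<le> m - (b - a)" by (rule min)
    then show False using that by linarith
  qed
  show ?thesis
  proof (rule that[of v m t])
    show "inj_on v {..m}"
    proof (rule inj_onI)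
      fix x y assume "x \<in> {..m}" "y \<in> {..m}" "v x = v y"
      then show "x = y" using no_repeat[of x y] no_repeat[of y x] by (cases x y rule: linorder_cases) auto
    qed
    show "l1_dist (v k) (v (Suc k)) = 1" if "k < m" for k
    proof -
      have "v k \<noteq> v (Suc k)" using no_repeat[of k "Suc k"] that by auto
      then have "l1_dist (v k) (v (Suc k)) \<noteq> 0" by (auto simp: l1_dist_def prod_eq_iff)
      moreover have "l1_dist (v k) (v (Suc k)) \<ge> 0" by (auto simp: l1_dist_def)
      moreover have "l1_dist (v k) (v (Suc k)) \<le> 1" using W that by (auto simp: walk_def)
      ultimately show ?thesis by linarith
    qed
  qed (use W in \<open>auto simp: walk_def\<close>)
qed

lemma floor_close: "\<bar>x - y\<bar> < 1 \<Longrightarrow> \<bar>\<lfloor>x\<rfloor> - \<lfloor>y\<rfloor>\<bar> \<le> (1::int)" for x y :: real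
  by linarith

text \<open>Rounding both coordinates of successive samples could produce diagonal steps. Each
  sampling interval is therefore split in two: the real part is updated first, the imaginary part
  second.\<close>

lemma lattice_walk:
  fixes c :: "real \<Rightarrow> complex"
  assumes c: "continuous_on {0..1} c" and \<eta>: "0 < \<eta>"
  obtains M \<tau> and w :: "nat \<Rightarrow> int \<times> int" where
    "\<And>k. k < M \<Longrightarrow> l1_dist (w k) (w (Suc k)) \<le> 1" "\<And>k. k < M \<Longrightarrow> \<tau> k < \<tau> (Suc k)"
    "\<And>k. k \<le> M \<Longrightarrow> \<tau> k \<in> {0..1} \<and> cmod (\<eta> *\<^sub>R lattice_point (w k) - c (\<tau> k)) \<le> 4 * \<eta>"
    "cmod (\<eta> *\<^sub>R lattice_point (w 0) - c 0) \<le> 4 * \<eta>" "cmod (\<eta> *\<^sub>R lattice_point (w M) - c 1) \<le> 4 * \<eta>"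
proof -
  obtain d where d: "d > 0" "\<And>s t. s \<in> {0..1} \<Longrightarrow> t \<in> {0..1} \<Longrightarrow> \<bar>s - t\<bar> < d \<Longrightarrow> cmod (c s - c t) < \<eta>"
    using compact_uniformly_continuous[OF c compact_Icc] \<eta>
    unfolding uniformly_continuous_on_def dist_norm real_norm_def by metis
  obtain N where N: "0 < N" "1 / real N < d" using real_arch_inverse d(1) by (metis inverse_eq_divide gr0I)
  define x where "x t = c t /\<^sub>R \<eta>" for t
  have xc: "cmod (x s - x t) < 1" if "s \<in> {0..1}" "t \<in> {0..1}" "\<bar>s - t\<bar> < d" for s t
  proof -
    have "x s - x t = (c s - c t) /\<^sub>R \<eta>" by (simp add: x_def scaleR_diff_right)
    then have "cmod (x s - x t) = cmod (c s - c t) / \<eta>" using \<eta> by (simp add: divide_inverse mult.commute)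
    then show ?thesis using d(2)[OF that] \<eta> by simp
  qed
  then have xr: "\<bar>Re (x s) - Re (x t)\<bar> < 1" "\<bar>Im (x s) - Im (x t)\<bar> < 1"
    if "s \<in> {0..1}" "t \<in> {0..1}" "\<bar>s - t\<bar> < d" for s t
    using that abs_Re_le_cmod[of "x s - x t"] abs_Im_le_cmod[of "x s - x t"] by fastforce+
  define T where "T k = real k / (2 * real N)" for k
  define w where "w k = (\<lfloor>Re (x (T (2 * ((k + 1) div 2))))\<rfloor>, \<lfloor>Im (x (T (2 * (k div 2))))\<rfloor>)" for k
  have T01: "T k \<in> {0..1}" if "k \<le> 2 * N" for k
  proof -
    have "real k \<le> 2 * real N" using that by (metis of_nat_le_iff of_nat_mult of_nat_numeral)
    then show ?thesis using N by (simp add: T_def)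
  qed
  have Td: "\<bar>T a - T b\<bar> < d" if "a \<le> b + 2" "b \<le> a + 2" for a b
  proof -
    have "\<bar>real a - real b\<bar> \<le> 2" using that by linarith
    then have "\<bar>real a - real b\<bar> / (2 * real N) \<le> 2 / (2 * real N)" using N by (intro divide_right_mono) auto
    moreover have "\<bar>T a - T b\<bar> = \<bar>real a - real b\<bar> / (2 * real N)"
      by (simp add: T_def diff_divide_distrib[symmetric])
    ultimately show ?thesis using N by simp
  qed
  \<comment> \<open>In each coordinate rounding costs at most 1 and the shift of the sampling time
    less than 1, which gives 4 for the norm.\<close>
  have near: "cmod (\<eta> *\<^sub>R lattice_point (w k) - c (T k)) \<le> 4 * \<eta>" if "k \<le> 2 * N" for k
  proof -
    have le: "2 * ((k + 1) div 2) \<le> 2 * N" "2 * (k div 2) \<le> 2 * N" using that by presburger+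
    define z where "z = lattice_point (w k) - x (T k)"
    have "\<bar>Re (x (T (2 * ((k + 1) div 2)))) - Re (x (T k))\<bar> < 1" "\<bar>Im (x (T (2 * (k div 2)))) - Im (x (T k))\<bar> < 1"
      by (rule xr; (rule T01 Td; use le that in presburger))+
    then have "\<bar>Re z\<bar> \<le> 2" "\<bar>Im z\<bar> \<le> 2" unfolding z_def lattice_point_def w_def by (simp; linarith)+
    then have "cmod z \<le> 4" using cmod_le[of z] by linarith
    moreover have "\<eta> *\<^sub>R lattice_point (w k) - c (T k) = \<eta> *\<^sub>R z"
      using \<eta> by (simp add: z_def x_def scaleR_diff_right)
    ultimately show ?thesis using \<eta> by simp
  qed
  show ?thesis
  proof (rule that[of "2 * N" w T])
    show "l1_dist (w k) (w (Suc k)) \<le> 1" if "k < 2 * N" for k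
    proof (cases "even k")
      case True
      then have e: "(k + 1) div 2 = k div 2" "(Suc k + 1) div 2 = k div 2 + 1" "Suc k div 2 = k div 2" by auto
      have le: "2 * (k div 2) \<le> 2 * N" "2 * (k div 2 + 1) \<le> 2 * N" using that True by presburger+
      have "\<bar>Re (x (T (2 * (k div 2)))) - Re (x (T (2 * (k div 2 + 1))))\<bar> < 1"
        by (rule xr; (rule T01 Td; use le that in presburger))
      from floor_close[OF this] show ?thesis unfolding l1_dist_def w_def e by simp
    next
      case False
      then have e: "(k + 1) div 2 = k div 2 + 1" "(Suc k + 1) div 2 = k div 2 + 1" "Suc k div 2 = k div 2 + 1" by auto
      have le: "2 * (k div 2) \<le> 2 * N" "2 * (k div 2 + 1) \<le> 2 * N" using that False by presburger+
      have "\<bar>Im (x (T (2 * (k div 2)))) - Im (x (T (2 * (k div 2 + 1))))\<bar> < 1"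
        by (rule xr; (rule T01 Td; use le that in presburger))
      from floor_close[OF this] show ?thesis unfolding l1_dist_def w_def e by simp
    qed
    show "T k < T (Suc k)" for k using N by (simp add: T_def divide_strict_right_mono)
    show "cmod (\<eta> *\<^sub>R lattice_point (w 0) - c 0) \<le> 4 * \<eta>" using near[of 0] by (simp add: T_def)
    show "cmod (\<eta> *\<^sub>R lattice_point (w (2 * N)) - c 1) \<le> 4 * \<eta>" using near[of "2 * N"] N by (simp add: T_def)
  qed (use near T01 in auto)
qed

section \<open>Reparametrising a ribbon by the time of the arc\<close>

lemma strict_mono_on_interp:
  fixes \<tau> :: "nat \<Rightarrow> real"
  assumes "\<And>k. k < M \<Longrightarrow> \<tau> k < \<tau> (Suc k)"
  shows "strict_mono_on {0..real M} (interp M \<tau>)"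
proof (cases "M = 0")
  case True then show ?thesis by (auto simp: strict_mono_on_def)
next
  case False
  have mono: "\<tau> a \<le> \<tau> b" if "a \<le> b" "b \<le> M" for a b
    using that
  proof (induction b)
    case (Suc b)
    then have "\<tau> b < \<tau> (Suc b)" using assms by auto
    then show ?case using Suc by (cases "a = Suc b") auto
  qed auto
  have ev: "interp M \<tau> (real j + l) = \<tau> j + l * (\<tau> (Suc j) - \<tau> j)" if "j < M" "0 \<le> l" "l \<le> 1" for j l
    using interp_segment[OF that, of \<tau>] by (simp add: algebra_simps)
  show ?thesis
  proof (rule strict_mono_onI)
    fix r s assume rs: "r \<in> {0..real M}" "s \<in> {0..real M}" "r < s"
    obtain j l where j: "j < M" "0 \<le> l" "l \<le> 1" "r = real j + l"
      using segment_index[of r M] rs False by auto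
    obtain k m where k: "k < M" "0 \<le> m" "m \<le> 1" "s = real k + m"
      using segment_index[of s M] rs False by auto
    have pos: "\<tau> (Suc j) - \<tau> j > 0" "\<tau> (Suc k) - \<tau> k > 0" using assms j k by auto
    consider "j = k" | "j < k" | "k < j" by linarith
    then show "interp M \<tau> r < interp M \<tau> s"
    proof cases
      case 1
      then have "l < m" using j k rs by auto
      then show ?thesis using ev[OF j(1-3)] ev[OF k(1-3)] pos 1 j k by simp
    next
      case 2
      have a: "interp M \<tau> r = \<tau> (Suc j) - (1 - l) * (\<tau> (Suc j) - \<tau> j)" using ev[OF j(1-3)] j by (simp add: algebra_simps)
      have b: "interp M \<tau> s = \<tau> k + m * (\<tau> (Suc k) - \<tau> k)" using ev[OF k(1-3)] k by simp
      have "(1 - l) * (\<tau> (Suc j) - \<tau> j) \<ge> 0" "m * (\<tau> (Suc k) - \<tau> k) \<ge> 0" using j k pos by auto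
      moreover have "\<tau> (Suc j) \<le> \<tau> k" using mono[of "Suc j" k] 2 k by auto
      moreover have "l < 1 \<or> m > 0 \<or> Suc j < k" using 2 j k rs by linarith
      then have "(1 - l) * (\<tau> (Suc j) - \<tau> j) > 0 \<or> m * (\<tau> (Suc k) - \<tau> k) > 0 \<or> \<tau> (Suc j) < \<tau> k"
      proof (elim disjE)
        assume "Suc j < k"
        then have "\<tau> (Suc j) < \<tau> (Suc (Suc j))" "\<tau> (Suc (Suc j)) \<le> \<tau> k" using assms mono k by auto
        then show ?thesis by linarith
      qed (use pos in auto)
      ultimately show ?thesis unfolding a b by linarith
    next
      case 3
      then have "real k + 1 \<le> real j" by linarith
      then show ?thesis using j k rs by linarith
    qed
  qed
qed

text \<open>\<open>\<sigma>\<close> interpolates the times of the walk, and its inverse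
  \<open>\<rho>\<close> turns the scaled ribbon into one parametrised by the time of the arc. Short
  cuts do no harm: consecutive walk points have arc points within \<open>9 * \<eta> < e\<close>,
  hence times within \<open>z\<close>.\<close>

lemma arc_thickening:
  fixes c :: "real \<Rightarrow> complex"
  assumes c: "continuous_on {0..1} c" "inj_on c {0..1}" and \<epsilon>: "0 < \<epsilon>"
  obtains \<Phi> :: "real \<times> real \<Rightarrow> complex" where
    "continuous_on ({0..1} \<times> {-1..1}) \<Phi>" "inj_on \<Phi> ({0..1} \<times> {-1..1})"
    "\<And>t s. t \<in> {0..1} \<Longrightarrow> s \<in> {-1..1} \<Longrightarrow> cmod (\<Phi> (t, s) - c t) < \<epsilon>"
proof -
  obtain z0 where z0: "z0 > 0" "\<And>s t. s \<in> {0..1} \<Longrightarrow> t \<in> {0..1} \<Longrightarrow> \<bar>s - t\<bar> < z0 \<Longrightarrow> cmod (c s - c t) < \<epsilon> / 2"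
    using compact_uniformly_continuous[OF c(1) compact_Icc] \<epsilon> half_gt_zero
    unfolding uniformly_continuous_on_def dist_norm real_norm_def by metis
  \<comment> \<open>The bound by 1 makes the times 0 and 1 count as far apart.\<close>
  define z where "z = min z0 1"
  have z: "z > 0" "z \<le> 1" "z \<le> z0" using z0(1) by (auto simp: z_def)
  obtain e where e: "e > 0" "\<And>s t. s \<in> {0..1} \<Longrightarrow> t \<in> {0..1} \<Longrightarrow> \<bar>s - t\<bar> \<ge> z \<Longrightarrow> e \<le> cmod (c s - c t)"
    using separation_of_injective[OF c z(1)] by blast
  \<comment> \<open>The 10 gives \<open>8 * \<eta> < e\<close>, which excludes a walk of one point,
    and \<open>9 * \<eta> < e\<close> along a step. The 13 gives
    \<open>2 * \<eta> + 4 * \<eta> + \<epsilon> / 2 < \<epsilon>\<close> in the final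
    estimate.\<close>
  define \<eta> where "\<eta> = min (e / 10) (\<epsilon> / 13)"
  have \<eta>: "\<eta> > 0" "10 * \<eta> \<le> e" "13 * \<eta> \<le> \<epsilon>" using e(1) \<epsilon> by (auto simp: \<eta>_def)
  define near where "near t w \<longleftrightarrow> t \<in> {0..1} \<and> cmod (\<eta> *\<^sub>R lattice_point w - c t) \<le> 4 * \<eta>" for t w
  obtain M0 \<tau>0 w0 where w0: "\<And>k. k < M0 \<Longrightarrow> l1_dist (w0 k) (w0 (Suc k)) \<le> 1" "\<And>k. k < M0 \<Longrightarrow> \<tau>0 k < \<tau>0 (Suc k)"
    "\<And>k. k \<le> M0 \<Longrightarrow> near (\<tau>0 k) (w0 k)" "near 0 (w0 0)" "near 1 (w0 M0)"
  proof (rule lattice_walk[OF c(1) \<eta>(1)])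
    fix M \<tau> and w :: "nat \<Rightarrow> int \<times> int"
    assume "\<And>k. k < M \<Longrightarrow> l1_dist (w k) (w (Suc k)) \<le> 1" "\<And>k. k < M \<Longrightarrow> \<tau> k < \<tau> (Suc k)"
      "\<And>k. k \<le> M \<Longrightarrow> \<tau> k \<in> {0..1} \<and> cmod (\<eta> *\<^sub>R lattice_point (w k) - c (\<tau> k)) \<le> 4 * \<eta>"
      "cmod (\<eta> *\<^sub>R lattice_point (w 0) - c 0) \<le> 4 * \<eta>" "cmod (\<eta> *\<^sub>R lattice_point (w M) - c 1) \<le> 4 * \<eta>"
    then show thesis by (intro that[of M w \<tau>]) (simp_all add: near_def)
  qed
  obtain M \<tau>1 w where w: "inj_on w {..M}" "w 0 = w0 0" "w M = w0 M0"
    "\<And>k. k < M \<Longrightarrow> l1_dist (w k) (w (Suc k)) = 1" "\<And>k. k < M \<Longrightarrow> \<tau>1 k < \<tau>1 (Suc k)"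
    "\<And>k. k \<le> M \<Longrightarrow> near (\<tau>1 k) (w k)"
  proof (rule minimal_walk_inj[where near = near and w = w0 and \<tau> = \<tau>0, OF w0(1-3)])
    fix M' \<tau>' and w' :: "nat \<Rightarrow> int \<times> int"
    assume "inj_on w' {..M'}" "w' 0 = w0 0" "w' M' = w0 M0"
      "\<And>k. k < M' \<Longrightarrow> l1_dist (w' k) (w' (Suc k)) = 1" "\<And>k. k < M' \<Longrightarrow> \<tau>' k < \<tau>' (Suc k)"
      "\<And>k. k \<le> M' \<Longrightarrow> near (\<tau>' k) (w' k)"
    then show thesis by (rule that)
  qed
  have near_dist: "cmod (c s - c t) \<le> \<eta> * cmod (lattice_point v - lattice_point v') + 8 * \<eta>"
    if "near s v" "near t v'" for s t v v'
  proof -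
    have "c s - c t = \<eta> *\<^sub>R (lattice_point v - lattice_point v')
        + (\<eta> *\<^sub>R lattice_point v' - c t) - (\<eta> *\<^sub>R lattice_point v - c s)"
      by (simp add: algebra_simps)
    also have "cmod \<dots> \<le> cmod (\<eta> *\<^sub>R (lattice_point v - lattice_point v')) + 4 * \<eta> + 4 * \<eta>"
      using that norm_triangle_ineq4[of "\<eta> *\<^sub>R (lattice_point v - lattice_point v') + (\<eta> *\<^sub>R lattice_point v' - c t)"
          "\<eta> *\<^sub>R lattice_point v - c s"]
        norm_triangle_ineq[of "\<eta> *\<^sub>R (lattice_point v - lattice_point v')" "\<eta> *\<^sub>R lattice_point v' - c t"]
      unfolding near_def by linarith
    finally show ?thesis using \<eta>(1) by simp
  qed
  have "0 < M"
  proof (rule ccontr)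
    assume "\<not> 0 < M"
    then have "cmod (c 0 - c 1) \<le> 8 * \<eta>" using near_dist[OF w0(4,5)] w(2,3) by simp
    moreover have "e \<le> cmod (c 0 - c 1)" using e(2)[of 0 1] z by auto
    ultimately show False using \<eta> by linarith
  qed
  \<comment> \<open>The end times are reset so that \<open>\<sigma>\<close> covers all of
    \<open>{0..1}\<close>; this is allowed because the walk begins near \<open>c 0\<close> and ends
    near \<open>c 1\<close>.\<close>
  define \<tau> where "\<tau> k = (if k = 0 then 0 else if k = M then 1 else \<tau>1 k)" for k
  have \<tau>near: "near (\<tau> k) (w k)" if "k \<le> M" for k
    using w that w0(4,5) by (auto simp: \<tau>_def)
  have \<tau>01: "\<tau> k \<in> {0..1}" if "k \<le> M" for k using \<tau>near[OF that] by (auto simp: near_def)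
  have \<tau>step: "\<tau> k < \<tau> (Suc k)" if "k < M" for k
    using w(5)[OF that] w(6)[of k] w(6)[of "Suc k"] that by (auto simp: \<tau>_def near_def)
  have step: "l1_dist (w k) (w (Suc k)) = 1" if "k < M" for k using w(4) that .
  obtain V where V: "\<And>k. k \<le> M \<Longrightarrow> cmod (V k) \<le> 2"
    "inj_on (\<lambda>(r, s). interp M (lattice_point \<circ> w) r + s *\<^sub>R interp M V r) ({0..real M} \<times> {-(1/8)..1/8})"
    using ribbon_injective[OF w(1,4) \<open>0 < M\<close>] by blast
  define \<sigma> where "\<sigma> = interp M \<tau>"
  define \<Psi> where "\<Psi> r s = interp M (lattice_point \<circ> w) r + (s / 8) *\<^sub>R interp M V r" for r s
  have close: "cmod (\<eta> *\<^sub>R \<Psi> r s - c (\<sigma> r)) < \<epsilon>" if r: "r \<in> {0..real M}" and s: "s \<in> {-1..1}" for r s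
  proof -
    obtain j l where j: "j < M" "0 \<le> l" "l \<le> 1" "r = real j + l"
      using segment_index[of r M] r \<open>0 < M\<close> by auto
    let ?D = "lattice_point (w (Suc j)) - lattice_point (w j)"
    have D: "cmod ?D = 1" using lattice_step[OF step[OF j(1)]] by auto
    have "\<Psi> r s - lattice_point (w j) = l *\<^sub>R ?D + (s / 8) *\<^sub>R ((1 - l) *\<^sub>R V j + l *\<^sub>R V (Suc j))"
      unfolding \<Psi>_def j(4) interp_segment[OF j(1-3)] by (simp add: algebra_simps)
    also have "cmod \<dots> \<le> 1 * 1 + 1/8 * 2"
      by (rule order_trans[OF norm_triangle_ineq]; unfold norm_scaleR D)
        (use j s V in \<open>intro add_mono mult_mono norm_convex_le; auto\<close>)
    finally have "cmod (\<Psi> r s - lattice_point (w j)) \<le> 2" by simp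
    then have a: "cmod (\<eta> *\<^sub>R (\<Psi> r s - lattice_point (w j))) \<le> 2 * \<eta>" using \<eta>(1) by simp
    have b: "cmod (\<eta> *\<^sub>R lattice_point (w j) - c (\<tau> j)) \<le> 4 * \<eta>" using \<tau>near[of j] j by (auto simp: near_def)
    have "cmod (c (\<tau> (Suc j)) - c (\<tau> j)) \<le> \<eta> * 1 + 8 * \<eta>"
      using near_dist[OF \<tau>near \<tau>near, of "Suc j" j] j D by simp
    also have "\<dots> < e" using \<eta> by linarith
    finally have "\<bar>\<tau> (Suc j) - \<tau> j\<bar> < z" using e(2)[of "\<tau> (Suc j)" "\<tau> j"] \<tau>01[of j] \<tau>01[of "Suc j"] j
      by (meson Suc_leI leD leI less_imp_le)
    moreover have \<sigma>r: "\<sigma> r = \<tau> j + l * (\<tau> (Suc j) - \<tau> j)"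
      unfolding \<sigma>_def j(4) interp_segment[OF j(1-3)] by (simp add: algebra_simps)
    moreover have "0 \<le> l * (\<tau> (Suc j) - \<tau> j)" "l * (\<tau> (Suc j) - \<tau> j) \<le> 1 * (\<tau> (Suc j) - \<tau> j)"
      using j \<tau>step[of j] by (auto intro!: mult_right_mono)
    ultimately have "\<bar>\<tau> j - \<sigma> r\<bar> < z" "\<sigma> r \<in> {0..1}"
      using \<tau>01[of j] \<tau>01[of "Suc j"] j by auto
    then have d: "cmod (c (\<tau> j) - c (\<sigma> r)) < \<epsilon> / 2" using z0(2) z \<tau>01[of j] j by auto
    have "\<eta> *\<^sub>R \<Psi> r s - c (\<sigma> r) = \<eta> *\<^sub>R (\<Psi> r s - lattice_point (w j)) + (\<eta> *\<^sub>R lattice_point (w j) - c (\<tau> j))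
        + (c (\<tau> j) - c (\<sigma> r))"
      by (simp add: algebra_simps)
    also have "cmod \<dots> < 2 * \<eta> + 4 * \<eta> + \<epsilon> / 2"
      using a b d
        norm_triangle_ineq[of "\<eta> *\<^sub>R (\<Psi> r s - lattice_point (w j)) + (\<eta> *\<^sub>R lattice_point (w j) - c (\<tau> j))"
          "c (\<tau> j) - c (\<sigma> r)"]
        norm_triangle_ineq[of "\<eta> *\<^sub>R (\<Psi> r s - lattice_point (w j))" "\<eta> *\<^sub>R lattice_point (w j) - c (\<tau> j)"]
      by linarith
    also have "\<dots> < \<epsilon>" using \<eta> by linarith
    finally show ?thesis .
  qed
  have sm: "strict_mono_on {0..real M} \<sigma>" unfolding \<sigma>_def by (rule strict_mono_on_interp) (rule \<tau>step)
  then have si: "inj_on \<sigma> {0..real M}" by (rule strict_mono_on_imp_inj_on)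
  have sc: "continuous_on {0..real M} \<sigma>" unfolding \<sigma>_def by (intro continuous_intros)
  have s0: "\<sigma> 0 = 0" "\<sigma> (real M) = 1"
    using interp_nat[of 0 M \<tau>] interp_nat[of M M \<tau>] \<open>0 < M\<close> by (auto simp: \<sigma>_def \<tau>_def)
  have im: "{0..1} \<subseteq> \<sigma> ` {0..real M}"
  proof
    fix y :: real assume "y \<in> {0..1}"
    then obtain x where "0 \<le> x" "x \<le> real M" "\<sigma> x = y" using IVT'[of \<sigma> 0 y "real M"] sc s0 by auto
    then show "y \<in> \<sigma> ` {0..real M}" by auto
  qed
  define \<rho> where "\<rho> = the_inv_into {0..real M} \<sigma>"
  have \<rho>: "\<rho> t \<in> {0..real M}" "\<sigma> (\<rho> t) = t" if "t \<in> {0..1}" for t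
  proof -
    have "t \<in> \<sigma> ` {0..real M}" using im that by (rule subsetD)
    then show "\<rho> t \<in> {0..real M}" "\<sigma> (\<rho> t) = t"
      unfolding \<rho>_def by (rule the_inv_into_into[OF si _ order_refl], rule f_the_inv_into_f[OF si])
  qed
  have "continuous_on (\<sigma> ` {0..real M}) \<rho>" unfolding \<rho>_def by (rule continuous_on_inv_into[OF sc compact_Icc si])
  then have \<rho>c: "continuous_on {0..1} \<rho>" using im by (rule continuous_on_subset)
  define \<Phi> where "\<Phi> = (\<lambda>(t, s). \<eta> *\<^sub>R \<Psi> (\<rho> t) s)"
  show ?thesis
  proof (rule that[of \<Phi>])
    show "continuous_on ({0..1} \<times> {-1..1}) \<Phi>"
      unfolding \<Phi>_def \<Psi>_def case_prod_beta
      by (intro continuous_intros continuous_on_compose2[OF \<rho>c]) auto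
    show "cmod (\<Phi> (t, s) - c t) < \<epsilon>" if "t \<in> {0..1}" "s \<in> {-1..1}" for t s
      using close[OF \<rho>(1)[OF that(1)] that(2)] \<rho>(2)[OF that(1)] by (simp add: \<Phi>_def)
    show "inj_on \<Phi> ({0..1} \<times> {-1..1})"
    proof (rule inj_onI, clarify)
      fix t s t' s' :: real assume t: "t \<in> {0..1}" "s \<in> {-1..1}" "t' \<in> {0..1}" "s' \<in> {-1..1}"
        and "\<Phi> (t, s) = \<Phi> (t', s')"
      then have "\<Psi> (\<rho> t) s = \<Psi> (\<rho> t') s'" using \<eta>(1) by (auto simp: \<Phi>_def)
      then have "(\<rho> t, s / 8) = (\<rho> t', s' / 8)"
        by (intro inj_onD[OF V(2)]) (use t \<rho>(1) in \<open>auto simp: \<Psi>_def\<close>)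
      then show "t = t' \<and> s = s'" using \<rho>(2) t by (metis Pair_inject divide_cancel_right zero_neq_numeral)
    qed
  qed
qed

section \<open>The order of disjoint curves along an arc\<close>

text \<open>Here \<open>\<Lambda> (s, t)\<close> is meant to be a continuous logarithm of \<open>c s - c t\<close> for \<open>t < s\<close>. The argument of
  \<open>b s - a t\<close> is normalised at the corner \<open>(s1, t0)\<close>, where \<open>t < s\<close>; at the opposite corner \<open>(s0, t1)\<close> the
  reference is \<open>- (c t1 - c s0)\<close>, so there it exceeds \<open>Im (\<Lambda> (t1, s0))\<close> by nearly an odd multiple of \<open>pi\<close>.\<close>

definition crosses_above ::
  "(real \<times> real \<Rightarrow> complex) \<Rightarrow> (real \<Rightarrow> complex) \<Rightarrow> (real \<Rightarrow> complex) \<Rightarrow> real \<Rightarrow> real \<Rightarrow> real \<Rightarrow> real \<Rightarrow> bool"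
  where "crosses_above \<Lambda> a b s0 s1 t0 t1 \<longleftrightarrow>
    (\<exists>L. continuous_on ({s0..s1} \<times> {t0..t1}) L \<and>
         (\<forall>s\<in>{s0..s1}. \<forall>t\<in>{t0..t1}. exp (L (s, t)) = b s - a t) \<and>
         \<bar>Im (L (s1, t0)) - Im (\<Lambda> (s1, t0))\<bar> < pi / 2 \<and>
         Im (\<Lambda> (t1, s0)) < Im (L (s0, t1)))"

section \<open>Continuous arguments and the values they cannot cross\<close>

lemma connected_less_avoid:
  fixes g :: "'a::topological_space \<Rightarrow> real"
  assumes "connected S" "continuous_on S g" "\<And>x. x \<in> S \<Longrightarrow> g x \<noteq> c"
    and "x \<in> S" "y \<in> S" "g x < c"
  shows "g y < c"
proof (rule ccontr)
  assume "\<not> g y < c"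
  moreover have "connected (g ` S)" using assms connected_continuous_image by blast
  ultimately have "c \<in> g ` S"
    using assms connectedD_interval[of "g ` S" "g x" "g y" c] by auto
  then show False using assms(3) by auto
qed

lemma connected_greater_avoid:
  fixes g :: "'a::topological_space \<Rightarrow> real"
  assumes "connected S" "continuous_on S g" "\<And>x. x \<in> S \<Longrightarrow> g x \<noteq> c"
    and "x \<in> S" "y \<in> S" "g x > c"
  shows "g y > c"
  using connected_less_avoid[of S "\<lambda>x. - g x" "- c" x y] assms
  by (auto intro: continuous_intros)

lemma Re_exp_pos_avoid:
  assumes "Re (exp z) > 0"
  shows "Im z \<noteq> pi/2" "Im z \<noteq> - (pi/2)"
  using assms by (metis Re_exp cos_pi_half less_irrefl mult_zero_right,
    metis Re_exp cos_minus cos_pi_half less_irrefl mult_zero_right)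

lemma Re_exp_neg_avoid: "Re (exp z) < 0 \<Longrightarrow> \<bar>Im z\<bar> > pi/2"
proof (rule ccontr)
  assume "Re (exp z) < 0" "\<not> \<bar>Im z\<bar> > pi/2"
  then have "cos (Im z) \<ge> 0" by (intro cos_ge_zero) linarith+
  then show False using \<open>Re (exp z) < 0\<close> by (simp add: Re_exp mult_less_0_iff)
qed

text \<open>The quotient \<open>u / v\<close> lies in the open unit disc around 1.\<close>

lemma exp_diff_Re_pos:
  assumes "exp z = u" "exp w = v" "cmod (u - v) < cmod v"
  shows "Re (exp (z - w)) > 0"
proof -
  have v: "v \<noteq> 0" using assms(2) by auto
  have "exp (z - w) = 1 + (u - v) / v" using assms v by (simp add: exp_diff field_simps)
  moreover have "cmod ((u - v) / v) < 1" using assms(3) v by (simp add: norm_divide)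
  ultimately show ?thesis
    using abs_Re_le_cmod[of "(u - v)/v"] by (simp add: abs_if split: if_splits)
qed

lemma exp_diff_Re_neg:
  assumes "exp z = u" "exp w = - v" "cmod (u - v) < cmod v"
  shows "Re (exp (z - w)) < 0"
proof -
  have v: "v \<noteq> 0" using assms(2) by auto
  have "exp (z - w) = - (1 + (u - v) / v)" using assms v by (simp add: exp_diff field_simps)
  moreover have "cmod ((u - v) / v) < 1" using assms(3) v by (simp add: norm_divide)
  ultimately show ?thesis
    using abs_Re_le_cmod[of "(u - v)/v"] by (simp add: abs_if split: if_splits)
qed

lemma exp_eq_Im_close:
  assumes "exp z = exp w" "\<bar>Im z - y\<bar> < pi/2" "\<bar>Im w - y\<bar> < pi/2"
  shows "z = w"
proof (rule exp_complex_eqI[OF _ assms(1)])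
  show "\<bar>Im z - Im w\<bar> < 2 * pi" using assms(2,3) pi_gt_zero by linarith
qed

text \<open>The constant \<open>d\<close> is a multiple of \<open>2 * pi * \<i>\<close> that makes
  the value at \<open>p\<close> equal to \<open>w\<close> plus the principal logarithm of
  \<open>g p / v\<close>, a number in the right half-plane.\<close>

lemma normalised_logarithm:
  fixes g :: "real \<times> real \<Rightarrow> complex"
  assumes "continuous_on S g" "convex S" "\<And>x. x \<in> S \<Longrightarrow> g x \<noteq> 0" "p \<in> S"
    and "exp w = v" "cmod (g p - v) < cmod v"
  obtains L where "continuous_on S L" "\<And>x. x \<in> S \<Longrightarrow> exp (L x) = g x" "\<bar>Im (L p) - Im w\<bar> < pi/2"
proof -
  obtain L where L: "continuous_on S L" "\<And>x. x \<in> S \<Longrightarrow> g x = exp (L x)"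
    using continuous_logarithm_on_contractible[OF assms(1) convex_imp_contractible[OF assms(2)] assms(3)]
    by blast
  define q where "q = exp (L p - w)"
  have q: "Re q > 0" unfolding q_def using exp_diff_Re_pos[of "L p" "g p" w v] L assms by auto
  then have "q \<noteq> 0" by auto
  define d where "d = Ln q - (L p - w)"
  have "exp d = 1" using \<open>q \<noteq> 0\<close> by (simp add: d_def exp_diff) (simp add: q_def exp_diff)
  moreover have "\<bar>Im (Ln q)\<bar> < pi/2" using Re_Ln_pos_lt[OF \<open>q \<noteq> 0\<close>] q by auto
  ultimately show ?thesis
    using that[of "\<lambda>x. L x + d"] L
    by (simp add: exp_add continuous_on_add) (simp add: d_def)
qed

lemma convex_halfplanes:
  "convex {(s::real, t::real). s0 \<le> s \<and> s \<le> s1 \<and> t0 \<le> t \<and> t \<le> t1 \<and> t + z \<le> s}" (is "convex ?A")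
  "convex {(s::real, t::real). s0 \<le> s \<and> s \<le> s1 \<and> t0 \<le> t \<and> t \<le> t1 \<and> s + z \<le> t}" (is "convex ?B")
proof -
  have eq: "?A = ({s0..s1} \<times> {t0..t1}) \<inter> {p. (-1, 1) \<bullet> p \<le> - z}"
    "?B = ({s0..s1} \<times> {t0..t1}) \<inter> {p. (1, -1) \<bullet> p \<le> - z}"
    by auto
  show "convex ?A" "convex ?B"
    unfolding eq by (intro convex_Int convex_Times convex_halfspace_le; simp)+
qed

text \<open>Where \<open>t + z \<le> s\<close>, the quotient of \<open>b s - a t\<close> by the
  reference stays in the right half-plane, so the normalisation passes from one corner to the other.
  Where \<open>s + z \<le> t\<close>, the quotient by the swapped reference stays in the left
  half-plane, so the difference of the arguments is never 0 and keeps its sign. Both regions are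
  convex. Degenerate rectangles are included, which lets a strand shrink to a point.\<close>

lemma crosses_above_subrectangle:
  fixes \<Lambda> :: "real \<times> real \<Rightarrow> complex" and a b c :: "real \<Rightarrow> complex"
  assumes \<Lambda>: "continuous_on {(s, t). p \<le> t \<and> t < s \<and> s \<le> q} \<Lambda>"
    "\<And>s t. p \<le> t \<Longrightarrow> t < s \<Longrightarrow> s \<le> q \<Longrightarrow> exp (\<Lambda> (s, t)) = c s - c t"
    and a: "continuous_on {t0..t1} a" and b: "continuous_on {s0..s1} b"
    and disj: "\<And>s t. s \<in> {s0..s1} \<Longrightarrow> t \<in> {t0..t1} \<Longrightarrow> b s \<noteq> a t"
    and close: "\<And>s t. s \<in> {s0..s1} \<Longrightarrow> t \<in> {t0..t1} \<Longrightarrow> \<bar>s - t\<bar> \<ge> z \<Longrightarrow>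
      cmod ((b s - a t) - (c s - c t)) < cmod (c s - c t)"
    and range: "p \<le> s0" "s0 \<le> s0'" "s0' \<le> s1'" "s1' \<le> s1" "s1 \<le> q"
      "p \<le> t0" "t0 \<le> t0'" "t0' \<le> t1'" "t1' \<le> t1" "t1 \<le> q"
    and z: "z > 0" "t0' + z \<le> s1'" "s0' + z \<le> t1'"
  shows "crosses_above \<Lambda> a b s0 s1 t0 t1 \<longleftrightarrow> crosses_above \<Lambda> a b s0' s1' t0' t1'"
proof -
  define R where "R = {s0..s1} \<times> {t0..t1}"
  define U where "U = {(s, t). s0 \<le> s \<and> s \<le> s1 \<and> t0 \<le> t \<and> t \<le> t1 \<and> t + z \<le> s}"
  define D where "D = {(s, t). s0 \<le> s \<and> s \<le> s1 \<and> t0 \<le> t \<and> t \<le> t1 \<and> s + z \<le> t}"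
  have sub: "U \<subseteq> R" "D \<subseteq> R" "{s0'..s1'} \<times> {t0'..t1'} \<subseteq> R"
    using range by (auto simp: U_def D_def R_def)
  have cU: "connected U" and cD: "connected D"
    unfolding U_def D_def by (intro convex_connected convex_halfplanes)+
  have contU: "continuous_on U \<Lambda>"
    by (rule continuous_on_subset[OF \<Lambda>(1)]) (use range z in \<open>auto simp: U_def\<close>)
  have contD: "continuous_on D (\<lambda>(s, t). \<Lambda> (t, s))"
  proof -
    have "continuous_on D (\<Lambda> \<circ> (\<lambda>x. (snd x, fst x)))"
      by (intro continuous_on_compose continuous_intros continuous_on_subset[OF \<Lambda>(1)])
         (use range z in \<open>auto simp: D_def\<close>)
    then show ?thesis by (simp add: o_def case_prod_beta)
  qed
  have mem: "(s1, t0) \<in> U" "(s1', t0') \<in> U" "(s0, t1) \<in> D" "(s0', t1') \<in> D"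
    using range z by (auto simp: U_def D_def)
  have upper: "\<bar>Im (L x) - Im (\<Lambda> x)\<bar> < pi/2 \<longleftrightarrow> \<bar>Im (L y) - Im (\<Lambda> y)\<bar> < pi/2"
    and lower: "Im (\<Lambda> (snd x', fst x')) < Im (L x') \<longleftrightarrow> Im (\<Lambda> (snd y', fst y')) < Im (L y')"
    if L: "continuous_on R L" "\<And>s t. (s, t) \<in> R \<Longrightarrow> exp (L (s, t)) = b s - a t"
      and xy: "x \<in> U" "y \<in> U" "x' \<in> D" "y' \<in> D" for L x y x' y'
  proof -
    have c1: "continuous_on U (\<lambda>x. Im (L x - \<Lambda> x))"
      using L(1) contU sub by (intro continuous_intros) (auto intro: continuous_on_subset)
    have Re_pos: "Re (exp (L x - \<Lambda> x)) > 0" if "x \<in> U" for x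
    proof (cases x)
      case (Pair s t)
      have r: "s \<in> {s0..s1}" "t \<in> {t0..t1}" "t + z \<le> s" "(s,t) \<in> R"
        using that Pair sub by (auto simp: U_def)
      show ?thesis unfolding Pair
      proof (rule exp_diff_Re_pos)
        show "exp (L (s, t)) = b s - a t" using L(2) r by blast
        show "exp (\<Lambda> (s, t)) = c s - c t" using \<Lambda>(2) r range z by auto
        show "cmod ((b s - a t) - (c s - c t)) < cmod (c s - c t)" using close[of s t] r z by auto
      qed
    qed
    note av = Re_exp_pos_avoid[OF Re_pos]
    have "\<bar>Im (L y - \<Lambda> y)\<bar> < pi/2" if "\<bar>Im (L x - \<Lambda> x)\<bar> < pi/2" "x \<in> U" "y \<in> U" for x y
    proof -
      have "Im (L y - \<Lambda> y) < pi/2"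
        using connected_less_avoid[OF cU c1, of "pi/2" x y] av(1) that by (smt (verit))
      moreover have "Im (L y - \<Lambda> y) > -(pi/2)"
        using connected_greater_avoid[OF cU c1, of "-(pi/2)" x y] av(2) that by (smt (verit))
      ultimately show ?thesis by linarith
    qed
    from this[of x y] this[of y x] show "\<bar>Im (L x) - Im (\<Lambda> x)\<bar> < pi/2 \<longleftrightarrow> \<bar>Im (L y) - Im (\<Lambda> y)\<bar> < pi/2"
      using xy by auto
    have c2: "continuous_on D (\<lambda>x. Im (L x - (\<lambda>(s, t). \<Lambda> (t, s)) x))"
      using L(1) contD sub by (intro continuous_intros) (auto intro: continuous_on_subset)
    have Re_neg: "Re (exp (L x - (\<lambda>(s, t). \<Lambda> (t, s)) x)) < 0" if "x \<in> D" for x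
    proof (cases x)
      case (Pair s t)
      have r: "s \<in> {s0..s1}" "t \<in> {t0..t1}" "s + z \<le> t" "(s,t) \<in> R"
        using that Pair sub by (auto simp: D_def)
      show ?thesis unfolding Pair prod.case
      proof (rule exp_diff_Re_neg)
        show "exp (L (s, t)) = b s - a t" using L(2) r by blast
        show "exp (\<Lambda> (t, s)) = - (c s - c t)" using \<Lambda>(2) r range z by auto
        show "cmod ((b s - a t) - (c s - c t)) < cmod (c s - c t)" using close[of s t] r z by auto
      qed
    qed
    have av0: "Im (L x - (\<lambda>(s, t). \<Lambda> (t, s)) x) \<noteq> 0" if "x \<in> D" for x
      using Re_exp_neg_avoid[OF Re_neg[OF that]] pi_gt_zero by linarith
    have "Im (L y' - (\<lambda>(s, t). \<Lambda> (t, s)) y') > 0" if "Im (L x' - (\<lambda>(s, t). \<Lambda> (t, s)) x') > 0" "x' \<in> D" "y' \<in> D" for x' y'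
      using connected_greater_avoid[OF cD c2, of 0 x' y'] av0 that by auto
    from this[of x' y'] this[of y' x'] xy
    show "Im (\<Lambda> (snd x', fst x')) < Im (L x') \<longleftrightarrow> Im (\<Lambda> (snd y', fst y')) < Im (L y')"
      by (auto simp: case_prod_beta)
  qed
  show ?thesis
  proof
    assume "crosses_above \<Lambda> a b s0 s1 t0 t1"
    then obtain L where L: "continuous_on R L" "\<And>s t. (s, t) \<in> R \<Longrightarrow> exp (L (s, t)) = b s - a t"
      "\<bar>Im (L (s1, t0)) - Im (\<Lambda> (s1, t0))\<bar> < pi / 2" "Im (\<Lambda> (t1, s0)) < Im (L (s0, t1))"
      unfolding crosses_above_def R_def by auto
    have "\<bar>Im (L (s1', t0')) - Im (\<Lambda> (s1', t0'))\<bar> < pi / 2" "Im (\<Lambda> (t1', s0')) < Im (L (s0', t1'))"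
      using upper[OF L(1,2) mem] lower[OF L(1,2) mem] L(3,4) by auto
    then show "crosses_above \<Lambda> a b s0' s1' t0' t1'"
      unfolding crosses_above_def using L(1,2) sub(3)
      by (intro exI[of _ L]) (auto intro: continuous_on_subset)
  next
    assume "crosses_above \<Lambda> a b s0' s1' t0' t1'"
    then obtain L' where L': "continuous_on ({s0'..s1'} \<times> {t0'..t1'}) L'"
      "\<And>s t. s \<in> {s0'..s1'} \<Longrightarrow> t \<in> {t0'..t1'} \<Longrightarrow> exp (L' (s, t)) = b s - a t"
      "\<bar>Im (L' (s1', t0')) - Im (\<Lambda> (s1', t0'))\<bar> < pi / 2" "Im (\<Lambda> (t1', s0')) < Im (L' (s0', t1'))"
      unfolding crosses_above_def by auto
    \<comment> \<open>The given logarithm lives on the small rectangle only, so a new one is taken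
      on the large rectangle. The normalisation makes both agree at \<open>(s1', t0')\<close>; their
      difference takes values in the multiples of \<open>2 * pi * \<i>\<close>, so they also agree
      at the opposite corner.\<close>
    have "continuous_on R (\<lambda>x. b (fst x) - a (snd x))"
      unfolding R_def
      by (intro continuous_intros continuous_on_compose2[OF b] continuous_on_compose2[OF a]) auto
    moreover have "convex R" unfolding R_def by (intro convex_Times convex_closed_interval) 
    ultimately obtain L where L: "continuous_on R L" "\<And>x. x \<in> R \<Longrightarrow> exp (L x) = b (fst x) - a (snd x)"
      "\<bar>Im (L (s1, t0)) - Im (\<Lambda> (s1, t0))\<bar> < pi/2"
    proof (rule normalised_logarithm)
      show "b (fst x) - a (snd x) \<noteq> 0" if "x \<in> R" for x using disj that by (auto simp: R_def)
      show "(s1, t0) \<in> R" using mem sub by blast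
      show "exp (\<Lambda> (s1, t0)) = c s1 - c t0" using \<Lambda>(2) range z by auto
      show "cmod (b (fst (s1, t0)) - a (snd (s1, t0)) - (c s1 - c t0)) < cmod (c s1 - c t0)"
        using close[of s1 t0] range z by auto
    qed blast
    have L2: "\<And>s t. (s, t) \<in> R \<Longrightarrow> exp (L (s, t)) = b s - a t" using L(2) by auto
    have n: "\<bar>Im (L (s1', t0')) - Im (\<Lambda> (s1', t0'))\<bar> < pi / 2" using upper[OF L(1) L2 mem] L(3) by auto
    let ?R' = "{s0'..s1'} \<times> {t0'..t1'}"
    have p0: "(s1', t0') \<in> ?R'" "(s0', t1') \<in> ?R'" using range by auto
    have eq0: "L (s1', t0') = L' (s1', t0')"
      by (rule exp_eq_Im_close[OF _ n L'(3)]) (use p0 L'(2) L2 sub in \<open>metis (no_types) SigmaD1 SigmaD2 subsetD\<close>)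
    have disc: "exp (L x - L' x) = 1" if "x \<in> ?R'" for x
    proof -
      have "exp (L x) = exp (L' x)" using that L'(2) L2 sub(3) by (cases x) (metis (no_types) SigmaD1 SigmaD2 subsetD)
      then show ?thesis by (simp add: exp_diff)
    qed
    have "continuous_on ?R' (\<lambda>x. Im (L x - L' x))"
      using L(1) L'(1) sub by (intro continuous_intros) (auto intro: continuous_on_subset)
    moreover have "connected ?R'" by (intro convex_connected convex_Times convex_closed_interval)
    moreover have np: "Im (L x - L' x) \<noteq> pi" "Im (L x - L' x) \<noteq> - pi" if "x \<in> ?R'" for x
      using disc[OF that] by (auto dest!: arg_cong[of _ _ Re] simp: Re_exp) (smt (verit) exp_gt_zero)+
    ultimately have "Im (L (s0', t1') - L' (s0', t1')) < pi" "Im (L (s0', t1') - L' (s0', t1')) > - pi"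
      using connected_less_avoid[of ?R' "\<lambda>x. Im (L x - L' x)" pi "(s1', t0')" "(s0', t1')"]
        connected_greater_avoid[of ?R' "\<lambda>x. Im (L x - L' x)" "-pi" "(s1', t0')" "(s0', t1')"] p0 eq0 pi_gt_zero
      by auto
    then have "L (s0', t1') - L' (s0', t1') = 0"
      using disc[OF p0(2)] exp_complex_eqI[of "L (s0', t1') - L' (s0', t1')" 0] pi_gt_zero
      by (simp add: abs_less_iff)
    then have "Im (\<Lambda> (t1', s0')) < Im (L (s0', t1'))" using L'(4) by simp
    then have "Im (\<Lambda> (t1, s0)) < Im (L (s0, t1))" using lower[OF L(1) L2 mem] by auto
    then show "crosses_above \<Lambda> a b s0 s1 t0 t1"
      unfolding crosses_above_def using L(1,3) L2 unfolding R_def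
      by (intro exI[of _ L]) auto
  qed
qed

text \<open>Leaving \<open>{pi/2..}\<close> would mean entering the interval around 0 on which
  \<open>cos\<close> is positive; \<open>max (g y) 0\<close> is a value inside it that would be
  attained.\<close>

lemma cos_nonpos_stays:
  fixes g :: "'a::topological_space \<Rightarrow> real"
  assumes "connected S" "continuous_on S g" "\<And>x. x \<in> S \<Longrightarrow> cos (g x) \<le> 0"
    and "x \<in> S" "y \<in> S" "g x \<ge> pi/2"
  shows "g y \<ge> pi/2"
proof (rule ccontr)
  assume "\<not> g y \<ge> pi/2"
  moreover have "connected (g ` S)" using assms connected_continuous_image by blast
  ultimately have "max (g y) 0 \<in> g ` S"
    using assms connectedD_interval[of "g ` S" "g y" "g x" "max (g y) 0"] pi_gt_zero by auto
  moreover have "cos (max (g y) 0) > 0"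
    using \<open>\<not> g y \<ge> pi/2\<close> pi_gt_zero by (intro cos_gt_zero_pi) linarith+
  ultimately show False using assms(3) by force
qed

text \<open>A shift by \<open>pi\<close> changes the sign of the cosine, and
  \<open>{-pi/2..pi/2}\<close> is bounded on both sides by the preceding fact.\<close>

lemma cos_nonneg_stays:
  fixes g :: "'a::topological_space \<Rightarrow> real"
  assumes "connected S" "continuous_on S g" "\<And>x. x \<in> S \<Longrightarrow> cos (g x) \<ge> 0"
    and "x \<in> S" "y \<in> S" "\<bar>g x\<bar> \<le> pi/2"
  shows "\<bar>g y\<bar> \<le> pi/2"
proof -
  have "continuous_on S (\<lambda>x. g x + pi)" "continuous_on S (\<lambda>x. - g x + pi)"
    by (intro continuous_intros assms(2))+
  then have "g y + pi \<ge> pi/2" "- g y + pi \<ge> pi/2"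
    using assms cos_nonpos_stays[of S "\<lambda>x. g x + pi" x y] cos_nonpos_stays[of S "\<lambda>x. - g x + pi" x y]
    by (simp_all add: abs_le_iff)
  then show ?thesis by linarith
qed

text \<open>The argument is traced along two sides of the rectangle that ends at the first hits
  \<open>s1\<close> of \<open>b\<close> and \<open>t1\<close> of \<open>a\<close>. On
  \<open>s = s1\<close> the curve \<open>a\<close> has not passed the level, so the argument
  relative to \<open>u\<close> stays in \<open>{-pi/2..pi/2}\<close>. At \<open>(s1, t1)\<close>
  both curves are on the level, and the argument is \<open>pi/2\<close> or \<open>- pi/2\<close>
  according to the heights. On \<open>t = t1\<close> the curve \<open>b\<close> has not passed the
  level, so the argument cannot come back across that value before \<open>s = lo\<close>. As
  \<open>h\<close> does not depend on the pair of curves, the comparison is one of real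
  numbers.\<close>

lemma height_order:
  fixes \<Lambda> :: "real \<times> real \<Rightarrow> complex" and c :: "real \<Rightarrow> complex"
  assumes c: "continuous_on {p..q} c" "inj_on c {p..q}"
    and \<Lambda>: "continuous_on {(s, t). p \<le> t \<and> t < s \<and> s \<le> q} \<Lambda>"
    "\<And>s t. p \<le> t \<Longrightarrow> t < s \<Longrightarrow> s \<le> q \<Longrightarrow> exp (\<Lambda> (s, t)) = c s - c t"
    and range: "p \<le> lo" "lo < hi" "hi \<le> q"
  obtains e h where "e > (0::real)"
    "\<And>a b. \<lbrakk>continuous_on {lo..hi} a; continuous_on {lo..hi} b;
      \<And>t. t \<in> {lo..hi} \<Longrightarrow> cmod (a t - c t) < e; \<And>t. t \<in> {lo..hi} \<Longrightarrow> cmod (b t - c t) < e;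
      \<And>s t. s \<in> {lo..hi} \<Longrightarrow> t \<in> {lo..hi} \<Longrightarrow> b s \<noteq> a t\<rbrakk>
      \<Longrightarrow> (crosses_above \<Lambda> a b lo hi lo hi \<longleftrightarrow> h a < (h b :: real)) \<and> h a \<noteq> h b"
proof -
  have cI: "continuous_on {lo..hi} c" using c(1) range by (auto intro: continuous_on_subset)
  have "continuous_on {lo..hi} (\<lambda>t. cmod (c t - c lo))" by (intro continuous_intros cI)
  from continuous_attains_sup[OF compact_Icc _ this] range obtain T where
    T: "T \<in> {lo..hi}" "\<And>t. t \<in> {lo..hi} \<Longrightarrow> cmod (c t - c lo) \<le> cmod (c T - c lo)" by fastforce
  define u where "u = c T - c lo"
  have "c hi \<noteq> c lo" using inj_onD[OF c(2), of hi lo] range by auto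
  then have u: "u \<noteq> 0" using T(2)[of hi] range by (auto simp: u_def)
  then have "lo < T" using T(1) by (cases "T = lo") (auto simp: u_def)
  define X where "X t = Re (c t / u)" for t
  have cX: "continuous_on {lo..hi} X" unfolding X_def using u by (intro continuous_intros cI) auto
  \<comment> \<open>After translation by \<open>c lo\<close> and division by \<open>u\<close> the
    arc lies in the closed unit disc, whose only point of real part at least 1 is 1 itself, the
    image of \<open>T\<close>.\<close>
  have Xmax: "X t < X T" if t: "t \<in> {lo..hi}" "t \<noteq> T" for t
  proof -
    define w where "w = (c t - c lo) / u"
    have "cmod w \<le> 1" using T(2)[OF t(1)] u by (simp add: w_def norm_divide u_def)
    moreover have "w \<noteq> 1"
      using inj_onD[OF c(2), of t T] t range T(1) u by (auto simp: w_def u_def)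
    ultimately have "Re w < 1"
    proof -
      have r: "(Re w)\<^sup>2 + (Im w)\<^sup>2 \<le> 1"
        using \<open>cmod w \<le> 1\<close> by (simp add: cmod_def)
      show ?thesis
      proof (rule ccontr)
        assume "\<not> Re w < 1"
        then have "(Re w)\<^sup>2 \<ge> 1" by simp
        then have "(Im w)\<^sup>2 \<le> 0" "(Re w)\<^sup>2 \<le> 1" using r zero_le_power2[of "Im w"] by linarith+
        then have "Im w = 0" "Re w = 1" using \<open>\<not> Re w < 1\<close> by (auto simp: power2_le_iff_abs_le abs_square_le_1)
        then show False using \<open>w \<noteq> 1\<close> by (simp add: complex_eq_iff)
      qed
    qed
    moreover have "X T - X t = 1 - Re w"
    proof -
      have "c T / u - c t / u = (u - (c t - c lo)) / u" by (simp add: u_def diff_divide_distrib[symmetric])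
      also have "\<dots> = 1 - w" unfolding diff_divide_distrib[of u "c t - c lo"] using u by (simp add: w_def)
      finally have "c T / u - c t / u = 1 - w" .
      from arg_cong[OF this, of Re] show ?thesis by (simp add: X_def)
    qed
    ultimately show ?thesis by simp
  qed
  \<comment> \<open>Near \<open>T\<close> the reference argument may be replaced by its value at
    \<open>(T, lo)\<close>, at the cost of less than \<open>pi/2\<close>.\<close>
  have "continuous_on {lo<..hi} (\<lambda>t. Im (\<Lambda> (t, lo)))"
    by (intro continuous_intros continuous_on_compose2[OF \<Lambda>(1)]) (use range in auto)
  then obtain d0 where d0: "d0 > 0"
    "\<And>t. t \<in> {lo<..hi} \<Longrightarrow> \<bar>t - T\<bar> < d0 \<Longrightarrow> \<bar>Im (\<Lambda> (t, lo)) - Im (\<Lambda> (T, lo))\<bar> < pi/2"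
    unfolding continuous_on_iff using T(1) \<open>lo < T\<close> pi_half_gt_zero
    by (metis dist_real_def greaterThanAtMost_iff atLeastAtMost_iff)
  \<comment> \<open>Half of \<open>T - lo\<close>: first hits within \<open>d \<le> z\<close> of
    \<open>T\<close> are then at least \<open>z\<close> later than \<open>lo\<close>, as the passage
    to a smaller rectangle demands.\<close>
  define z where "z = (T - lo) / 2"
  define d where "d = min d0 z"
  have z: "z > 0" and d: "d > 0" "d \<le> d0" "d \<le> z" using d0(1) \<open>lo < T\<close> by (auto simp: z_def d_def min_def)
  define K where "K = {lo..hi} \<inter> {t. d \<le> \<bar>t - T\<bar>}"
  have "compact K" unfolding K_def
    by (intro compact_Int_closed compact_Icc closed_Collect_le continuous_intros)
  moreover have "lo \<in> K" using d \<open>lo < T\<close> range by (auto simp: K_def z_def)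
  moreover have "continuous_on K X" using cX by (rule continuous_on_subset) (auto simp: K_def)
  ultimately obtain k where k: "k \<in> K" "\<And>t. t \<in> K \<Longrightarrow> X t \<le> X k"
    using continuous_attains_sup[of K X] by blast
  \<comment> \<open>A third of the gap between the maximum and the values on \<open>K\<close>. A
    curve within \<open>\<nu>\<close> in projection exceeds the level \<open>X T - \<nu>\<close> at
    \<open>T\<close>, and on \<open>K\<close> it stays below \<open>X T - 2 * \<nu>\<close>.\<close>
  define \<nu> where "\<nu> = (X T - X k) / 3"
  have \<nu>: "\<nu> > 0" using Xmax[of k] k(1) d by (auto simp: \<nu>_def K_def)
  obtain e1 where e1: "e1 > 0" "\<And>s t. s \<in> {p..q} \<Longrightarrow> t \<in> {p..q} \<Longrightarrow> \<bar>s - t\<bar> \<ge> z \<Longrightarrow> e1 \<le> cmod (c s - c t)"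
    using separation_of_injective[OF c z] by blast
  define e where "e = min (e1 / 2) (\<nu> * cmod u)"
  have e: "e > 0" "2 * e \<le> e1" "e \<le> \<nu> * cmod u" using e1 \<nu> u by (auto simp: e_def)
  define b0 where "b0 = X T - \<nu>"
  define hit where "hit a = Inf {t \<in> {lo..hi}. b0 \<le> Re (a t / u)}" for a
  define h where "h a = Im (a (hit a) / u)" for a
  have hit: "hit a \<in> {lo<..hi}" "\<bar>hit a - T\<bar> < d" "Re (a (hit a) / u) = b0"
    "\<And>t. t \<in> {lo..hit a} \<Longrightarrow> Re (a t / u) \<le> b0" "Re (a lo / u) < b0"
    if a: "continuous_on {lo..hi} a" "\<forall>t\<in>{lo..hi}. cmod (a t - c t) < e" for a
  proof -
    define A where "A t = Re (a t / u)" for t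
    have cA: "continuous_on {lo..hi} A" unfolding A_def using u by (intro continuous_intros a(1)) auto
    have AX: "\<bar>A t - X t\<bar> < \<nu>" if "t \<in> {lo..hi}" for t
    proof -
      have "A t - X t = Re ((a t - c t) / u)" by (simp add: A_def X_def diff_divide_distrib)
      moreover have "cmod ((a t - c t) / u) < \<nu>"
        using bspec[OF a(2) that] e(3) u by (simp add: norm_divide pos_divide_less_eq)
      ultimately show ?thesis using abs_Re_le_cmod[of "(a t - c t) / u"] by linarith
    qed
    define S where "S = {t \<in> {lo..hi}. b0 \<le> A t}"
    have "closed S" unfolding S_def
      by (intro continuous_on_closed_Collect_le continuous_intros cA)
    moreover have "T \<in> S" using AX[OF T(1)] T(1) by (auto simp: S_def b0_def)
    moreover have bb: "bdd_below S" by (rule bdd_belowI[of _ lo]) (auto simp: S_def)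
    ultimately have hS: "hit a \<in> S"
      unfolding hit_def using closed_contains_Inf[of S] by (auto simp: S_def A_def)
    have "X T = X k + 3 * \<nu>" by (simp add: \<nu>_def diff_divide_distrib)
    then have lo: "A lo < b0" using AX[of lo] k(2)[OF \<open>lo \<in> K\<close>] range(2) \<nu> unfolding b0_def by auto
    have before: "A t < b0" if "t \<in> {lo..<hit a}" for t
    proof (rule ccontr)
      assume "\<not> A t < b0"
      then have "t \<in> S" using that hS by (auto simp: S_def)
      then show False using cInf_lower[OF _ bb, of t] that by (auto simp: hit_def S_def A_def)
    qed
    have eq: "A (hit a) = b0"
    proof (rule ccontr)
      assume "A (hit a) \<noteq> b0"
      then have "b0 \<le> A (hit a)" "b0 \<noteq> A (hit a)" using hS by (auto simp: S_def)
      moreover have "lo \<le> hit a" using hS by (auto simp: S_def)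
      moreover have "continuous_on {lo..hit a} A" using cA by (rule continuous_on_subset) (use hS in \<open>auto simp: S_def\<close>)
      ultimately obtain t where "lo \<le> t" "t \<le> hit a" "A t = b0"
        using IVT'[of A lo b0 "hit a"] lo by auto
      moreover have "t \<noteq> hit a" using \<open>A t = b0\<close> \<open>b0 \<noteq> A (hit a)\<close> by auto
      ultimately show False using before[of t] by auto
    qed
    show "Re (a (hit a) / u) = b0" "Re (a lo / u) < b0" using eq lo by (auto simp: A_def)
    show "\<And>t. t \<in> {lo..hit a} \<Longrightarrow> Re (a t / u) \<le> b0"
      using before eq unfolding A_def by (metis atLeastAtMost_iff atLeastLessThan_iff less_eq_real_def)
    show "hit a \<in> {lo<..hi}" using hS eq lo by (cases "hit a = lo") (auto simp: S_def)
    have "hit a \<notin> K"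
    proof
      assume "hit a \<in> K"
      then have "X (hit a) \<le> X T - 3 * \<nu>" using k(2) by (auto simp: \<nu>_def field_simps)
      then show False using AX[of "hit a"] hS \<nu> eq by (auto simp: S_def b0_def)
    qed
    then show "\<bar>hit a - T\<bar> < d" using hS by (auto simp: K_def S_def)
  qed
  have main: "(crosses_above \<Lambda> a b lo hi lo hi \<longleftrightarrow> h a < h b) \<and> h a \<noteq> h b"
    if a: "continuous_on {lo..hi} a" "\<And>t. t \<in> {lo..hi} \<Longrightarrow> cmod (a t - c t) < e"
      and b: "continuous_on {lo..hi} b" "\<And>t. t \<in> {lo..hi} \<Longrightarrow> cmod (b t - c t) < e"
      and disj: "\<And>s t. s \<in> {lo..hi} \<Longrightarrow> t \<in> {lo..hi} \<Longrightarrow> b s \<noteq> a t" for a b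
  proof -
    define t1 where "t1 = hit a"
    define s1 where "s1 = hit b"
    have "\<forall>t\<in>{lo..hi}. cmod (a t - c t) < e" "\<forall>t\<in>{lo..hi}. cmod (b t - c t) < e" using a(2) b(2) by auto
    note ta = hit[OF a(1) this(1), folded t1_def] and tb = hit[OF b(1) this(2), folded s1_def]
    define R where "R = {lo..s1} \<times> {lo..t1}"
    have close: "cmod ((b s - a t) - (c s - c t)) < cmod (c s - c t)"
      if "s \<in> {lo..hi}" "t \<in> {lo..hi}" "\<bar>s - t\<bar> \<ge> z" for s t
    proof -
      have "cmod ((b s - a t) - (c s - c t)) = cmod ((b s - c s) - (a t - c t))" by (simp add: algebra_simps)
      also have "\<dots> \<le> cmod (b s - c s) + cmod (a t - c t)" by (rule norm_triangle_ineq4)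
      also have "\<dots> < e1" using a(2)[OF that(2)] b(2)[OF that(1)] e(2) by linarith
      also have "\<dots> \<le> cmod (c s - c t)" using e1(2)[of s t] that range by auto
      finally show ?thesis .
    qed
    have zz: "lo + z \<le> s1" "lo + z \<le> t1" using ta(2) tb(2) d(3) by (auto simp: z_def field_simps)
    have red: "crosses_above \<Lambda> a b lo hi lo hi \<longleftrightarrow> crosses_above \<Lambda> a b lo s1 lo t1"
      by (rule crosses_above_subrectangle[where p = p and q = q and z = z, OF \<Lambda> a(1) b(1) disj close])
         (use range z zz ta(1) tb(1) in auto)
    have uL: "exp (\<Lambda> (T, lo)) = u" using \<Lambda>(2)[of lo T] range T(1) \<open>lo < T\<close> by (auto simp: u_def)
    have hne: "h a \<noteq> h b"
    proof
      assume "h a = h b"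
      then have "a t1 / u = b s1 / u" using ta(3) tb(3) by (auto simp: h_def t1_def s1_def complex_eq_iff)
      then show False using disj[of s1 t1] ta(1) tb(1) u by auto
    qed
    have key: "Im (\<Lambda> (t1, lo)) < Im (L (lo, t1)) \<longleftrightarrow> h a < h b"
      if L: "continuous_on R L" "\<And>s t. s \<in> {lo..s1} \<Longrightarrow> t \<in> {lo..t1} \<Longrightarrow> exp (L (s, t)) = b s - a t"
        "\<bar>Im (L (s1, lo)) - Im (\<Lambda> (s1, lo))\<bar> < pi / 2" for L
    proof -
      define y where "y x = Im (L x - \<Lambda> (T, lo))" for x
      have cy: "continuous_on R y" unfolding y_def by (intro continuous_intros L(1))
      have ey: "exp (Re (L (s,t) - \<Lambda> (T, lo))) * cos (y (s,t)) = Re (b s / u) - Re (a t / u)"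
        "exp (Re (L (s,t) - \<Lambda> (T, lo))) * sin (y (s,t)) = Im (b s / u) - Im (a t / u)"
        if "s \<in> {lo..s1}" "t \<in> {lo..t1}" for s t
      proof -
        have "exp (L (s,t) - \<Lambda> (T, lo)) = b s / u - a t / u"
          using L(2)[OF that] uL by (simp add: exp_diff diff_divide_distrib)
        from arg_cong[OF this, of Re] arg_cong[OF this, of Im]
        show "exp (Re (L (s,t) - \<Lambda> (T, lo))) * cos (y (s,t)) = Re (b s / u) - Re (a t / u)"
          "exp (Re (L (s,t) - \<Lambda> (T, lo))) * sin (y (s,t)) = Im (b s / u) - Im (a t / u)"
          unfolding y_def by (simp_all only: Re_exp Im_exp minus_complex.simps)
      qed
      have le: "lo \<le> s1" "lo \<le> t1" using ta(1) tb(1) by auto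
      have "cos (y (s1, lo)) > 0"
      proof -
        have "0 < exp (Re (L (s1,lo) - \<Lambda> (T, lo))) * cos (y (s1, lo))"
          using ey(1)[of s1 lo] ta(5) tb(3) le by auto
        then show ?thesis by (simp add: zero_less_mult_iff)
      qed
      \<comment> \<open>Two errors below \<open>pi/2\<close>, from the normalisation of
        \<open>L\<close> and from replacing \<open>s1\<close> by \<open>T\<close> in the reference.
        Together with the positive cosine this leaves only the interval around 0.\<close>
      moreover have "\<bar>y (s1, lo)\<bar> < pi"
      proof -
        have "\<bar>Im (\<Lambda> (s1, lo)) - Im (\<Lambda> (T, lo))\<bar> < pi/2" using d0(2)[of s1] tb(1,2) d(2) by auto
        then show ?thesis using L(3) unfolding y_def minus_complex.sel by argo
      qed
      ultimately have y0: "\<bar>y (s1, lo)\<bar> \<le> pi/2"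
        using cos_gt_zero_pi[of "pi - \<bar>y (s1, lo)\<bar>"] by (fastforce simp: cos_diff abs_if split: if_splits)
      have c1: "continuous_on {lo..t1} (\<lambda>t. y (s1, t))" and c2: "continuous_on {lo..s1} (\<lambda>s. y (s, t1))"
        by (intro continuous_on_compose2[OF cy] continuous_intros; use le in \<open>auto simp: R_def\<close>)+
      have p1: "cos (y (s1, t)) \<ge> 0" if "t \<in> {lo..t1}" for t
      proof -
        have "0 \<le> exp (Re (L (s1,t) - \<Lambda> (T, lo))) * cos (y (s1, t))"
          using ey(1)[of s1 t] ta(4)[OF that] tb(3) le that by auto
        then show ?thesis by (simp add: zero_le_mult_iff)
      qed
      have p2: "cos (y (s, t1)) \<le> 0" if "s \<in> {lo..s1}" for s
      proof -
        have "exp (Re (L (s,t1) - \<Lambda> (T, lo))) * cos (y (s, t1)) \<le> 0"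
          using ey(1)[of s t1] tb(4)[OF that] ta(3) le that by auto
        then show ?thesis by (simp add: mult_le_0_iff)
      qed
      have y1: "\<bar>y (s1, t1)\<bar> \<le> pi/2"
        using cos_nonneg_stays[OF connected_Icc c1 p1, of lo t1] le y0 by auto
      have cz: "cos (y (s1, t1)) = 0" using p1[of t1] p2[of s1] le by auto
      then have yabs: "\<bar>y (s1, t1)\<bar> = pi/2"
        using y1 cos_gt_zero_pi[of "y (s1, t1)"] by linarith
      have small: "\<bar>Im (\<Lambda> (t1, lo)) - Im (\<Lambda> (T, lo))\<bar> < pi/2"
        using d0(2)[of t1] ta(1,2) d(2) by auto
      have hh: "exp (Re (L (s1,t1) - \<Lambda> (T, lo))) * sin (y (s1,t1)) = h b - h a"
        using ey(2)[of s1 t1] le by (simp add: h_def s1_def t1_def)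
      show ?thesis
      proof (cases "y (s1, t1) = pi/2")
        case True
        have "h a < h b" using hh exp_gt_zero[of "Re (L (s1,t1) - \<Lambda> (T, lo))"] unfolding True sin_pi_half by linarith
        moreover have "y (lo, t1) \<ge> pi/2"
          using cos_nonpos_stays[OF connected_Icc c2 p2, of s1 lo] le True by auto
        then have "Im (\<Lambda> (t1, lo)) < Im (L (lo, t1))" using small unfolding y_def minus_complex.sel by argo
        ultimately show ?thesis by auto
      next
        case False
        have m: "y (s1, t1) = -(pi/2)" using yabs False by linarith
        have "h b < h a" using hh exp_gt_zero[of "Re (L (s1,t1) - \<Lambda> (T, lo))"] unfolding m sin_minus sin_pi_half by linarith
        moreover have "- y (lo, t1) \<ge> pi/2"
          using cos_nonpos_stays[of "{lo..s1}" "\<lambda>s. - y (s, t1)" s1 lo] continuous_on_minus[OF c2] p2 le m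
          by auto
        then have "\<not> Im (\<Lambda> (t1, lo)) < Im (L (lo, t1))" using small unfolding y_def minus_complex.sel by argo
        ultimately show ?thesis by auto
      qed
    qed
    have "crosses_above \<Lambda> a b lo s1 lo t1 \<longleftrightarrow> h a < h b"
    proof
      assume "crosses_above \<Lambda> a b lo s1 lo t1"
      then show "h a < h b" unfolding crosses_above_def using key unfolding R_def by blast
    next
      assume less: "h a < h b"
      have "continuous_on R (\<lambda>x. b (fst x) - a (snd x))"
        unfolding R_def using ta(1) tb(1)
        by (intro continuous_intros continuous_on_compose2[OF b(1)] continuous_on_compose2[OF a(1)]) auto
      moreover have "convex R" unfolding R_def by (intro convex_Times convex_closed_interval)
      ultimately obtain L where L: "continuous_on R L" "\<And>x. x \<in> R \<Longrightarrow> exp (L x) = b (fst x) - a (snd x)"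
        "\<bar>Im (L (s1, lo)) - Im (\<Lambda> (s1, lo))\<bar> < pi/2"
      proof (rule normalised_logarithm)
        show "b (fst x) - a (snd x) \<noteq> 0" if "x \<in> R" for x
          using disj that ta(1) tb(1) by (auto simp: R_def)
        show "(s1, lo) \<in> R" using ta(1) tb(1) by (auto simp: R_def)
        show "exp (\<Lambda> (s1, lo)) = c s1 - c lo" using \<Lambda>(2) range tb(1) by auto
        show "cmod (b (fst (s1, lo)) - a (snd (s1, lo)) - (c s1 - c lo)) < cmod (c s1 - c lo)"
          using close[of s1 lo] range zz z tb(1) by auto
      qed blast
      then have "Im (\<Lambda> (t1, lo)) < Im (L (lo, t1))" using key[of L] less by (auto simp: R_def)
      then show "crosses_above \<Lambda> a b lo s1 lo t1"
        unfolding crosses_above_def using L by (intro exI[of _ L]) (auto simp: R_def)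
    qed
    then show ?thesis using red hne by simp
  qed
  show ?thesis by (rule that[OF e(1)]) (rule main; assumption)
qed

lemma crosses_above_cong:
  assumes "\<And>t. t \<in> {t0..t1} \<Longrightarrow> a t = a' t" "\<And>s. s \<in> {s0..s1} \<Longrightarrow> b s = b' s"
  shows "crosses_above \<Lambda> a b s0 s1 t0 t1 \<longleftrightarrow> crosses_above \<Lambda> a' b' s0 s1 t0 t1"
  unfolding crosses_above_def using assms by simp

text \<open>The pairs with \<open>t < s\<close> form a convex set, and injectivity keeps the
  difference away from 0 on it.\<close>

lemma difference_logarithm:
  fixes c :: "real \<Rightarrow> complex"
  assumes "continuous_on {p..q} c" "inj_on c {p..q}"
  obtains \<Lambda> where "continuous_on {(s, t). p \<le> t \<and> t < s \<and> s \<le> q} \<Lambda>"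
    "\<And>s t. p \<le> t \<Longrightarrow> t < s \<Longrightarrow> s \<le> q \<Longrightarrow> exp (\<Lambda> (s, t)) = c s - c t"
proof -
  let ?T = "{(s, t). p \<le> t \<and> t < s \<and> s \<le> q}"
  have "?T = ({..q} \<times> {p..}) \<inter> {x. (-1, 1) \<bullet> x < 0}" by auto
  also have "convex \<dots>" by (intro convex_Int convex_Times convex_halfspace_lt) auto
  finally have "contractible ?T" by (rule convex_imp_contractible)
  moreover have "continuous_on ?T (\<lambda>x. c (fst x) - c (snd x))"
    by (intro continuous_intros continuous_on_compose2[OF assms(1)]) auto
  moreover have "c (fst x) - c (snd x) \<noteq> 0" if "x \<in> ?T" for x
    using that inj_onD[OF assms(2), of "fst x" "snd x"] by auto
  ultimately obtain \<Lambda> where "continuous_on ?T \<Lambda>" "\<And>x. x \<in> ?T \<Longrightarrow> c (fst x) - c (snd x) = exp (\<Lambda> x)"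
    using continuous_logarithm_on_contractible[of ?T "\<lambda>x. c (fst x) - c (snd x)"] by blast
  then show ?thesis using that[of \<Lambda>] by fastforce
qed

section \<open>Levelled graphs\<close>

text \<open>\<open>E u v\<close> is an edge going up from \<open>u\<close> to \<open>v\<close>; \<open>S\<close> marks the vertices that need not be regular.\<close>

locale levelled_graph =
  fixes V :: "'v set" and lv :: "'v \<Rightarrow> nat" and E :: "'v \<Rightarrow> 'v \<Rightarrow> bool" and S :: "'v \<Rightarrow> bool" and n :: nat
  assumes fin: "finite V" and n_pos: "0 < n"
    and E: "E u v \<Longrightarrow> u \<in> V \<and> v \<in> V \<and> lv v = Suc (lv u)"
    and lv_le: "v \<in> V \<Longrightarrow> lv v \<le> n"
    and S_lv: "S v \<Longrightarrow> 0 < lv v \<and> lv v < n"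
    and S_unique: "v \<in> V \<Longrightarrow> r \<in> V \<Longrightarrow> S v \<Longrightarrow> S r \<Longrightarrow> lv v = lv r \<Longrightarrow> v = r"
    and up: "v \<in> V \<Longrightarrow> \<not> S v \<Longrightarrow> lv v < n \<Longrightarrow> \<exists>!q. E v q"
    and down: "v \<in> V \<Longrightarrow> \<not> S v \<Longrightarrow> 0 < lv v \<Longrightarrow> \<exists>!l. E l v"
begin

text \<open>The last inequality is not strict because two edges may end in the same vertex; by the
  first clause equality occurs only then.\<close>

definition level_order :: "('v \<Rightarrow> real) \<Rightarrow> bool" where
  "level_order H \<longleftrightarrow> (\<forall>v\<in>V. \<forall>r\<in>V. lv v = lv r \<and> v \<noteq> r \<longrightarrow> H v \<noteq> H r) \<and>
    (\<forall>u v u' v'. E u v \<and> E u' v' \<and> lv u = lv u' \<and> H u < H u' \<longrightarrow> H v \<le> H v')"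

text \<open>By \<open>cons_low\<close> and \<open>cons_up\<close> the comparison of edges at two
  vertices depends only on the vertices, and by \<open>mid\<close> the lower and upper sides agree.
  Hence the order of the vertices can be read off on whichever side has edges.\<close>

lemma level_order_from_edge_heights:
  fixes ht :: "'v \<Rightarrow> 'v \<Rightarrow> real"
  assumes distinct: "\<And>u v u' v'. E u v \<Longrightarrow> E u' v' \<Longrightarrow> lv u = lv u' \<Longrightarrow> (u, v) \<noteq> (u', v') \<Longrightarrow> ht u v \<noteq> ht u' v'"
    and cons_low: "\<And>u v v' r q q'. E u v \<Longrightarrow> E u v' \<Longrightarrow> E r q \<Longrightarrow> E r q' \<Longrightarrow> lv u = lv r \<Longrightarrow> u \<noteq> r \<Longrightarrow>
      ht u v < ht r q \<longleftrightarrow> ht u v' < ht r q'"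
    and cons_up: "\<And>u v v' r q q'. E v u \<Longrightarrow> E v' u \<Longrightarrow> E q r \<Longrightarrow> E q' r \<Longrightarrow> lv u = lv r \<Longrightarrow> u \<noteq> r \<Longrightarrow>
      ht v u < ht q r \<longleftrightarrow> ht v' u < ht q' r"
    and mid: "\<And>a v b l r q. E a v \<Longrightarrow> E v b \<Longrightarrow> E l r \<Longrightarrow> E r q \<Longrightarrow> lv v = lv r \<Longrightarrow> v \<noteq> r \<Longrightarrow>
      ht a v < ht l r \<longleftrightarrow> ht v b < ht r q"
  obtains H where "level_order H"
proof -
  define iso where "iso v \<longleftrightarrow> \<not> (\<exists>q. E v q) \<and> \<not> (\<exists>l. E l v)" for v
  define right where "right k \<longleftrightarrow> (\<forall>x\<in>V. lv x = k \<and> \<not> iso x \<longrightarrow> (\<exists>q. E x q))" for k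
  \<comment> \<open>A bound for all heights. Isolated vertices are not regular, so a level has at
    most one, and \<open>B + 1\<close> puts it above everything else.\<close>
  define B where "B = (\<Sum>x\<in>V. \<Sum>y\<in>V. \<bar>ht x y\<bar>)"
  \<comment> \<open>At an inner level at most one vertex can lack an edge on some side, so at each level either the right or
    the left edges provide heights for all non-isolated vertices.\<close>
  define H where "H v = (if iso v then B + 1 else if right (lv v) then ht v (SOME q. E v q) else ht (SOME l. E l v) v)" for v
  have B: "ht x y \<le> B" if "x \<in> V" "y \<in> V" for x y
  proof -
    have "\<bar>ht x y\<bar> \<le> (\<Sum>y\<in>V. \<bar>ht x y\<bar>)" using that fin by (intro member_le_sum) auto
    also have "\<dots> \<le> B" unfolding B_def
      using that fin by (intro member_le_sum[where f = "\<lambda>x. \<Sum>y\<in>V. \<bar>ht x y\<bar>"]) (auto intro: sum_nonneg)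
    finally show ?thesis by linarith
  qed
  have isoS: "S v" if "v \<in> V" "iso v" for v
  proof (rule ccontr)
    assume "\<not> S v"
    then show False using up[OF that(1)] down[OF that(1)] that(2) n_pos unfolding iso_def by (metis gr0I)
  qed
  \<comment> \<open>Some non-isolated \<open>x\<close> on the level lacks an upper edge. Were
    \<open>v\<close> marked by \<open>S\<close> and with an upper edge, \<open>x\<close> would be
    regular below the top level and would have one too. So \<open>v\<close> is regular unless it
    lacks an upper edge itself, and the level is positive because \<open>x\<close> has a lower
    edge.\<close>
  have left: "\<exists>l. E l v" if v: "v \<in> V" "\<not> iso v" "\<not> right (lv v)" for v
  proof (cases "S v \<and> \<not> (\<exists>q. E v q)")
    case True then show ?thesis using v unfolding iso_def by blast
  next
    case False
    obtain x where x: "x \<in> V" "lv x = lv v" "\<not> iso x" "\<not> (\<exists>q. E x q)" using v(3) unfolding right_def by auto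
    have lx: "0 < lv v" using x(3,4) E x(2) unfolding iso_def by (metis zero_less_Suc)
    have "\<not> S v"
    proof
      assume "S v"
      then have "v \<noteq> x" "lv v < n" using False x S_lv by auto
      moreover have "\<not> S x" using S_unique[OF v(1) x(1) \<open>S v\<close>] x(2) \<open>v \<noteq> x\<close> by auto
      ultimately show False using up[OF x(1)] x(2,4) by auto
    qed
    then show ?thesis using down[OF v(1)] lx by blast
  qed
  have right: "\<exists>q. E v q" if v: "v \<in> V" "\<not> iso v" "right (lv v)" for v
    using v unfolding right_def by auto
  have Hright: "\<exists>q. E v q \<and> H v = ht v q" if v: "v \<in> V" "\<not> iso v" "right (lv v)" for v
    using someI_ex[OF right[OF v]] v(2,3) unfolding H_def by auto
  have Hleft: "\<exists>l. E l v \<and> H v = ht l v" if v: "v \<in> V" "\<not> iso v" "\<not> right (lv v)" for v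
    using someI_ex[OF left[OF v]] v(2,3) unfolding H_def by auto
  have not_iso: "\<not> iso u" "\<not> iso v" if "E u v" for u v using that unfolding iso_def by auto
  have low: "H v < H r \<longleftrightarrow> ht v b < ht r q" if e: "E v b" "E r q" "lv v = lv r" "v \<noteq> r" for v b r q
  proof -
    have V: "v \<in> V" "r \<in> V" "\<not> iso v" "\<not> iso r" using e E not_iso by blast+
    show ?thesis
    proof (cases "right (lv v)")
      case True
      obtain b0 q0 where "E v b0" "H v = ht v b0" "E r q0" "H r = ht r q0"
        using Hright[of v] Hright[of r] True V e(3) by auto
      then show ?thesis using cons_low[of v b0 b r q0 q] e by simp
    next
      case False
      obtain a0 l0 where "E a0 v" "H v = ht a0 v" "E l0 r" "H r = ht l0 r"
        using Hleft[of v] Hleft[of r] False V e(3) by auto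
      then show ?thesis using mid[of a0 v b l0 r q] e by simp
    qed
  qed
  have upp: "H v < H r \<longleftrightarrow> ht a v < ht l r" if e: "E a v" "E l r" "lv v = lv r" "v \<noteq> r" for a v l r
  proof -
    have V: "v \<in> V" "r \<in> V" "\<not> iso v" "\<not> iso r" using e E not_iso by blast+
    show ?thesis
    proof (cases "right (lv v)")
      case True
      obtain b0 q0 where "E v b0" "H v = ht v b0" "E r q0" "H r = ht r q0"
        using Hright[of v] Hright[of r] True V e(3) by auto
      then show ?thesis using mid[of a v b0 l r q0] e by simp
    next
      case False
      obtain a0 l0 where "E a0 v" "H v = ht a0 v" "E l0 r" "H r = ht l0 r"
        using Hleft[of v] Hleft[of r] False V e(3) by auto
      then show ?thesis using cons_up[of a0 v a l0 r l] e by simp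
    qed
  qed
  have ne: "H v \<noteq> H r" if V: "v \<in> V" "r \<in> V" "\<not> iso v" "\<not> iso r" and e: "lv v = lv r" "v \<noteq> r" for v r
  proof (cases "right (lv v)")
    case True
    obtain b0 q0 where "E v b0" "H v = ht v b0" "E r q0" "H r = ht r q0"
      using Hright[of v] Hright[of r] True V e by auto
    then show ?thesis using distinct[of v b0 r q0] e by simp
  next
    case False
    obtain a0 l0 where h: "E a0 v" "H v = ht a0 v" "E l0 r" "H r = ht l0 r"
      using Hleft[of v] Hleft[of r] False V e by auto
    then have "lv a0 = lv l0" using E[OF h(1)] E[OF h(3)] e by simp
    then show ?thesis using distinct[of a0 v l0 r] e h by simp
  qed
  have HB: "H v \<le> B" if v: "v \<in> V" "\<not> iso v" for v
  proof (cases "right (lv v)")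
    case True then show ?thesis using Hright[OF v] B E by auto
  next
    case False then show ?thesis using Hleft[OF v] B E by auto
  qed
  have "level_order H"
    unfolding level_order_def
  proof (intro conjI ballI allI impI)
    fix v r assume V: "v \<in> V" "r \<in> V" and e: "lv v = lv r \<and> v \<noteq> r"
    consider "\<not> iso v" "\<not> iso r" | "iso v" "\<not> iso r" | "\<not> iso v" "iso r" | "iso v" "iso r" by blast
    then show "H v \<noteq> H r"
    proof cases
      case 1 then show ?thesis using ne V e by blast
    next
      case 2 then show ?thesis using HB[OF V(2)] by (simp add: H_def)
    next
      case 3 then show ?thesis using HB[OF V(1)] by (simp add: H_def)
    next
      case 4 then show ?thesis using isoS V S_unique e by blast
    qed
  next
    fix u v u' v' assume e: "E u v \<and> E u' v' \<and> lv u = lv u' \<and> H u < H u'"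
    then have "u \<noteq> u'" by auto
    then have lt: "ht u v < ht u' v'" using low[of u v u' v'] e by blast
    have "lv v = lv v'" using E[of u v] E[of u' v'] e by simp
    then show "H v \<le> H v'" using upp[of u v u' v'] e lt by (cases "v = v'") auto
  qed
  then show ?thesis by (rule that)
qed

text \<open>Strands are parametrised by level, so all of them can be compared with \<open>c\<close>
  at equal times. Heights on the middle half of each edge come from \<open>height_order\<close>;
  comparison with a strand running through a vertex makes them fit together.\<close>

lemma level_order_from_strands:
  fixes c :: "real \<Rightarrow> complex"
  assumes c: "continuous_on {0..real n} c" "inj_on c {0..real n}"
    and approx: "\<And>\<epsilon>. \<epsilon> > 0 \<Longrightarrow> \<exists>g gv.
      (\<forall>u v. E u v \<longrightarrow> continuous_on {real (lv u)..real (lv v)} (g u v) \<and>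
        g u v (real (lv u)) = gv u \<and> g u v (real (lv v)) = gv v \<and>
        (\<forall>t\<in>{real (lv u)..real (lv v)}. cmod (g u v t - c t) < \<epsilon>)) \<and>
      (\<forall>u v u' v' s t. E u v \<and> E u' v' \<and> s \<in> {real (lv u)..real (lv v)} \<and> t \<in> {real (lv u')..real (lv v')} \<and>
        g u v s = g u' v' t \<longrightarrow>
        s = t \<and> (u = u' \<and> v = v' \<or> s = real (lv u) \<and> u \<in> {u', v'} \<or> s = real (lv v) \<and> v \<in> {u', v'}))"
  obtains H where "level_order H"
proof -
  obtain \<Lambda> where \<Lambda>: "continuous_on {(s, t). 0 \<le> t \<and> t < s \<and> s \<le> real n} \<Lambda>"
    "\<And>s t. 0 \<le> t \<Longrightarrow> t < s \<Longrightarrow> s \<le> real n \<Longrightarrow> exp (\<Lambda> (s, t)) = c s - c t"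
    using difference_logarithm[OF c] by blast
  obtain e0 where e0: "e0 > 0" "\<And>s t. s \<in> {0..real n} \<Longrightarrow> t \<in> {0..real n} \<Longrightarrow> \<bar>s - t\<bar> \<ge> 1/2 \<Longrightarrow> e0 \<le> cmod (c s - c t)"
    using separation_of_injective[OF c, of "1/2"] by auto
  define sq where "sq a b k \<longleftrightarrow> crosses_above \<Lambda> a b (real k + 1/4) (real k + 3/4) (real k + 1/4) (real k + 3/4)" for a b k
  \<comment> \<open>A closed form of \<open>height_order\<close>, so that thresholds and heights can
    be chosen for all levels at once.\<close>
  define Q where "Q k e h \<longleftrightarrow> (e > (0::real)) \<and> (\<forall>a b. continuous_on {real k + 1/4..real k + 3/4} a \<longrightarrow>
     continuous_on {real k + 1/4..real k + 3/4} b \<longrightarrow>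
     (\<forall>t\<in>{real k + 1/4..real k + 3/4}. cmod (a t - c t) < e) \<longrightarrow>
     (\<forall>t\<in>{real k + 1/4..real k + 3/4}. cmod (b t - c t) < e) \<longrightarrow>
     (\<forall>s\<in>{real k + 1/4..real k + 3/4}. \<forall>t\<in>{real k + 1/4..real k + 3/4}. b s \<noteq> a t) \<longrightarrow>
     (sq a b k \<longleftrightarrow> h a < (h b :: real)) \<and> h a \<noteq> h b)" for k e and h :: "(real \<Rightarrow> complex) \<Rightarrow> real"
  have "\<exists>e h. Q k e h" if "k < n" for k
  proof -
    have "0 \<le> real k + 1/4" "real k + 1/4 < real k + 3/4" "real k + 3/4 \<le> real n" using that by auto
    from height_order[OF c \<Lambda> this] obtain e h where eh: "e > (0::real)"
      "\<And>a b. \<lbrakk>continuous_on {real k + 1/4..real k + 3/4} a; continuous_on {real k + 1/4..real k + 3/4} b;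
      \<And>t. t \<in> {real k + 1/4..real k + 3/4} \<Longrightarrow> cmod (a t - c t) < e; \<And>t. t \<in> {real k + 1/4..real k + 3/4} \<Longrightarrow> cmod (b t - c t) < e;
      \<And>s t. s \<in> {real k + 1/4..real k + 3/4} \<Longrightarrow> t \<in> {real k + 1/4..real k + 3/4} \<Longrightarrow> b s \<noteq> a t\<rbrakk>
      \<Longrightarrow> (crosses_above \<Lambda> a b (real k + 1/4) (real k + 3/4) (real k + 1/4) (real k + 3/4) \<longleftrightarrow> h a < (h b :: real)) \<and> h a \<noteq> h b"
      by blast
    have "Q k e h" unfolding Q_def sq_def
      by (intro conjI[OF eh(1)] allI impI, rule eh(2)) auto
    then show ?thesis by blast
  qed
  then obtain e h where eh: "\<And>k. k < n \<Longrightarrow> Q k (e k) (h k)" by metis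
  \<comment> \<open>Half of \<open>e0\<close>, because a difference of two strands carries two
    errors and must stay closer to \<open>c s - c t\<close> than the length of the latter.\<close>
  define \<epsilon> where "\<epsilon> = Min (insert (e0 / 2) (e ` {..<n}))"
  have \<epsilon>: "\<epsilon> > 0" "\<epsilon> \<le> e0 / 2" "\<And>k. k < n \<Longrightarrow> \<epsilon> \<le> e k"
  proof -
    have "finite (insert (e0 / 2) (e ` {..<n}))" by simp
    then show "\<epsilon> \<le> e0 / 2" "\<And>k. k < n \<Longrightarrow> \<epsilon> \<le> e k" unfolding \<epsilon>_def by (blast intro: Min_le)+
    show "\<epsilon> > 0" unfolding \<epsilon>_def using e0(1) eh by (auto simp: Q_def)
  qed
  obtain g gv where G: "\<forall>u v. E u v \<longrightarrow> continuous_on {real (lv u)..real (lv v)} (g u v) \<and>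
        g u v (real (lv u)) = gv u \<and> g u v (real (lv v)) = gv v \<and>
        (\<forall>t\<in>{real (lv u)..real (lv v)}. cmod (g u v t - c t) < \<epsilon>)"
      "\<forall>u v u' v' s t. E u v \<and> E u' v' \<and> s \<in> {real (lv u)..real (lv v)} \<and> t \<in> {real (lv u')..real (lv v')} \<and>
        g u v s = g u' v' t \<longrightarrow>
        s = t \<and> (u = u' \<and> v = v' \<or> s = real (lv u) \<and> u \<in> {u', v'} \<or> s = real (lv v) \<and> v \<in> {u', v'})"
    using approx[OF \<epsilon>(1)] by (elim exE conjE) (rule that)
  have g_cont: "\<And>u v. E u v \<Longrightarrow> continuous_on {real (lv u)..real (lv v)} (g u v)"
    and g_ends: "\<And>u v. E u v \<Longrightarrow> g u v (real (lv u)) = gv u" "\<And>u v. E u v \<Longrightarrow> g u v (real (lv v)) = gv v"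
    and g_close: "\<And>u v t. E u v \<Longrightarrow> t \<in> {real (lv u)..real (lv v)} \<Longrightarrow> cmod (g u v t - c t) < \<epsilon>"
    using G(1) by blast+
  have g_disj: "s = t \<and> (u = u' \<and> v = v' \<or> s = real (lv u) \<and> u \<in> {u', v'} \<or> s = real (lv v) \<and> v \<in> {u', v'})"
    if "E u v" "E u' v'" "s \<in> {real (lv u)..real (lv v)}" "t \<in> {real (lv u')..real (lv v')}" "g u v s = g u' v' t"
    for u v u' v' s t
    using G(2)[rule_format, OF conjI[OF that(1) conjI[OF that(2) conjI[OF that(3) conjI[OF that(4,5)]]]]] .
  define ht where "ht u v = h (lv u) (g u v)" for u v
  have lvn: "lv u < n" "real (lv v) = real (lv u) + 1" if "E u v" for u v
    using E[OF that] lv_le[of v] by auto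
  have ht: "(sq (g u v) (g u' v') (lv u) \<longleftrightarrow> ht u v < ht u' v') \<and> ht u v \<noteq> ht u' v'"
    if e: "E u v" "E u' v'" "lv u = lv u'" "(u, v) \<noteq> (u', v')" for u v u' v'
  proof -
    let ?I = "{real (lv u) + 1/4..real (lv u) + 3/4}"
    have sub: "?I \<subseteq> {real (lv u)..real (lv v)}" "?I \<subseteq> {real (lv u')..real (lv v')}"
      using lvn(2)[OF e(1)] lvn(2)[OF e(2)] e(3) by auto
    have c12: "continuous_on ?I (g u v)" "continuous_on ?I (g u' v')"
      by (rule continuous_on_subset[OF g_cont[OF e(1)] sub(1)], rule continuous_on_subset[OF g_cont[OF e(2)] sub(2)])
    have n12: "\<forall>t\<in>?I. cmod (g u v t - c t) < e (lv u)" "\<forall>t\<in>?I. cmod (g u' v' t - c t) < e (lv u)"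
      using g_close[OF e(1)] g_close[OF e(2)] sub \<epsilon>(3)[OF lvn(1)[OF e(1)]] by (meson order_less_le_trans subsetD)+
    have d: "\<forall>s\<in>?I. \<forall>t\<in>?I. g u' v' s \<noteq> g u v t"
    proof (intro ballI notI)
      fix s t assume st: "s \<in> ?I" "t \<in> ?I" "g u' v' s = g u v t"
      then have "s = t \<and> (u' = u \<and> v' = v \<or> s = real (lv u') \<and> u' \<in> {u, v} \<or> s = real (lv v') \<and> v' \<in> {u, v})"
        using g_disj[OF e(2,1)] sub by blast
      then show False using st e lvn(2)[OF e(2)] by auto
    qed
    have "(sq (g u v) (g u' v') (lv u) \<longleftrightarrow> h (lv u) (g u v) < h (lv u) (g u' v')) \<and>
        h (lv u) (g u v) \<noteq> h (lv u) (g u' v')"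
      by (rule eh[OF lvn(1)[OF e(1)], unfolded Q_def, THEN conjunct2, THEN spec, THEN spec,
        THEN mp, OF c12(1), THEN mp, OF c12(2), THEN mp, OF n12(1), THEN mp, OF n12(2), THEN mp, OF d])
    then show ?thesis unfolding ht_def e(3)[symmetric] .
  qed
  \<comment> \<open>Strands at different vertices of level \<open>k\<close> can only share a vertex
    of a neighbouring level, at time distance 1 from \<open>k\<close>.\<close>
  have sep: "g x y t \<noteq> g x' y' s"
    if e: "E x y" "E x' y'" and t: "t \<in> {real (lv x)..real (lv y)}" and s: "s \<in> {real (lv x')..real (lv y')}"
      and k: "\<bar>t - real k\<bar> < 1" and v: "v \<in> {x, y}" "lv v = k" and r: "r \<in> {x', y'}" "lv r = k" "v \<noteq> r"
    for x y x' y' t s k v r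
  proof
    assume "g x y t = g x' y' s"
    from g_disj[OF e t s this]
    consider "x = x'" "y = y'" | "t = real (lv x)" "x \<in> {x', y'}" | "t = real (lv y)" "y \<in> {x', y'}" by blast
    moreover have ne: "lv x \<noteq> lv y" "lv x' \<noteq> lv y'" using E[OF e(1)] E[OF e(2)] by simp_all
    ultimately show False
    proof cases
      case 1 then show False using ne v r by (metis empty_iff insert_iff)
    next
      case 2
      then have "lv x = k" using k by linarith
      then have "v = x" "r = x" using 2(2) v r ne by (metis empty_iff insert_iff)+
      then show False using r(3) by simp
    next
      case 3
      then have "lv y = k" using k by linarith
      then have "v = y" "r = y" using 3(2) v r ne by (metis empty_iff insert_iff)+
      then show False using r(3) by simp
    qed
  qed
  have rect: "crosses_above \<Lambda> a b s0 s1 t0 t1 \<longleftrightarrow> crosses_above \<Lambda> a b s0' s1' t0' t1'"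
    if "continuous_on {t0..t1} a" "continuous_on {s0..s1} b"
      "\<And>s t. s \<in> {s0..s1} \<Longrightarrow> t \<in> {t0..t1} \<Longrightarrow> b s \<noteq> a t"
      "\<And>t. t \<in> {t0..t1} \<Longrightarrow> cmod (a t - c t) < \<epsilon>" "\<And>s. s \<in> {s0..s1} \<Longrightarrow> cmod (b s - c s) < \<epsilon>"
      "0 \<le> s0" "s0 \<le> s0'" "s0' \<le> s1'" "s1' \<le> s1" "s1 \<le> real n"
      "0 \<le> t0" "t0 \<le> t0'" "t0' \<le> t1'" "t1' \<le> t1" "t1 \<le> real n" "t0' + 1/2 \<le> s1'" "s0' + 1/2 \<le> t1'"
    for a b s0 s1 t0 t1 s0' s1' t0' t1'
  proof (rule crosses_above_subrectangle[where p = 0 and q = "real n" and z = "1/2" and c = c, OF \<Lambda> that(1,2,3)])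
    fix s t assume st: "s \<in> {s0..s1}" "t \<in> {t0..t1}" "1/2 \<le> \<bar>s - t\<bar>"
    have "cmod ((b s - a t) - (c s - c t)) = cmod ((b s - c s) - (a t - c t))" by (simp add: algebra_simps)
    also have "\<dots> \<le> cmod (b s - c s) + cmod (a t - c t)" by (rule norm_triangle_ineq4)
    also have "\<dots> < e0" using that(4)[OF st(2)] that(5)[OF st(1)] \<epsilon>(2) by linarith
    also have "\<dots> \<le> cmod (c s - c t)" using e0(2)[of s t] st that by auto
    finally show "cmod ((b s - a t) - (c s - c t)) < cmod (c s - c t)" .
  qed (use that in auto)
  \<comment> \<open>\<open>W\<close> only sees the position of \<open>v\<close>, so edges at \<open>v\<close> on either side compare in the same way.\<close>
  define W where "W v l r q \<longleftrightarrow> crosses_above \<Lambda> (\<lambda>_. gv v) (\<lambda>t. if t \<le> real (lv r) then g l r t else g r q t)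
      (real (lv r) - 3/4) (real (lv r) + 3/4) (real (lv r)) (real (lv r))" for v l r q
  \<comment> \<open>From the square before the vertex the rectangle is enlarged until
    \<open>\<beta>\<close> reaches to both sides, and then the other strand is shrunk to the point
    \<open>gv v\<close>. From the square after the vertex the same degenerate rectangle is reached.
    The strand through \<open>r\<close> is what permits the enlargement.\<close>
  have through: "(E a v \<longrightarrow> (ht a v < ht l r \<longleftrightarrow> W v l r q)) \<and> (E v b \<longrightarrow> (ht v b < ht r q \<longleftrightarrow> W v l r q))"
    if e: "E l r" "E r q" "lv v = lv r" "v \<noteq> r" for a v b l r q
  proof -
    define k where "k = real (lv r)"
    define \<beta> where "\<beta> t = (if t \<le> k then g l r t else g r q t)" for t
    have lvs: "real (lv l) = k - 1" "real (lv q) = k + 1" "k \<ge> 1" "k + 1 \<le> real n"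
      using E[OF e(1)] E[OF e(2)] lv_le[of q] by (auto simp: k_def)
    have gk: "g l r k = g r q k" using g_ends[OF e(1)] g_ends[OF e(2)] by (simp add: k_def)
    have "continuous_on {k - 1..k + 1} \<beta>"
    proof -
      have "continuous_on ({k - 1..k} \<union> {k..k + 1}) \<beta>"
        unfolding \<beta>_def using g_cont[OF e(1)] g_cont[OF e(2)] gk lvs
        by (intro continuous_on_If) (auto simp: k_def intro: order_antisym)
      moreover have "{k - 1..k} \<union> {k..k + 1} = {k - 1..k + 1}" by auto
      ultimately show ?thesis by simp
    qed
    then have \<beta>c: "continuous_on {k - 3/4..k + 3/4} \<beta>" by (rule continuous_on_subset) auto
    have \<beta>near: "cmod (\<beta> t - c t) < \<epsilon>" if "t \<in> {k - 3/4..k + 3/4}" for t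
      using that g_close[OF e(1), of t] g_close[OF e(2), of t] lvs by (auto simp: \<beta>_def k_def)
    have \<beta>sep: "\<beta> s \<noteq> g x y t"
      if "E x y" "t \<in> {real (lv x)..real (lv y)}" "\<bar>t - k\<bar> < 1" "v \<in> {x, y}" "s \<in> {k - 3/4..k + 3/4}" for x y t s
    proof (cases "s \<le> k")
      case True
      have "g x y t \<noteq> g l r s"
        by (rule sep[OF that(1) e(1) that(2) _ _ that(4) e(3)]) (use that True lvs e in \<open>auto simp: k_def\<close>)
      then show ?thesis using True by (simp add: \<beta>_def)
    next
      case False
      have "g x y t \<noteq> g r q s"
        by (rule sep[OF that(1) e(2) that(2) _ _ that(4) e(3)]) (use that False lvs e in \<open>auto simp: k_def\<close>)
      then show ?thesis using False by (simp add: \<beta>_def)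
    qed
    have W: "W v l r q \<longleftrightarrow> crosses_above \<Lambda> (\<lambda>_. gv v) \<beta> (k - 3/4) (k + 3/4) k k"
      unfolding W_def \<beta>_def k_def ..
    have 1: "ht a v < ht l r \<longleftrightarrow> W v l r q" if av: "E a v"
    proof -
      have la: "real (lv a) = k - 1" "lv a = lv l" using E[OF av] E[OF e(1)] e(3) by (auto simp: k_def)
      have a: "continuous_on {k - 3/4..k} (g a v)"
        using g_cont[OF av] by (rule continuous_on_subset) (use la e in \<open>auto simp: k_def\<close>)
      have an: "cmod (g a v t - c t) < \<epsilon>" if "t \<in> {k - 3/4..k}" for t
        using g_close[OF av, of t] that la e by (auto simp: k_def)
      have d: "\<beta> s \<noteq> g a v t" if "s \<in> {k - 3/4..k + 3/4}" "t \<in> {k - 3/4..k}" for s t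
        by (rule \<beta>sep[OF av]) (use that la e in \<open>auto simp: k_def\<close>)
      have "ht a v < ht l r \<longleftrightarrow> sq (g a v) (g l r) (lv a)"
        using ht[OF av e(1)] la(2) e(4) by auto
      also have "\<dots> \<longleftrightarrow> crosses_above \<Lambda> (g a v) (g l r) (k - 3/4) (k - 1/4) (k - 3/4) (k - 1/4)"
        unfolding sq_def la(1) by simp
      also have "\<dots> \<longleftrightarrow> crosses_above \<Lambda> (g a v) \<beta> (k - 3/4) (k - 1/4) (k - 3/4) (k - 1/4)"
        by (rule crosses_above_cong) (auto simp: \<beta>_def)
      also have "\<dots> \<longleftrightarrow> crosses_above \<Lambda> (g a v) \<beta> (k - 3/4) (k + 3/4) (k - 3/4) k"
        by (rule rect[OF a \<beta>c d an \<beta>near, symmetric]) (use lvs in auto)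
      also have "\<dots> \<longleftrightarrow> crosses_above \<Lambda> (g a v) \<beta> (k - 3/4) (k + 3/4) k k"
        by (rule rect[OF a \<beta>c d an \<beta>near]) (use lvs in auto)
      also have "\<dots> \<longleftrightarrow> W v l r q"
        unfolding W using g_ends(2)[OF av] e(3) by (intro crosses_above_cong) (auto simp: k_def)
      finally show ?thesis .
    qed
    have 2: "ht v b < ht r q \<longleftrightarrow> W v l r q" if vb: "E v b"
    proof -
      have lb: "real (lv b) = k + 1" using E[OF vb] e(3) by (auto simp: k_def)
      have a: "continuous_on {k..k + 3/4} (g v b)"
        using g_cont[OF vb] by (rule continuous_on_subset) (use lb e in \<open>auto simp: k_def\<close>)
      have an: "cmod (g v b t - c t) < \<epsilon>" if "t \<in> {k..k + 3/4}" for t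
        using g_close[OF vb, of t] that lb e by (auto simp: k_def)
      have d: "\<beta> s \<noteq> g v b t" if "s \<in> {k - 3/4..k + 3/4}" "t \<in> {k..k + 3/4}" for s t
        by (rule \<beta>sep[OF vb]) (use that lb e in \<open>auto simp: k_def\<close>)
      have "ht v b < ht r q \<longleftrightarrow> sq (g v b) (g r q) (lv v)"
        using ht[OF vb e(2)] e by auto
      also have "\<dots> \<longleftrightarrow> crosses_above \<Lambda> (g v b) (g r q) (k + 1/4) (k + 3/4) (k + 1/4) (k + 3/4)"
        unfolding sq_def e(3) k_def by simp
      also have "\<dots> \<longleftrightarrow> crosses_above \<Lambda> (g v b) \<beta> (k + 1/4) (k + 3/4) (k + 1/4) (k + 3/4)"
        by (rule crosses_above_cong) (auto simp: \<beta>_def)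
      also have "\<dots> \<longleftrightarrow> crosses_above \<Lambda> (g v b) \<beta> (k - 3/4) (k + 3/4) k (k + 3/4)"
        by (rule rect[OF a \<beta>c d an \<beta>near, symmetric]) (use lvs in auto)
      also have "\<dots> \<longleftrightarrow> crosses_above \<Lambda> (g v b) \<beta> (k - 3/4) (k + 3/4) k k"
        by (rule rect[OF a \<beta>c d an \<beta>near]) (use lvs in auto)
      also have "\<dots> \<longleftrightarrow> W v l r q"
        unfolding W using g_ends(1)[OF vb] e(3) by (intro crosses_above_cong) (auto simp: k_def)
      finally show ?thesis .
    qed
    show ?thesis using 1 2 by blast
  qed
  have dist: "ht u v \<noteq> ht u' v'" if "E u v" "E u' v'" "lv u = lv u'" "(u, v) \<noteq> (u', v')" for u v u' v'
    using ht[OF that] by blast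
  have flip: "(x < y \<longleftrightarrow> x' < y') \<longleftrightarrow> (y < x \<longleftrightarrow> y' < x')" if "x \<noteq> y" "x' \<noteq> y'" for x y x' y' :: real
    using that by linarith
  have lv_eq: "lv a = lv l" if "E a v" "E l r" "lv v = lv r" for a v l r
    using E[OF that(1)] E[OF that(2)] that(3) by simp
  \<comment> \<open>The regular vertex \<open>r\<close> has only one upper edge. On level 0 the same
    is true of \<open>u\<close>; on other levels a strand runs through \<open>r\<close>, and both
    edges at \<open>u\<close> are compared with it.\<close>
  have low1: "ht u v < ht r q \<longleftrightarrow> ht u v' < ht r q'"
    if e: "E u v" "E u v'" "E r q" "E r q'" "lv u = lv r" "u \<noteq> r" "\<not> S r" for u v v' r q q'
  proof -
    have q: "q = q'" using up[of r] E[OF e(3)] lvn(1)[OF e(3)] e by blast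
    show ?thesis
    proof (cases "lv r = 0")
      case True
      then have "\<not> S u" using S_lv[of u] e(5) by auto
      then have "v = v'" using up[of u] E[OF e(1)] lvn(1)[OF e(1)] e by blast
      then show ?thesis using q by simp
    next
      case False
      then obtain l where "E l r" using down[of r] E[OF e(3)] e(7) by blast
      then show ?thesis using through[of l r q u _ v] through[of l r q u _ v'] e q by blast
    qed
  qed
  have up1: "ht v u < ht q r \<longleftrightarrow> ht v' u < ht q' r"
    if e: "E v u" "E v' u" "E q r" "E q' r" "lv u = lv r" "u \<noteq> r" "\<not> S r" for u v v' r q q'
  proof -
    have q: "q = q'" using down[of r] E[OF e(3)] e by fastforce
    show ?thesis
    proof (cases "lv r = n")
      case True
      then have "\<not> S u" using S_lv[of u] e(5) by auto
      then have "v = v'" using down[of u] E[OF e(1)] e by fastforce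
      then show ?thesis using q by simp
    next
      case False
      then obtain l where "E r l" using up[of r] E[OF e(3)] lv_le[of r] e(7) by fastforce
      then show ?thesis using through[of q r l u v] through[of q r l u v'] e q by blast
    qed
  qed
  show ?thesis
  proof (rule level_order_from_edge_heights[of ht])
    show "ht u v \<noteq> ht u' v'" if "E u v" "E u' v'" "lv u = lv u'" "(u, v) \<noteq> (u', v')" for u v u' v'
      using dist that .
    \<comment> \<open>At most one of \<open>u\<close> and \<open>r\<close> is marked by
      \<open>S\<close>. If it is \<open>r\<close>, the roles are exchanged; since heights are
      distinct, this reverses both comparisons.\<close>
    show "ht u v < ht r q \<longleftrightarrow> ht u v' < ht r q'"
      if e: "E u v" "E u v'" "E r q" "E r q'" "lv u = lv r" "u \<noteq> r" for u v v' r q q'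
    proof (cases "S r")
      case True
      then have "\<not> S u" using S_unique[of u r] E[OF e(1)] E[OF e(3)] e by auto
      then have "ht r q < ht u v \<longleftrightarrow> ht r q' < ht u v'"
        using low1[OF e(3,4,1,2) e(5)[symmetric] e(6)[symmetric]] by blast
      moreover have "ht u v \<noteq> ht r q" "ht u v' \<noteq> ht r q'"
        using dist[OF e(1,3,5)] dist[OF e(2,4,5)] e(6) by auto
      ultimately show ?thesis using flip by blast
    next
      case False
      then show ?thesis by (rule low1[OF e])
    qed
    show "ht v u < ht q r \<longleftrightarrow> ht v' u < ht q' r"
      if e: "E v u" "E v' u" "E q r" "E q' r" "lv u = lv r" "u \<noteq> r" for u v v' r q q'
    proof (cases "S r")
      case True
      then have "\<not> S u" using S_unique[of u r] E[OF e(1)] E[OF e(3)] e by auto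
      then have "ht q r < ht v u \<longleftrightarrow> ht q' r < ht v' u"
        using up1[OF e(3,4,1,2) e(5)[symmetric] e(6)[symmetric]] by blast
      moreover have "ht v u \<noteq> ht q r" "ht v' u \<noteq> ht q' r"
        using dist[OF e(1,3) lv_eq[OF e(1,3,5)]] dist[OF e(2,4) lv_eq[OF e(2,4,5)]] e(6) by auto
      ultimately show ?thesis using flip by blast
    next
      case False
      then show ?thesis by (rule up1[OF e])
    qed
    show "ht a v < ht l r \<longleftrightarrow> ht v b < ht r q"
      if e: "E a v" "E v b" "E l r" "E r q" "lv v = lv r" "v \<noteq> r" for a v b l r q
      using through[of l r q v a b] e by blast
  qed (use that in blast)
qed

end

section \<open>Geometric realisations\<close>

lemma embedding_map_of_compact:
  fixes g :: "'a::t2_space \<Rightarrow> 'b::metric_space"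
  assumes "compact S" "continuous_on S g" "inj_on g S" "g ` S \<subseteq> T"
  shows "embedding_map (top_of_set S) (top_of_set T) g"
  using assms
  by (intro continuous_imp_embedding_map)
    (auto simp: compact_space_subtopology Hausdorff_space_subtopology continuous_map_in_subtopology
      image_subset_iff_funcset)

lemma embedding_map_setD:
  assumes "embedding_map (top_of_set S) (top_of_set T) g"
  shows "continuous_on S g" "inj_on g S" "g ` S \<subseteq> T"
proof -
  have h: "homeomorphic_map (top_of_set S) (subtopology (top_of_set T) (g ` S)) g"
    using assms by (simp add: embedding_map_def)
  then show "inj_on g S" using homeomorphic_imp_injective_map by fastforce
  have "continuous_map (top_of_set S) (top_of_set T) g"
    using homeomorphic_imp_continuous_map[OF h] continuous_map_in_subtopology by blast
  then show "continuous_on S g" "g ` S \<subseteq> T"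
    by (auto simp: continuous_map_in_subtopology)
qed

section \<open>Barycentric coordinates on edges and simplices\<close>

definition edge_point :: "'v::finite \<Rightarrow> 'v \<Rightarrow> real \<Rightarrow> real ^ 'v" where
  "edge_point u v l = (1 - l) *\<^sub>R axis u 1 + l *\<^sub>R axis v 1"

lemma edge_point_0 [simp]: "edge_point u v 0 = axis u 1"
  and edge_point_1 [simp]: "edge_point u v 1 = axis v 1"
  by (simp_all add: edge_point_def)

lemma edge_point_swap: "edge_point u v l = edge_point v u (1 - l)"
  by (simp add: edge_point_def add.commute)

lemma continuous_on_edge_point [continuous_intros]:
  "continuous_on S h \<Longrightarrow> continuous_on S (\<lambda>x. edge_point u v (h x))"
  unfolding edge_point_def by (intro continuous_intros)

lemma axis_nth_if: "axis u (1::real) $ w = (if u = w then 1 else 0)"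
  by (simp add: axis_def)

lemma edge_point_nth: "edge_point u v l $ w = (if u = w then 1 - l else 0) + (if v = w then l else 0)"
  by (simp add: edge_point_def axis_nth_if)

text \<open>The linear extension of a function given on the vertices.\<close>

definition vertex_functional :: "('v::finite \<Rightarrow> real) \<Rightarrow> real ^ 'v \<Rightarrow> real" where
  "vertex_functional h x = (\<Sum>v\<in>UNIV. x $ v * h v)"

lemma linear_vertex_functional: "linear (vertex_functional h)"
  by (rule linearI) (simp_all add: vertex_functional_def distrib_right sum.distrib sum_distrib_left mult.assoc)

lemma vertex_functional_axis [simp]: "vertex_functional h (axis v 1) = h v"
proof -
  have "vertex_functional h (axis v 1) = (\<Sum>u\<in>UNIV. if v = u then h u else 0)"
    unfolding vertex_functional_def by (rule sum.cong) (auto simp: axis_nth_if)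
  then show ?thesis by simp
qed

lemma vertex_functional_edge_point [simp]:
  "vertex_functional h (edge_point u v l) = (1 - l) * h u + l * h v"
  unfolding edge_point_def by (simp add: linear_add[OF linear_vertex_functional] linear_cmul[OF linear_vertex_functional])

lemma continuous_on_vertex_functional [continuous_intros]:
  "continuous_on S g \<Longrightarrow> continuous_on S (\<lambda>x. vertex_functional h (g x))"
  unfolding vertex_functional_def by (intro continuous_intros)

lemma linear_geom_map: "linear (geom_map f)"
  by (rule linearI) (simp_all add: geom_map_def scaleR_add_left sum.distrib scaleR_sum_right)

lemma geom_map_axis [simp]: "geom_map f (axis v 1) = axis (f v) 1"
proof -
  have "geom_map f (axis v 1) = (\<Sum>u\<in>UNIV. if v = u then axis (f u) 1 else 0)"
    unfolding geom_map_def by (rule sum.cong) (auto simp: axis_nth_if)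
  then show ?thesis by simp
qed

lemma geom_map_edge_point [simp]: "geom_map f (edge_point u v l) = edge_point (f u) (f v) l"
  unfolding edge_point_def by (simp add: linear_add[OF linear_geom_map] linear_cmul[OF linear_geom_map])

text \<open>Coordinates of the ambient space are barycentric coordinates; in this form intersections
  of simplices become intersections of vertex sets.\<close>

lemma mem_hull_axis_iff:
  fixes x :: "real ^ 'v::finite"
  shows "x \<in> convex hull ((\<lambda>v. axis v 1) ` s) \<longleftrightarrow>
    (\<forall>v. 0 \<le> x $ v) \<and> (\<forall>v. v \<notin> s \<longrightarrow> x $ v = 0) \<and> (\<Sum>v\<in>UNIV. x $ v) = 1"
proof
  assume x: "x \<in> convex hull ((\<lambda>v. axis v 1) ` s)"
  let ?R = "{x::real ^ 'v. (\<forall>v. 0 \<le> x $ v) \<and> (\<forall>v. v \<notin> s \<longrightarrow> x $ v = 0) \<and> (\<Sum>v\<in>UNIV. x $ v) = 1}"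
  have "convex ?R"
  proof (rule convexI)
    fix x y and a b :: real
    assume "x \<in> ?R" "y \<in> ?R" "0 \<le> a" "0 \<le> b" "a + b = 1"
    then show "a *\<^sub>R x + b *\<^sub>R y \<in> ?R"
      by (simp add: sum.distrib sum_distrib_left[symmetric])
  qed
  moreover have "(\<lambda>v. axis v 1) ` s \<subseteq> ?R"
    by (auto simp: axis_nth_if)
  ultimately have "convex hull ((\<lambda>v. axis v 1) ` s) \<subseteq> ?R" by (intro hull_minimal)
  then show "(\<forall>v. 0 \<le> x $ v) \<and> (\<forall>v. v \<notin> s \<longrightarrow> x $ v = 0) \<and> (\<Sum>v\<in>UNIV. x $ v) = 1"
    using x by auto
next
  assume x: "(\<forall>v. 0 \<le> x $ v) \<and> (\<forall>v. v \<notin> s \<longrightarrow> x $ v = 0) \<and> (\<Sum>v\<in>UNIV. x $ v) = 1"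
  have "(\<Sum>v\<in>s. x $ v) = (\<Sum>v\<in>UNIV. x $ v)" using x by (intro sum.mono_neutral_left) auto
  then have "(\<Sum>v\<in>s. x $ v *\<^sub>R axis v 1) \<in> convex hull ((\<lambda>v. axis v (1::real)) ` s)"
    using x by (intro convex_sum) (auto intro: hull_inc)
  moreover have "(\<Sum>v\<in>s. x $ v *\<^sub>R axis v 1) = x"
  proof (rule vec_eq_iff[THEN iffD2, rule_format])
    fix w
    have "(\<Sum>v\<in>s. x $ v *\<^sub>R axis v 1) $ w = (\<Sum>v\<in>s. if v = w then x $ w else 0)"
      unfolding sum_component by (rule sum.cong) (auto simp: axis_nth_if)
    then show "(\<Sum>v\<in>s. x $ v *\<^sub>R axis v 1) $ w = x $ w" using x by auto
  qed
  ultimately show "x \<in> convex hull ((\<lambda>v. axis v 1) ` s)" by simp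
qed

lemma simplicial_complex_geom:
  fixes G :: "'v::finite graph"
  assumes "is_graph G"
  obtains T where "simplicial_complex T" "\<Union>T = geom G"
proof -
  let ?h = "\<lambda>s. convex hull ((\<lambda>v. axis v (1::real)) ` s) :: (real ^ 'v) set"
  \<comment> \<open>The empty simplex is included, being a face of every simplex and the
    intersection of disjoint ones.\<close>
  define K where "K = insert {} (simplices G)"
  have down: "t \<in> K" if "s \<in> K" "t \<subseteq> s" for s t
  proof -
    consider "s = {}" | v where "v \<in> verts G" "s = {v}" | "s \<in> edges G"
      using \<open>s \<in> K\<close> by (auto simp: K_def simplices_def)
    then show ?thesis
    proof cases
      case 1 then show ?thesis using that by (auto simp: K_def)
    next
      case 2 then show ?thesis using that by (auto simp: K_def simplices_def)
    next
      case 3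
      then have s: "s \<subseteq> verts G" "card s = 2" using assms by (auto simp: is_graph_def)
      then obtain u v where "s = {u, v}" by (meson card_2_iff)
      then have "t = {} \<or> t = {u} \<or> t = {v} \<or> t = s" using that(2) by auto
      then show ?thesis using \<open>s \<in> K\<close> s \<open>s = {u, v}\<close> by (auto simp: K_def simplices_def)
    qed
  qed
  have indep: "\<not> affine_dependent ((\<lambda>v. axis v (1::real)) ` s :: (real ^ 'v) set)" for s :: "'v set"
  proof -
    have "(\<lambda>v. axis v (1::real)) ` s \<subseteq> (Basis :: (real ^ 'v) set)" by (auto simp: axis_in_Basis_iff)
    then have "independent ((\<lambda>v. axis v (1::real)) ` s :: (real ^ 'v) set)"
      using independent_Basis independent_mono by blast
    then show ?thesis using affine_dependent_imp_dependent by blast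
  qed
  have face: "F face_of ?h s \<longleftrightarrow> (\<exists>t\<subseteq>s. F = ?h t)" for F s
    unfolding face_of_convex_hull_affine_independent[OF indep] by (metis subset_image_iff image_mono)
  have inter: "?h s \<inter> ?h t = ?h (s \<inter> t)" for s t
    by (auto simp: mem_hull_axis_iff)
  have "simplicial_complex (?h ` K)"
    unfolding simplicial_complex_def
  proof (intro conjI ballI allI impI)
    show "finite (?h ` K)" by simp
    show "\<exists>n. n simplex X" if X: "X \<in> ?h ` K" for X
    proof -
      obtain s where "X = ?h s" using X by blast
      then have "(int (card ((\<lambda>v. axis v (1::real)) ` s :: (real ^ 'v) set)) - 1) simplex X"
        using simplex_convex_hull[OF conjI[OF indep]] by simp
      then show ?thesis by blast
    qed
    show "F \<in> ?h ` K" if "X \<in> ?h ` K \<and> F face_of X" for F X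
      using that down face by fastforce
    show "X \<inter> Y face_of X" if XY: "X \<in> ?h ` K \<and> Y \<in> ?h ` K" for X Y
    proof -
      obtain s t where "X = ?h s" "Y = ?h t" using XY by blast
      then show ?thesis using inter[of s t] face[of "?h (s \<inter> t)" s] by auto
    qed
  qed
  moreover have "\<Union>(?h ` K) = geom G" by (simp add: K_def geom_def)
  ultimately show ?thesis by (rule that)
qed

lemma compact_geom: "compact (geom G)"
  unfolding geom_def by (rule compact_UN) (simp_all add: finite_imp_compact_convex_hull)

lemma vertex_in_geom: "v \<in> verts G \<Longrightarrow> axis v 1 \<in> geom G"
  unfolding geom_def simplices_def by (auto intro: hull_inc)

lemma edge_point_in_geom:
  assumes "{u, v} \<in> edges G" "0 \<le> l" "l \<le> 1"
  shows "edge_point u v l \<in> geom G"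
proof -
  have "edge_point u v l \<in> convex hull ((\<lambda>v. axis v 1) ` {u, v})"
    using assms by (auto simp: segment_convex_hull[symmetric] closed_segment_def edge_point_def)
  then show ?thesis using assms(1) unfolding geom_def simplices_def by blast
qed

lemma geom_cases:
  assumes "is_graph G" "x \<in> geom G"
  obtains v where "v \<in> verts G" "x = axis v 1"
  | u v l where "{u, v} \<in> edges G" "0 < l" "l < 1" "x = edge_point u v l"
proof -
  obtain s where s: "s \<in> simplices G" "x \<in> convex hull ((\<lambda>v. axis v 1) ` s)"
    using assms(2) by (auto simp: geom_def)
  show ?thesis
  proof (cases "s \<in> edges G")
    case False
    then obtain v where "v \<in> verts G" "s = {v}" using s(1) by (auto simp: simplices_def)
    then show ?thesis using that(1) s(2) by simp
  next
    case True
    then obtain u v where uv: "s = {u, v}" using assms(1) by (meson card_2_iff is_graph_def)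
    then have V: "u \<in> verts G" "v \<in> verts G" using True assms(1) by (auto simp: is_graph_def)
    have "x \<in> closed_segment (axis u 1) (axis v 1)" using s(2) uv by (simp add: segment_convex_hull)
    then obtain l where l: "0 \<le> l" "l \<le> 1" "x = edge_point u v l"
      by (auto simp: closed_segment_def edge_point_def)
    consider "l = 0" | "l = 1" | "0 < l" "l < 1" using l by linarith
    then show ?thesis using that V l True uv by cases auto
  qed
qed

section \<open>Stable maps to a path\<close>

definition plane_to_complex :: "real ^ 2 \<Rightarrow> complex" where
  "plane_to_complex z = Complex (z $ 1) (z $ 2)"

definition complex_to_plane :: "complex \<Rightarrow> real ^ 2" where
  "complex_to_plane z = vector [Re z, Im z]"

lemma plane_to_complex_inverse [simp]:
  "plane_to_complex (complex_to_plane z) = z" "complex_to_plane (plane_to_complex x) = x"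
  by (simp_all add: plane_to_complex_def complex_to_plane_def vec_eq_iff forall_2)

lemma cmod_plane_to_complex: "cmod (plane_to_complex x - plane_to_complex y) = dist x y"
  by (simp add: plane_to_complex_def cmod_def dist_norm norm_vec_def L2_set_def sum_2)

lemma continuous_on_plane_to_complex [continuous_intros]:
  assumes "continuous_on S g"
  shows "continuous_on S (\<lambda>x. plane_to_complex (g x))"
proof (rule continuous_on_compose2[OF _ assms subset_UNIV])
  show "continuous_on UNIV plane_to_complex"
    unfolding continuous_on_iff dist_complex_def cmod_plane_to_complex by auto
qed

lemma continuous_on_complex_to_plane [continuous_intros]:
  assumes "continuous_on S g"
  shows "continuous_on S (\<lambda>x. complex_to_plane (g x))"
proof (rule continuous_on_compose2[OF _ assms subset_UNIV])
  have "dist (complex_to_plane a) (complex_to_plane b) = dist a b" for a b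
    by (metis cmod_plane_to_complex dist_norm plane_to_complex_inverse(1))
  then show "continuous_on UNIV complex_to_plane" unfolding continuous_on_iff by auto
qed

section \<open>The path as the interval of its levels\<close>

locale path_parametrisation =
  fixes vs :: "'w::finite list" and J :: "'w graph"
  assumes distinct: "distinct vs" and len: "2 \<le> length vs" and verts: "verts J = set vs"
    and edges: "edges J = {{vs ! k, vs ! Suc k} | k. Suc k < length vs}"
begin

definition n :: nat where "n = length vs - 1"

definition level :: "'w \<Rightarrow> nat" where "level w = (THE k. k \<le> n \<and> vs ! k = w)"

lemma n_pos: "0 < n" using len by (simp add: n_def)

lemma length_vs: "length vs = Suc n" using len by (simp add: n_def)

lemma nth_eq: "a \<le> n \<Longrightarrow> b \<le> n \<Longrightarrow> vs ! a = vs ! b \<longleftrightarrow> a = b"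
  using distinct by (simp add: nth_eq_iff_index_eq length_vs)

lemma level_nth [simp]: "k \<le> n \<Longrightarrow> level (vs ! k) = k"
  unfolding level_def by (rule the_equality) (auto simp: nth_eq)

lemma nth_level: "w \<in> verts J \<Longrightarrow> vs ! level w = w"
  and level_le: "w \<in> verts J \<Longrightarrow> level w \<le> n"
  by (auto simp: verts in_set_conv_nth length_vs less_Suc_eq_le)

lemma nth_in_verts: "k \<le> n \<Longrightarrow> vs ! k \<in> verts J"
  by (simp add: verts length_vs)

lemma level_inj: "w \<in> verts J \<Longrightarrow> w' \<in> verts J \<Longrightarrow> level w = level w' \<Longrightarrow> w = w'"
  by (metis nth_level)

lemma edge_iff: "{w, w'} \<in> edges J \<longleftrightarrow>
  w \<in> verts J \<and> w' \<in> verts J \<and> (level w' = Suc (level w) \<or> level w = Suc (level w'))"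
proof
  assume "{w, w'} \<in> edges J"
  then obtain k where k: "k < n" "{w, w'} = {vs ! k, vs ! Suc k}"
    unfolding edges by (auto simp: length_vs)
  then have "w = vs ! k \<and> w' = vs ! Suc k \<or> w' = vs ! k \<and> w = vs ! Suc k" by (auto simp: doubleton_eq_iff)
  then show "w \<in> verts J \<and> w' \<in> verts J \<and> (level w' = Suc (level w) \<or> level w = Suc (level w'))"
    using k(1) by (auto simp: nth_in_verts)
next
  assume r: "w \<in> verts J \<and> w' \<in> verts J \<and> (level w' = Suc (level w) \<or> level w = Suc (level w'))"
  have e: "{vs ! level a, vs ! Suc (level a)} \<in> edges J" if "Suc (level a) \<le> n" for a
    unfolding edges using that by (auto simp: length_vs)
  from r show "{w, w'} \<in> edges J"
  proof (elim conjE disjE)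
    assume "w \<in> verts J" "w' \<in> verts J" "level w' = Suc (level w)"
    then show ?thesis using e[of w] nth_level[of w] nth_level[of w'] level_le[of w'] by simp
  next
    assume "w \<in> verts J" "w' \<in> verts J" "level w = Suc (level w')"
    then show ?thesis using e[of w'] nth_level[of w] nth_level[of w'] level_le[of w]
      by (simp add: insert_commute)
  qed
qed

lemma edge_nth: "k < n \<Longrightarrow> {vs ! k, vs ! Suc k} \<in> edges J"
  by (simp add: edge_iff nth_in_verts)

lemma edgeE:
  assumes "e \<in> edges J"
  obtains k where "k < n" "e = {vs ! k, vs ! Suc k}"
  using assms unfolding edges by (auto simp: length_vs)

lemma is_graph_path: "is_graph J"
  unfolding is_graph_def
proof
  fix e assume "e \<in> edges J"
  then obtain k where "k < n" "e = {vs ! k, vs ! Suc k}" by (rule edgeE)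
  then show "e \<subseteq> verts J \<and> card e = 2" using nth_eq[of k "Suc k"] by (simp add: nth_in_verts)
qed

text \<open>An end of the path lies on a single edge. For a stable map this keeps the non-regular
  vertices strictly between the two ends.\<close>

lemma vdeg_eq_2:
  assumes "vdeg J w = 2" "w \<in> verts J"
  shows "0 < level w \<and> level w < n"
proof (rule ccontr)
  assume not: "\<not> (0 < level w \<and> level w < n)"
  let ?k = "level w"
  have "{e \<in> edges J. w \<in> e} \<subseteq> (if ?k = 0 then {{vs ! 0, vs ! Suc 0}} else {{vs ! (n - 1), vs ! n}})"
  proof
    fix e assume e: "e \<in> {e \<in> edges J. w \<in> e}"
    then obtain k where k: "k < n" "e = {vs ! k, vs ! Suc k}" by (auto elim: edgeE)
    then have "?k = k \<or> ?k = Suc k" using e by auto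
    then show "e \<in> (if ?k = 0 then {{vs ! 0, vs ! Suc 0}} else {{vs ! (n - 1), vs ! n}})"
      using k not level_le[OF assms(2)] by auto
  qed
  then have "card {e \<in> edges J. w \<in> e} \<le> card (if ?k = 0 then {{vs ! 0, vs ! Suc 0}} else {{vs ! (n - 1), vs ! n}})"
    by (intro card_mono) auto
  also have "\<dots> \<le> 1" by simp
  finally show False using assms(1) by (simp add: vdeg_def)
qed

lemma neighbour_in_star:
  assumes "w \<in> verts J" "w' \<in> verts J" "level w' = Suc (level w) \<or> level w = Suc (level w')"
  shows "w' \<in> star J w"
  using edge_iff[of w w'] assms unfolding star_def by blast

definition curve :: "real \<Rightarrow> real ^ 'w" where
  "curve t = interp n (\<lambda>k. axis (vs ! k) 1) t"

text \<open>The inverse of \<open>curve\<close> on \<open>geom J\<close>, written as a linear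
  functional so that its composition with \<open>geom_map f\<close> is one as well.\<close>

definition height :: "real ^ 'w \<Rightarrow> real" where
  "height = vertex_functional (\<lambda>w. real (level w))"

lemma curve_segment: "k < n \<Longrightarrow> 0 \<le> l \<Longrightarrow> l \<le> 1 \<Longrightarrow> curve (real k + l) = edge_point (vs ! k) (vs ! Suc k) l"
  unfolding curve_def by (simp add: interp_segment edge_point_def)

lemma continuous_on_curve: "continuous_on S curve"
  unfolding curve_def by (intro continuous_intros)

lemma curve_height_in:
  assumes "t \<in> {0..real n}"
  shows "curve t \<in> geom J" "height (curve t) = t"
proof -
  obtain k l where k: "k < n" "0 \<le> l" "l \<le> 1" "t = real k + l"
    using segment_index[of t n] assms n_pos by auto
  show "curve t \<in> geom J" unfolding k(4) curve_segment[OF k(1-3)]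
    using edge_point_in_geom[OF edge_nth] k by auto
  have "height (curve t) = (1 - l) * real k + l * real (Suc k)"
    unfolding k(4) curve_segment[OF k(1-3)] height_def using k(1) by simp
  then show "height (curve t) = t" using k(4) by (simp add: algebra_simps)
qed

lemma height_curve:
  assumes "y \<in> geom J"
  shows "height y \<in> {0..real n}" "curve (height y) = y"
proof -
  have *: "height y \<in> {0..real n} \<and> curve (height y) = y"
    if k: "k < n" "0 \<le> l" "l \<le> 1" "y = edge_point (vs ! k) (vs ! Suc k) l" for k l
  proof -
    have y: "y = curve (real k + l)" using curve_segment[OF k(1-3)] k(4) by simp
    have "real k + 1 \<le> real n" using k(1) by linarith
    then have "real k + l \<in> {0..real n}" using k by auto
    then show ?thesis using curve_height_in y by simp
  qed
  have "height y \<in> {0..real n} \<and> curve (height y) = y"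
    using is_graph_path assms
  proof (cases rule: geom_cases)
    case (1 v)
    then have v: "v = vs ! level v" "level v \<le> n" using nth_level level_le by auto
    show ?thesis
    proof (cases "level v = n")
      case True
      then show ?thesis using *[of "n - 1" 1] n_pos 1 v by simp
    next
      case False
      then show ?thesis using *[of "level v" 0] 1 v by simp
    qed
  next
    case (2 u v l)
    have uv: "u \<in> verts J" "v \<in> verts J" "level v = Suc (level u) \<or> level u = Suc (level v)"
      using 2(1) edge_iff by auto
    then show ?thesis
    proof (elim disjE)
      assume s: "level v = Suc (level u)"
      then have "level u < n" using level_le[OF uv(2)] by simp
      moreover have "u = vs ! level u" "v = vs ! Suc (level u)" using nth_level uv s by metis+
      ultimately show ?thesis using *[of "level u" l] 2 by simp
    next
      assume s: "level u = Suc (level v)"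
      then have "level v < n" using level_le[OF uv(1)] by simp
      moreover have "v = vs ! level v" "u = vs ! Suc (level v)" using nth_level uv s by metis+
      moreover have "y = edge_point v u (1 - l)" using 2(4) edge_point_swap by simp
      ultimately show ?thesis using *[of "level v" "1 - l"] 2 by simp
    qed
  qed
  then show "height y \<in> {0..real n}" "curve (height y) = y" by auto
qed

lemma continuous_on_height [continuous_intros]:
  "continuous_on S g \<Longrightarrow> continuous_on S (\<lambda>x. height (g x))"
  unfolding height_def by (intro continuous_intros)

lemma inj_on_curve: "inj_on curve {0..real n}"
  by (rule inj_on_inverseI[of _ height]) (rule curve_height_in)

end

section \<open>The levelled graph of a stable map\<close>

locale stable_over_path = path_parametrisation vs J for vs :: "'w::finite list" and J +
  fixes G :: "'v::finite graph" and f :: "'v \<Rightarrow> 'w"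
  assumes graph: "is_graph G" and simplicial: "simplicial_map G J f" and stable: "stable_map G J f"
begin

definition lv :: "'v \<Rightarrow> nat" where "lv v = level (f v)"

definition E :: "'v \<Rightarrow> 'v \<Rightarrow> bool" where "E u v \<longleftrightarrow> {u, v} \<in> edges G \<and> lv v = Suc (lv u)"

definition S :: "'v \<Rightarrow> bool" where "S v \<longleftrightarrow> v \<in> verts G \<and> \<not> regular_vertex G J f v"

lemma f_verts: "v \<in> verts G \<Longrightarrow> f v \<in> verts J"
proof -
  assume "v \<in> verts G"
  then have "{v} \<in> simplices G" by (simp add: simplices_def)
  then have "f ` {v} \<in> simplices J" using simplicial unfolding simplicial_map_def by blast
  then show ?thesis using is_graph_path by (auto simp: simplices_def is_graph_def)
qed

lemma edge_verts: "{u, v} \<in> edges G \<Longrightarrow> u \<in> verts G \<and> v \<in> verts G \<and> u \<noteq> v"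
  using graph unfolding is_graph_def by force

lemma S_vdeg: "S v \<Longrightarrow> vdeg J (f v) = 2"
  using stable f_verts[of v] unfolding stable_map_def S_def by blast

lemma S_unique: "S v \<Longrightarrow> S r \<Longrightarrow> f v = f r \<Longrightarrow> v = r"
proof -
  assume s: "S v" "S r" "f v = f r"
  let ?N = "{u \<in> verts G. f u = f v \<and> \<not> regular_vertex G J f u}"
  have "card ?N \<le> Suc 0"
    using stable f_verts[of v] S_vdeg[OF s(1)] s(1) unfolding stable_map_def S_def by auto
  then show "v = r" using s card_le_Suc0_iff_eq[of ?N] unfolding S_def by auto
qed

text \<open>A collapsed edge lies in the stars of both its ends, so both are non-regular over the
  same vertex, against stability.\<close>

lemma edge_not_collapsed:
  assumes "{u, v} \<in> edges G"
  shows "f u \<noteq> f v"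
proof
  assume eq: "f u = f v"
  have uv: "u \<in> verts G" "v \<in> verts G" "u \<noteq> v" using edge_verts[OF assms] by auto
  have "{u, v} \<subseteq> star G x" if "x \<in> {u, v}" for x
    using assms that unfolding star_def by blast
  then have "\<not> inj_on f (star G x)" if "x \<in> {u, v}" for x
    using that eq uv(3) unfolding inj_on_def by blast
  then have "S u" "S v" using uv unfolding S_def regular_vertex_def bij_betw_def by auto
  then show False using S_unique eq uv(3) by blast
qed

lemma image_edge: "{u, v} \<in> edges G \<Longrightarrow> {f u, f v} \<in> edges J"
proof -
  assume e: "{u, v} \<in> edges G"
  then have "f ` {u, v} \<in> simplices J" using simplicial unfolding simplicial_map_def simplices_def by blast
  then show ?thesis using edge_not_collapsed[OF e] by (auto simp: simplices_def doubleton_eq_iff)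
qed

lemma edge_orientation: "{u, v} \<in> edges G \<Longrightarrow> E u v \<or> E v u"
  using image_edge[of u v] unfolding E_def lv_def edge_iff by (auto simp: insert_commute)

lemma star_edge: "q \<in> star G v \<Longrightarrow> q \<noteq> v \<Longrightarrow> {v, q} \<in> edges G"
proof -
  assume q: "q \<in> star G v" "q \<noteq> v"
  then obtain e where e: "e \<in> edges G" "v \<in> e" "q \<in> e" by (auto simp: star_def)
  then have "card e = 2" using graph by (auto simp: is_graph_def)
  then have "e = {v, q}" using e q(2) by (auto simp: card_2_iff)
  then show ?thesis using e by simp
qed

text \<open>The neighbour of \<open>f v\<close> on level \<open>k\<close> has exactly one preimage
  in the star of \<open>v\<close>, and any vertex of the star other than \<open>v\<close> is joined
  to \<open>v\<close>.\<close>

lemma regular_neighbour: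
  assumes v: "v \<in> verts G" "\<not> S v" and k: "k \<le> n" "k = Suc (lv v) \<or> lv v = Suc k"
  shows "\<exists>!q. {v, q} \<in> edges G \<and> lv q = k"
proof -
  have b: "bij_betw f (star G v) (star J (f v))" using v by (auto simp: S_def regular_vertex_def)
  have "vs ! k \<in> star J (f v)"
    by (rule neighbour_in_star[OF f_verts[OF v(1)] nth_in_verts[OF k(1)]]) (use k in \<open>auto simp: lv_def\<close>)
  then have "vs ! k \<in> f ` star G v" using b by (simp add: bij_betw_def)
  then obtain q where q: "q \<in> star G v" "f q = vs ! k" by (metis imageE)
  have lq: "lv q = k" using q(2) k(1) by (simp add: lv_def)
  then have "q \<noteq> v" using k by auto
  show ?thesis
  proof (rule ex1I[of _ q])
    show "{v, q} \<in> edges G \<and> lv q = k" using star_edge[OF q(1) \<open>q \<noteq> v\<close>] lq by simp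
    fix q' assume q': "{v, q'} \<in> edges G \<and> lv q' = k"
    then have "q' \<in> star G v" unfolding star_def by blast
    moreover have "f q' = f q"
      using q' lq level_inj f_verts edge_verts star_edge[OF q(1) \<open>q \<noteq> v\<close>] unfolding lv_def by metis
    ultimately show "q' = q" using b q(1) by (auto simp: bij_betw_def inj_on_def)
  qed
qed

sublocale levelled_graph "verts G" lv E S n
proof
  show "finite (verts G)" by simp
  show "0 < n" by (rule n_pos)
  show "u \<in> verts G \<and> v \<in> verts G \<and> lv v = Suc (lv u)" if "E u v" for u v
    using that edge_verts by (auto simp: E_def)
  show "lv v \<le> n" if "v \<in> verts G" for v using level_le f_verts that by (simp add: lv_def)
  show "0 < lv v \<and> lv v < n" if "S v" for v
    using vdeg_eq_2[OF S_vdeg[OF that]] f_verts that by (simp add: lv_def S_def)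
  show "v = r" if "v \<in> verts G" "r \<in> verts G" "S v" "S r" "lv v = lv r" for v r
    using S_unique level_inj f_verts that by (simp add: lv_def)
  show "\<exists>!q. E v q" if "v \<in> verts G" "\<not> S v" "lv v < n" for v
    using regular_neighbour[of v "Suc (lv v)"] that by (simp add: E_def)
  show "\<exists>!l. E l v" if v: "v \<in> verts G" "\<not> S v" "0 < lv v" for v
  proof -
    obtain k where k: "lv v = Suc k" using v(3) gr0_conv_Suc by auto
    have "k \<le> n" using k level_le[OF f_verts[OF v(1)]] by (simp add: lv_def)
    then have "\<exists>!q. {v, q} \<in> edges G \<and> lv q = k" using regular_neighbour[OF v(1,2)] k by auto
    then show ?thesis unfolding E_def k by (simp add: insert_commute eq_commute)
  qed
qed

lemma geom_map_in:
  assumes "x \<in> geom G"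
  shows "geom_map f x \<in> geom J"
  using graph assms
proof (cases rule: geom_cases)
  case (1 v) then show ?thesis using vertex_in_geom f_verts by auto
next
  case (2 u v l) then show ?thesis using edge_point_in_geom[OF image_edge[OF 2(1)], of l] by simp
qed

lemma height_geom_map: "height (geom_map f x) = vertex_functional (\<lambda>v. real (lv v)) x"
proof -
  have "height (geom_map f x) = (\<Sum>v\<in>UNIV. height ((x $ v) *\<^sub>R axis (f v) 1))"
    unfolding geom_map_def height_def by (rule linear_sum[OF linear_vertex_functional])
  also have "\<dots> = (\<Sum>v\<in>UNIV. x $ v * real (lv v))"
    unfolding height_def by (simp add: linear_cmul[OF linear_vertex_functional] lv_def)
  finally show ?thesis by (simp add: vertex_functional_def)
qed

lemma geom_cases_oriented:
  assumes "x \<in> geom G"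
  obtains v where "v \<in> verts G" "x = axis v 1"
  | u v l where "E u v" "0 < l" "l < 1" "x = edge_point u v l"
  using graph assms
proof (cases rule: geom_cases)
  case (1 v) then show ?thesis using that by blast
next
  case (2 u v l)
  then show ?thesis
    using edge_orientation[OF 2(1)] that(2)[of u v l] that(2)[of v u "1 - l"] edge_point_swap[of u v l] by auto
qed

text \<open>The lift is linear on each simplex, with the linear extension of \<open>H\<close> as
  second coordinate. The first coordinate determines the level and the position within an edge, so
  only points at the same position over the same edge of the path can collide, and there the vertex
  heights decide.\<close>

lemma lifts_if_level_order:
  assumes "level_order H"
  shows "lifts_to_embedding G J f"
proof -
  have H1: "H v \<noteq> H r" if "v \<in> verts G" "r \<in> verts G" "lv v = lv r" "v \<noteq> r" for v r
    using assms that unfolding level_order_def by blast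
  have H2: "H v \<le> H v'" if "E u v" "E u' v'" "lv u = lv u'" "H u < H u'" for u v u' v'
    using assms that unfolding level_order_def by blast
  define F where "F x = (geom_map f x, vertex_functional H x)" for x
  have lin: "linear F" unfolding F_def
    by (rule linearI) (simp_all add: linear_add[OF linear_geom_map] linear_cmul[OF linear_geom_map]
      linear_add[OF linear_vertex_functional] linear_cmul[OF linear_vertex_functional])
  obtain T where T: "simplicial_complex T" "\<Union>T = geom G" using simplicial_complex_geom[OF graph] by blast
  have pl: "piecewise_linear_on (geom G) F"
    unfolding piecewise_linear_on_def
    by (intro exI[of _ T] conjI T ballI exI[of _ 0] exI[of _ F] lin) simp
  \<comment> \<open>The lower ends have positive weight \<open>1 - l\<close>, so the weak inequality
    at the upper ends is enough.\<close>
  have less: "(1 - l) * H u + l * H v < (1 - l) * H u' + l * H v'"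
    if "E u v" "E u' v'" "lv u = lv u'" "0 < l" "l < 1" "H u < H u'" for u v u' v' and l :: real
    using H2[OF that(1,2,3,6)] that by (intro add_less_le_mono mult_strict_left_mono mult_left_mono) auto
  have inj: "inj_on F (geom G)"
  proof (rule inj_onI)
    fix x y assume xy: "x \<in> geom G" "y \<in> geom G" "F x = F y"
    have L: "vertex_functional (\<lambda>v. real (lv v)) x = vertex_functional (\<lambda>v. real (lv v)) y"
      using xy(3) height_geom_map[of x] height_geom_map[of y] by (simp add: F_def)
    have Hxy: "vertex_functional H x = vertex_functional H y" using xy(3) by (simp add: F_def)
    have lve: "vertex_functional (\<lambda>v. real (lv v)) (edge_point u v l) = real (lv u) + l" if "E u v" for u v l
      using that by (simp add: E_def algebra_simps)
    have frac: "a = b \<and> l = m" if "real a + l = real b + m" "0 \<le> l" "l < 1" "0 \<le> m" "m < 1" for a b :: nat and l m :: real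
    proof -
      have "a = b" using that by linarith
      then show ?thesis using that(1) by simp
    qed
    from xy(1) show "x = y"
    proof (cases rule: geom_cases_oriented)
      case x: (1 v)
      from xy(2) show ?thesis
      proof (cases rule: geom_cases_oriented)
        case y: (1 r)
        then show ?thesis using x L Hxy H1[of v r] by auto
      next
        case y: (2 u r l)
        then show ?thesis using L x lve[OF y(1)] frac[of "lv v" 0 "lv u" l] by simp
      qed
    next
      case x: (2 u v l)
      from xy(2) show ?thesis
      proof (cases rule: geom_cases_oriented)
        case y: (1 r)
        then show ?thesis using L x lve[OF x(1)] frac[of "lv r" 0 "lv u" l] by simp
      next
        case y: (2 u' v' m)
        have lm: "lv u = lv u'" "l = m"
          using L lve[OF x(1)] lve[OF y(1)] x y frac[of "lv u" l "lv u'" m] by auto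
        have Heq: "(1 - l) * H u + l * H v = (1 - l) * H u' + l * H v'"
          using Hxy x y lm by simp
        have V: "u \<in> verts G" "v \<in> verts G" "u' \<in> verts G" "v' \<in> verts G" "lv v = lv v'"
          using E[OF x(1)] E[OF y(1)] lm by auto
        have "\<not> H u < H u'" "\<not> H u' < H u"
          using less[OF x(1) y(1) lm(1) x(2,3)] less[OF y(1) x(1) lm(1)[symmetric] x(2,3)] Heq by auto
        then have u: "u = u'" using H1[of u u'] V lm by force
        then have "H v = H v'" using Heq x(2) by simp
        then have "v = v'" using H1[of v v'] V by blast
        then show ?thesis using u lm x y by simp
      qed
    qed
  qed
  have "continuous_on (geom G) F" using lin by (simp add: linear_continuous_on linear_conv_bounded_linear)
  moreover have "F ` geom G \<subseteq> geom J \<times> UNIV" using geom_map_in by (auto simp: F_def)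
  ultimately have "embedding_map (top_of_set (geom G)) (top_of_set (geom J \<times> UNIV)) F"
    using embedding_map_of_compact[OF compact_geom] inj by blast
  then show ?thesis
    unfolding lifts_to_embedding_def by (intro exI[of _ F] conjI pl ballI) (simp_all add: F_def)
qed

end

section \<open>The two implications\<close>

context stable_over_path
begin

text \<open>In the level parameter \<open>geom_map f\<close> runs along an edge of \<open>G\<close>
  exactly as \<open>curve\<close> does, so an approximation restricted to the edges yields strands
  close to \<open>c\<close> at equal times; its injectivity lets them meet only in common
  vertices.\<close>

lemma approximable_imp_lifts:
  fixes i :: "real ^ 'w \<Rightarrow> real ^ 2"
  assumes i: "embedding_map (top_of_set (geom J)) euclidean i"
    and approx: "approximable_by_embeddings G f i"
  shows "lifts_to_embedding G J f"
proof -
  define c where "c t = plane_to_complex (i (curve t))" for t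
  have i': "continuous_on (geom J) i" "inj_on i (geom J)"
    using embedding_map_setD[of "geom J" UNIV i] i by auto
  have c: "continuous_on {0..real n} c"
    unfolding c_def using curve_height_in(1)
    by (intro continuous_intros continuous_on_compose2[OF i'(1) continuous_on_curve]) auto
  have ci: "inj_on c {0..real n}"
  proof (rule inj_onI)
    fix s t assume st: "s \<in> {0..real n}" "t \<in> {0..real n}" "c s = c t"
    then have "i (curve s) = i (curve t)" unfolding c_def by (metis plane_to_complex_inverse(2))
    then have "curve s = curve t" using inj_onD[OF i'(2)] curve_height_in(1) st by blast
    then show "s = t" using inj_onD[OF inj_on_curve] st by blast
  qed
  have "\<exists>g gv.
      (\<forall>u v. E u v \<longrightarrow> continuous_on {real (lv u)..real (lv v)} (g u v) \<and>
        g u v (real (lv u)) = gv u \<and> g u v (real (lv v)) = gv v \<and>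
        (\<forall>t\<in>{real (lv u)..real (lv v)}. cmod (g u v t - c t) < \<epsilon>)) \<and>
      (\<forall>u v u' v' s t. E u v \<and> E u' v' \<and> s \<in> {real (lv u)..real (lv v)} \<and> t \<in> {real (lv u')..real (lv v')} \<and>
        g u v s = g u' v' t \<longrightarrow>
        s = t \<and> (u = u' \<and> v = v' \<or> s = real (lv u) \<and> u \<in> {u', v'} \<or> s = real (lv v) \<and> v \<in> {u', v'}))"
    if \<epsilon>: "\<epsilon> > 0" for \<epsilon>
  proof -
    obtain j :: "real ^ 'v \<Rightarrow> real ^ 2" where j: "embedding_map (top_of_set (geom G)) euclidean j"
      "\<And>x. x \<in> geom G \<Longrightarrow> dist (j x) (i (geom_map f x)) < \<epsilon>"
      using approx \<epsilon> unfolding approximable_by_embeddings_def by blast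
    have j': "continuous_on (geom G) j" "inj_on j (geom G)"
      using embedding_map_setD[of "geom G" UNIV j] j(1) by auto
    define g where "g u v t = plane_to_complex (j (edge_point u v (t - real (lv u))))" for u v t
    define gv where "gv v = plane_to_complex (j (axis v 1))" for v
    have lvE: "real (lv v) = real (lv u) + 1" if "E u v" for u v using that by (simp add: E_def)
    have inG: "edge_point u v (t - real (lv u)) \<in> geom G"
      if "E u v" "t \<in> {real (lv u)..real (lv v)}" for u v t
      using that lvE[OF that(1)] by (intro edge_point_in_geom) (auto simp: E_def)
    have 1: "continuous_on {real (lv u)..real (lv v)} (g u v) \<and>
        g u v (real (lv u)) = gv u \<and> g u v (real (lv v)) = gv v \<and>
        (\<forall>t\<in>{real (lv u)..real (lv v)}. cmod (g u v t - c t) < \<epsilon>)" if e: "E u v" for u v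
    proof (intro conjI ballI)
      show "continuous_on {real (lv u)..real (lv v)} (g u v)"
        unfolding g_def using inG[OF e]
        by (intro continuous_intros continuous_on_compose2[OF j'(1)]) auto
      show "g u v (real (lv u)) = gv u" "g u v (real (lv v)) = gv v"
        using lvE[OF e] by (simp_all add: g_def gv_def)
      fix t assume t: "t \<in> {real (lv u)..real (lv v)}"
      have V: "u \<in> verts G" "v \<in> verts G" "lv v = Suc (lv u)" using E[OF e] by auto
      have fu: "f u = vs ! lv u" "f v = vs ! Suc (lv u)"
        using nth_level[OF f_verts[OF V(1)]] nth_level[OF f_verts[OF V(2)]] V(3) by (auto simp: lv_def)
      have "lv u < n" using lv_le[OF V(2)] V(3) by simp
      from curve_segment[OF this, of "t - real (lv u)"]
      have "geom_map f (edge_point u v (t - real (lv u))) = curve t"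
        using t lvE[OF e] fu by simp
      then show "cmod (g u v t - c t) < \<epsilon>"
        using j(2)[OF inG[OF e t]] by (simp add: g_def c_def cmod_plane_to_complex)
    qed
    have 2: "s = t \<and> (u = u' \<and> v = v' \<or> s = real (lv u) \<and> u \<in> {u', v'} \<or> s = real (lv v) \<and> v \<in> {u', v'})"
      if e: "E u v" "E u' v'" and st: "s \<in> {real (lv u)..real (lv v)}" "t \<in> {real (lv u')..real (lv v')}"
        and eq: "g u v s = g u' v' t" for u v u' v' s t
    proof -
      define l where "l = s - real (lv u)"
      define m where "m = t - real (lv u')"
      have l: "0 \<le> l" "l \<le> 1" "0 \<le> m" "m \<le> 1"
        using st lvE[OF e(1)] lvE[OF e(2)] by (auto simp: l_def m_def)
      have "j (edge_point u v l) = j (edge_point u' v' m)"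
        using eq unfolding g_def l_def m_def by (metis plane_to_complex_inverse(2))
      then have pt: "edge_point u v l = edge_point u' v' m"
        using inj_onD[OF j'(2)] inG[OF e(1) st(1)] inG[OF e(2) st(2)] unfolding l_def m_def by blast
      have "real (lv u) + l = real (lv u') + m"
        using arg_cong[OF pt, of "vertex_functional (\<lambda>v. real (lv v))"] lvE[OF e(1)] lvE[OF e(2)]
        by (simp add: algebra_simps)
      then have st': "s = t" by (simp add: l_def m_def)
      \<comment> \<open>A vertex with positive barycentric weight in a common point belongs to both
        edges.\<close>
      have uin: "u \<in> {u', v'}" if "l \<noteq> 1"
        using arg_cong[OF pt, of "\<lambda>x. x $ u"] l that by (auto simp: edge_point_nth split: if_splits)
      have vin: "v \<in> {u', v'}" if "l \<noteq> 0"
        using arg_cong[OF pt, of "\<lambda>x. x $ v"] l that by (auto simp: edge_point_nth split: if_splits)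
      consider "l = 0" | "l = 1" | "l \<noteq> 0" "l \<noteq> 1" by blast
      then show ?thesis
      proof cases
        case 1 then show ?thesis using uin st' by (simp add: l_def)
      next
        case 2 then show ?thesis using vin st' lvE[OF e(1)] by (simp add: l_def)
      next
        case 3
        then have "u = u' \<and> v = v'" using uin vin e by (auto simp: E_def)
        then show ?thesis using st' by simp
      qed
    qed
    show ?thesis using 1 2 by (intro exI[of _ g] exI[of _ gv]) blast
  qed
  then obtain H where "level_order H" by (rule level_order_from_strands[OF c ci])
  then show ?thesis by (rule lifts_if_level_order)
qed

lemma lifts_imp_approximable:
  fixes i :: "real ^ 'w \<Rightarrow> real ^ 2"
  assumes i: "embedding_map (top_of_set (geom J)) euclidean i"
    and lifts: "lifts_to_embedding G J f"
  shows "approximable_by_embeddings G f i"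
  unfolding approximable_by_embeddings_def
proof (intro allI impI)
  fix \<epsilon> :: real assume "\<epsilon> > 0"
  obtain F :: "real ^ 'v \<Rightarrow> (real ^ 'w) \<times> real" where
    F: "embedding_map (top_of_set (geom G)) (top_of_set (geom J \<times> UNIV)) F"
      "\<And>x. x \<in> geom G \<Longrightarrow> geom_map f x = fst (F x)"
    using lifts unfolding lifts_to_embedding_def by blast
  note F' = embedding_map_setD[OF F(1)]
  have i': "continuous_on (geom J) i" "inj_on i (geom J)"
    using embedding_map_setD[of "geom J" UNIV i] i by auto
  define c where "c t = plane_to_complex (i (curve (real n * t)))" for t
  have scale: "real n * t \<in> {0..real n}" if "t \<in> {0..1}" for t
    using that by (auto simp: mult_left_le)
  have c: "continuous_on {0..1} c"
    unfolding c_def using curve_height_in(1) scale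
    by (intro continuous_intros continuous_on_compose2[OF i'(1)] continuous_on_compose2[OF continuous_on_curve[of UNIV]]) auto
  have ci: "inj_on c {0..1}"
  proof (rule inj_onI)
    fix s t :: real assume st: "s \<in> {0..1}" "t \<in> {0..1}" "c s = c t"
    then have "i (curve (real n * s)) = i (curve (real n * t))" unfolding c_def by (metis plane_to_complex_inverse(2))
    then have "curve (real n * s) = curve (real n * t)"
      using inj_onD[OF i'(2)] curve_height_in(1) scale st by blast
    then have "real n * s = real n * t" using inj_onD[OF inj_on_curve] scale st by blast
    then show "s = t" using n_pos by simp
  qed
  obtain \<Phi> :: "real \<times> real \<Rightarrow> complex" where \<Phi>: "continuous_on ({0..1} \<times> {-1..1}) \<Phi>" "inj_on \<Phi> ({0..1} \<times> {-1..1})"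
    "\<And>t s. t \<in> {0..1} \<Longrightarrow> s \<in> {-1..1} \<Longrightarrow> cmod (\<Phi> (t, s) - c t) < \<epsilon>"
    using arc_thickening[OF c ci \<open>\<epsilon> > 0\<close>] by blast
  have "compact ((\<lambda>x. snd (F x)) ` geom G)"
    by (intro compact_continuous_image continuous_intros F'(1) compact_geom)
  then obtain B where B: "B > 0" "\<And>x. x \<in> geom G \<Longrightarrow> \<bar>snd (F x)\<bar> \<le> B"
    using compact_imp_bounded bounded_pos by (metis image_eqI real_norm_def)
  \<comment> \<open>The lift in ribbon coordinates: division by \<open>n\<close> and by the bound
    \<open>B\<close> puts it into \<open>{0..1} \<times> {-1..1}\<close>.\<close>
  define a where "a x = (height (geom_map f x) / real n, snd (F x) / B)" for x
  have a_in: "a x \<in> {0..1} \<times> {-1..1}" if "x \<in> geom G" for x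
    using height_curve(1)[OF geom_map_in[OF that]] B(1) B(2)[OF that] n_pos
    by (auto simp: a_def field_simps abs_le_iff)
  have a_cont: "continuous_on (geom G) a"
    unfolding a_def using B(1) n_pos
    by (intro continuous_intros F'(1) linear_continuous_on linear_conv_bounded_linear[THEN iffD1] linear_geom_map) auto
  have a_inj: "inj_on a (geom G)"
  proof (rule inj_onI)
    fix x y assume xy: "x \<in> geom G" "y \<in> geom G" "a x = a y"
    then have "height (geom_map f x) = height (geom_map f y)" "snd (F x) = snd (F y)"
      using B(1) n_pos by (auto simp: a_def)
    then have "F x = F y"
      using height_curve(2)[OF geom_map_in[OF xy(1)]] height_curve(2)[OF geom_map_in[OF xy(2)]] F(2) xy
      by (metis prod_eqI)
    then show "x = y" using inj_onD[OF F'(2)] xy by blast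
  qed
  define j where "j x = complex_to_plane (\<Phi> (a x))" for x
  have "continuous_on (geom G) j"
    unfolding j_def by (intro continuous_intros continuous_on_compose2[OF \<Phi>(1) a_cont] image_subsetI a_in)
  moreover have "inj_on j (geom G)"
  proof (rule inj_onI)
    fix x y assume xy: "x \<in> geom G" "y \<in> geom G" "j x = j y"
    then have "\<Phi> (a x) = \<Phi> (a y)" unfolding j_def by (metis plane_to_complex_inverse(1))
    then have "a x = a y" using inj_onD[OF \<Phi>(2)] a_in xy by blast
    then show "x = y" using inj_onD[OF a_inj] xy by blast
  qed
  ultimately have "embedding_map (top_of_set (geom G)) euclidean j"
    using embedding_map_of_compact[OF compact_geom, of G j UNIV] by simp
  moreover have "dist (j x) (i (geom_map f x)) < \<epsilon>" if x: "x \<in> geom G" for x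
  proof -
    have "c (height (geom_map f x) / real n) = plane_to_complex (i (geom_map f x))"
      using height_curve(2)[OF geom_map_in[OF x]] n_pos by (simp add: c_def)
    then have "cmod (plane_to_complex (j x) - plane_to_complex (i (geom_map f x))) < \<epsilon>"
      using \<Phi>(3)[of "height (geom_map f x) / real n" "snd (F x) / B"] a_in[OF x] by (simp add: j_def a_def)
    then show ?thesis by (simp add: cmod_plane_to_complex)
  qed
  ultimately show "\<exists>j. embedding_map (top_of_set (geom G)) euclidean j \<and>
      (\<forall>x\<in>geom G. dist (j x) (i (geom_map f x)) < \<epsilon>)"
    by blast
qed

end

theorem theorem7:
  fixes G :: "'v::finite graph" and J :: "'w::finite graph"
    and f :: "'v \<Rightarrow> 'w" and i :: "real ^ 'w \<Rightarrow> real ^ 2"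
  assumes "is_graph G" and "path_graph J"
    and "simplicial_map G J f" and "stable_map G J f"
    and "embedding_map (top_of_set (geom J)) euclidean i"
  shows "approximable_by_embeddings G f i \<longleftrightarrow> lifts_to_embedding G J f"
proof -
  obtain vs where vs: "distinct vs" "2 \<le> length vs" "verts J = set vs"
    "edges J = {{vs ! k, vs ! Suc k} | k. Suc k < length vs}"
    using assms(2) unfolding path_graph_def by blast
  interpret stable_over_path vs J G f
    by unfold_locales (use assms vs in auto)
  show ?thesis
    using approximable_imp_lifts lifts_imp_approximable assms(5) by blast
qed

end
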